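(* Let $K\subset\mathbb{R}^2$ be a compact convex set with boundary of class $C^2$ and support function $p$ of class $C^2$, let $F$ be the area of $K$ and $L$ the length of $\partial K$. Let $c_k^2=a_k^2+b_k^2$, where $a_k,b_k$ are the Fourier coefficients of $p$. Then for every integer $m\ge1$, $$\int_{P\notin K}(\omega^m-\sin^m\omega)\,dP=-\pi^mF+M_m\frac{L^2}{2\pi}+\pi\sum_{k\ge2}\beta_k c_k^2,$$ where $\omega=\omega(P)$ is the visual angle of $K$ from $P$ on the left-hand side, and $$M_m=\int_0^\pi\frac{(\omega^m-\sin^m\omega)'}{1-\cos\omega}\,d\omega,\qquad \beta_k=\int_0^\pi\frac{(\omega^m-\sin^m\omega)'\,g_k(\omega)}{\sin^2\omega}\,d\omega,$$ $$g_k(\omega)=1+\frac{(-1)^k}{2}\bigl((k+1)\cos((k-1)\omega)-(k-1)\cos((k+1)\omega)\bigr).$$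
   Context: The support function of a compact convex set $K$ is the $2\pi$-periodic function $p(\varphi)=\sup\{x\cos\varphi+y\sin\varphi : (x,y)\in K\}$, with Fourier series $p(\varphi)=a_0+\sum_{n\ge1}(a_n\cos n\varphi+b_n\sin n\varphi)$. For $P\notin K$, the visual angle $\omega(P)\in(0,\pi)$ is the angle between the two tangent lines from $P$ to $\partial K$ (the angle at $P$ under which $K$ is seen). $dP$ denotes Lebesgue (area) measure on $\mathbb{R}^2$, and $\int_{P\notin K}$ is integration over $\mathbb{R}^2\setminus K$. Primes denote derivatives with respect to $\omega$. *)

theory Defs
  imports "HOL-Analysis.Analysis"
begin

definition C2_fun :: "(real \<Rightarrow> 'a::real_normed_vector) \<Rightarrow> bool" where
  "C2_fun f \<longleftrightarrow> (\<exists>f' f''.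
     (\<forall>t. (f has_vector_derivative f' t) (at t)) \<and>
     (\<forall>t. (f' has_vector_derivative f'' t) (at t)) \<and>
     continuous_on UNIV f'')"

text \<open>The curve is a regular, 1-periodic \<open>C\<^sup>2\<close> parametrisation, simple on one period, of the
  boundary. Asking for \<open>C\<^sup>2\<close> regularity of the periodic curve on the whole line includes regularity
  at the closing point. For compact convex \<open>K\<close> the existence of such a curve is the assumption that
  the boundary is of class \<open>C\<^sup>2\<close>; it forces \<open>K\<close> to have nonempty interior.\<close>
definition C2_boundary_param :: "(real^2) set \<Rightarrow> (real \<Rightarrow> real^2) \<Rightarrow> bool" where
  "C2_boundary_param K \<gamma> \<longleftrightarrow>
     C2_fun \<gamma> \<and> (\<forall>t. vector_derivative \<gamma> (at t) \<noteq> 0) \<and> (\<forall>t. \<gamma> (t + 1) = \<gamma> t) \<and>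
     simple_path \<gamma> \<and> path_image \<gamma> = frontier K"

definition curve_length :: "(real \<Rightarrow> real^2) \<Rightarrow> real" where
  "curve_length \<gamma> = integral {0..1} (\<lambda>t. norm (vector_derivative \<gamma> (at t)))"

definition support_fun :: "(real^2) set \<Rightarrow> real \<Rightarrow> real" where
  "support_fun K \<phi> = (SUP P\<in>K. P $ 1 * cos \<phi> + P $ 2 * sin \<phi>)"

definition fourier_a :: "(real \<Rightarrow> real) \<Rightarrow> nat \<Rightarrow> real" where
  "fourier_a p n = (if n = 0 then 1 / (2 * pi) else 1 / pi) *
     integral {0..2*pi} (\<lambda>\<phi>. p \<phi> * cos (real n * \<phi>))"

definition fourier_b :: "(real \<Rightarrow> real) \<Rightarrow> nat \<Rightarrow> real" where
  "fourier_b p n = 1 / pi * integral {0..2*pi} (\<lambda>\<phi>. p \<phi> * sin (real n * \<phi>))"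

text \<open>Unit directions of the rays from \<open>P\<close> to the points where a line through \<open>P\<close> is tangent to
  the curve.\<close>
definition tangent_dirs :: "(real \<Rightarrow> real^2) \<Rightarrow> real^2 \<Rightarrow> (real^2) set" where
  "tangent_dirs \<gamma> P = {u. norm u = 1 \<and>
     (\<exists>t s c. 0 < s \<and> \<gamma> t = P + s *\<^sub>R u \<and> vector_derivative \<gamma> (at t) = c *\<^sub>R u)}"

text \<open>From a point outside a compact convex set with boundary \<open>\<gamma>\<close> there are exactly two tangent
  lines. Using the rays towards the points of tangency selects, among the two supplementary angles
  formed by these lines, the one under which the set is seen. The value is only
  meaningful for such points.\<close>
definition visual_angle :: "(real \<Rightarrow> real^2) \<Rightarrow> real^2 \<Rightarrow> real" where
  "visual_angle \<gamma> P =
     (THE \<omega>. \<exists>u v. u \<noteq> v \<and> tangent_dirs \<gamma> P = {u, v} \<and> \<omega> = arccos (u \<bullet> v))"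

definition omega_fun :: "nat \<Rightarrow> real \<Rightarrow> real" where
  "omega_fun m \<omega> = \<omega> ^ m - sin \<omega> ^ m"

definition g_fun :: "nat \<Rightarrow> real \<Rightarrow> real" where
  "g_fun k \<omega> = 1 + (- 1) ^ k / 2 *
     ((real k + 1) * cos ((real k - 1) * \<omega>) - (real k - 1) * cos ((real k + 1) * \<omega>))"

text \<open>The denominators below vanish only at endpoints of \<open>[0, \<pi>]\<close>, a null set.\<close>
definition M_integrand :: "nat \<Rightarrow> real \<Rightarrow> real" where
  "M_integrand m \<omega> = deriv (omega_fun m) \<omega> / (1 - cos \<omega>)"

definition beta_integrand :: "nat \<Rightarrow> nat \<Rightarrow> real \<Rightarrow> real" where
  "beta_integrand m k \<omega> = deriv (omega_fun m) \<omega> * g_fun k \<omega> / (sin \<omega>)\<^sup>2"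

definition M_coeff :: "nat \<Rightarrow> real" where
  "M_coeff m = (LINT \<omega>:{0..pi}|lborel. M_integrand m \<omega>)"

definition beta_coeff :: "nat \<Rightarrow> nat \<Rightarrow> real" where
  "beta_coeff m k = (LINT \<omega>:{0..pi}|lborel. beta_integrand m k \<omega>)"

end

theory Submission
  imports Defs
begin

text \<open>
  Write \<open>h\<^sub>P(\<phi>) = p(\<phi>) - P \<bullet> n(\<phi>)\<close> for the support function of \<open>K\<close> seen from \<open>P\<close>, where \<open>n(\<phi>)\<close> is the
  unit vector of angle \<open>\<phi>\<close>. A point \<open>P\<close> lies outside \<open>K\<close> exactly when \<open>h\<^sub>P\<close> is negative somewhere, and
  then \<open>h\<^sub>P\<close> has exactly two zeros \<open>\<phi>\<close> and \<open>\<phi> + \<delta>\<close> modulo \<open>2\<pi>\<close>, with \<open>0 < \<delta> < \<pi>\<close>: the normal angles of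
  the two tangent lines. The visual angle is \<open>\<omega> = \<pi> - \<delta>\<close>. Hence \<open>(\<phi>, \<delta>)\<close> are global coordinates on the
  exterior of \<open>K\<close> (\<open>meet_surj\<close>, \<open>meet_inj\<close>, \<open>visual_angle_meet\<close>), and their area element is
  \<open>T\<^sub>1 T\<^sub>2 / sin \<delta> d\<phi> d\<delta>\<close> with \<open>T\<^sub>1, T\<^sub>2\<close> the lengths of the two tangent segments (\<open>det_meet'\<close>).

  The integral over \<open>\<phi>\<close> only involves the autocorrelation \<open>R(\<delta>) = \<integral> p(\<phi>) p(\<phi> + \<delta>) d\<phi>\<close> and its first two
  derivatives, and it is the derivative of
  \<open>A(\<delta>) = (R(0) - cos \<delta> R(\<delta>) + sin \<delta> R'(\<delta>)) / sin\<^sup>2 \<delta>\<close> (\<open>iso_area_deriv\<close>). Geometrically \<open>A(\<delta>)\<close> is the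
  area enclosed by the isoptic curve of angle \<open>\<pi> - \<delta>\<close>; in particular \<open>A(0+) = (R(0) + R''(0)) / 2\<close> is
  the area \<open>F\<close> of \<open>K\<close> (\<open>area_K\<close>). For \<open>f(\<omega>) = \<omega>\<^sup>m - sin\<^sup>m \<omega>\<close> an integration by parts gives
  \<open>\<integral> f(\<omega>(P)) dP = \<integral> f(\<pi> - \<delta>) A'(\<delta>) d\<delta> = - \<pi>\<^sup>m F + \<integral> f'(\<pi> - \<delta>) A(\<delta>) d\<delta>\<close>, where the boundary term at
  \<open>\<delta> = \<pi>\<close> vanishes because \<open>f(\<omega>) = O(\<omega> (1 - cos \<omega>))\<close> (\<open>integrate_isoptic_area\<close>).

  Finally, \<open>R\<close> has the cosine series \<open>2\<pi> a\<^sub>0\<^sup>2 + \<pi> \<Sum> c\<^sub>k\<^sup>2 cos k\<delta>\<close> (\<open>r0_series\<close>), so that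
  \<open>sin\<^sup>2 \<delta> A(\<delta>)\<close> is the series with \<open>cos k\<delta>\<close> replaced by the kernel
  \<open>1 - cos \<delta> cos k\<delta> - k sin \<delta> sin k\<delta> = g\<^sub>k(\<pi> - \<delta>)\<close>. The derivative of this kernel is
  \<open>(1 - k\<^sup>2) sin \<delta> cos k\<delta>\<close>, which bounds it by \<open>(k\<^sup>2 + 1)(1 - cos \<delta>)\<close>; as \<open>p\<close> is \<open>C\<^sup>2\<close>, \<open>k\<^sup>4 c\<^sub>k\<^sup>2\<close> is bounded,
  and sum and integral may be exchanged (\<open>integral_isoptic_area_series\<close>). The kernel vanishes for
  \<open>k = 1\<close>; for \<open>k = 0\<close> it yields the term \<open>M\<^sub>m\<close>, whose factor is identified by Cauchy's formula
  \<open>L = \<integral> p = 2\<pi> a\<^sub>0\<close> (\<open>curve_length_eq\<close>).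
\<close>

section \<open>Periodic integrals and uniqueness of cosine coefficients\<close>

lemma integral_periodic_shift:
  fixes f :: "real \<Rightarrow> real"
  assumes f: "continuous_on UNIV f" and per: "\<And>x. f (x + T) = f x" and T: "0 \<le> T" and d: "0 \<le> d"
  shows "integral {0..T} (\<lambda>x. f (x + d)) = integral {0..T} f"
proof -
  have int: "f integrable_on {a..b}" for a b
    by (intro integrable_continuous_real continuous_on_subset[OF f]) auto
  have shift: "integral {a..b} (\<lambda>x. f (x + c)) = integral {a + c..b + c} f" for a b c
    using integral_shift_real_ivl[of "a + c" c "b + c" f] by simp
  have "integral {0..d} f + integral {d..T + d} f = integral {0..T} f + integral {T..T + d} f"
    using Henstock_Kurzweil_Integration.integral_combine[of 0 d "T + d" f] Henstock_Kurzweil_Integration.integral_combine[of 0 T "T + d" f] T d int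
    by simp
  moreover have "integral {T..T + d} f = integral {0..d} f"
    using shift[of 0 d T] per by (simp add: add.commute)
  moreover have "integral {0..T} (\<lambda>x. f (x + d)) = integral {d..T + d} f"
    using shift[of 0 T d] by simp
  ultimately show ?thesis by simp
qed

lemma has_integral_deriv_periodic:
  fixes f :: "real \<Rightarrow> real"
  assumes "\<And>x. (f has_real_derivative f' x) (at x)" "f T = f 0" "0 \<le> T"
  shows "(f' has_integral 0) {0..T}"
  using fundamental_theorem_of_calculus[of 0 T f f'] assms
  by (simp add: has_real_derivative_iff_has_vector_derivative has_vector_derivative_at_within)

lemma integral_cos_nat: "integral {0..2*pi} (\<lambda>x. cos (real k * x)) = (if k = 0 then 2 * pi else 0)"
proof (cases "k = 0")
  case False
  have "((\<lambda>x. sin (real k * x) / real k) has_real_derivative cos (real k * x)) (at x)" for x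
    using False by (auto intro!: derivative_eq_intros)
  then have "((\<lambda>x. cos (real k * x)) has_integral 0) {0..2*pi}"
    by (rule has_integral_deriv_periodic) (use sin_npi[of "2 * k"] in \<open>auto simp: mult_ac\<close>)
  then show ?thesis using False by (simp add: integral_unique)
qed simp

lemma cos_mult_cos_nat:
  "cos (real j * x) * cos (real k * x) = (cos (real (j + k) * x) + cos (real (if j \<le> k then k - j else j - k) * x)) / 2"
proof (cases "j \<le> k")
  case True
  have "cos (real j * x) * cos (real k * x) = (cos (real k * x - real j * x) + cos (real k * x + real j * x)) / 2"
    using cos_times_cos[of "real k * x" "real j * x"] by (simp add: mult.commute)
  then show ?thesis using True by (simp add: algebra_simps of_nat_diff)
next
  case False
  then show ?thesis using cos_times_cos[of "real j * x" "real k * x"] by (simp add: algebra_simps of_nat_diff)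
qed

lemma integral_cos_cos_nat:
  "integral {0..2*pi} (\<lambda>x. cos (real j * x) * cos (real k * x)) = (if j = k then if k = 0 then 2 * pi else pi else 0)"
proof -
  have int: "(\<lambda>x. cos (real i * x)) integrable_on {0..2*pi}" for i
    by (intro integrable_continuous_real continuous_intros)
  have "integral {0..2*pi} (\<lambda>x. cos (real j * x) * cos (real k * x)) =
    (integral {0..2*pi} (\<lambda>x. cos (real (j + k) * x)) + integral {0..2*pi} (\<lambda>x. cos (real (if j \<le> k then k - j else j - k) * x))) / 2"
    unfolding cos_mult_cos_nat integral_divide by (subst integral_add[OF int int]) simp
  then show ?thesis unfolding integral_cos_nat by (auto split: if_splits)
qed

text \<open>A function symmetric about \<open>\<pi>\<close> is a continuous function of \<open>cos x\<close>, hence a uniform limit of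
  polynomials in \<open>cos x\<close>. By the product formula these polynomials are combinations of the
  \<open>cos kx\<close>, so such a function with vanishing cosine coefficients is orthogonal to itself.\<close>
lemma cosine_coefficients_zero_imp_zero:
  fixes e :: "real \<Rightarrow> real"
  assumes cont: "continuous_on {0..2*pi} e" and refl: "\<And>x. 0 \<le> x \<Longrightarrow> x \<le> 2 * pi \<Longrightarrow> e (2 * pi - x) = e x"
    and coeff: "\<And>k::nat. integral {0..2*pi} (\<lambda>x. e x * cos (real k * x)) = 0"
    and x: "0 \<le> x" "x \<le> 2 * pi"
  shows "e x = 0"
proof -
  have int: "(\<lambda>x. e x * g x) integrable_on {0..2*pi}" if "continuous_on {0..2*pi} g" for g
    by (intro integrable_continuous_real continuous_intros cont that)
  have pow: "integral {0..2*pi} (\<lambda>x. e x * (cos x ^ n * cos (real k * x))) = 0" for n k :: nat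
  proof (induction n arbitrary: k)
    case 0 show ?case using coeff by simp
  next
    case (Suc n)
    define i where "i = (if 1 \<le> k then k - 1 else 1 - k)"
    have "e x * (cos x ^ Suc n * cos (real k * x)) =
      e x * (cos x ^ n * cos (real (1 + k) * x)) / 2 + e x * (cos x ^ n * cos (real i * x)) / 2" for x
    proof -
      have "cos x * cos (real k * x) = (cos (real (1 + k) * x) + cos (real i * x)) / 2"
        using cos_mult_cos_nat[of 1 x k] unfolding i_def by simp
      then have "e x * (cos x ^ n * (cos x * cos (real k * x))) = e x * (cos x ^ n * ((cos (real (1 + k) * x) + cos (real i * x)) / 2))"
        by simp
      then show ?thesis by (simp only: power_Suc2 mult.assoc) (simp only: distrib_left add_divide_distrib times_divide_eq_right)
    qed
    then have "integral {0..2*pi} (\<lambda>x. e x * (cos x ^ Suc n * cos (real k * x))) =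
      integral {0..2*pi} (\<lambda>x. e x * (cos x ^ n * cos (real (1 + k) * x)) / 2) + integral {0..2*pi} (\<lambda>x. e x * (cos x ^ n * cos (real i * x)) / 2)"
      by (simp only:) (intro integral_add integrable_on_divide int continuous_intros)
    then show ?case unfolding integral_divide Suc.IH by simp
  qed
  have poly: "integral {0..2*pi} (\<lambda>x. e x * g (cos x)) = 0" if "real_polynomial_function g" for g
  proof -
    obtain a n where g: "g = (\<lambda>x. \<Sum>i\<le>n. a i * x ^ i)" using \<open>real_polynomial_function g\<close> real_polynomial_function_iff_sum by auto
    have "e x * g (cos x) = (\<Sum>i\<le>n. a i * (e x * (cos x ^ i * cos (real 0 * x))))" for x
      unfolding g sum_distrib_left by (intro sum.cong) auto
    then have "integral {0..2*pi} (\<lambda>x. e x * g (cos x)) = (\<Sum>i\<le>n. integral {0..2*pi} (\<lambda>x. a i * (e x * (cos x ^ i * cos (real 0 * x)))))"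
      by (simp only:) (intro integral_sum integrable_on_mult_right int continuous_intros finite_atMost)
    also have "\<dots> = 0" unfolding integral_mult_right pow by simp
    finally show ?thesis .
  qed
  obtain M where M: "M > 0" "\<And>x. x \<in> {0..2*pi} \<Longrightarrow> \<bar>e x\<bar> \<le> M"
    using compact_imp_bounded[OF compact_continuous_image[OF cont compact_Icc]] unfolding bounded_pos by auto
  have arc: "e (arccos (cos y)) = e y" if "y \<in> {0..2*pi}" for y
  proof (cases "y \<le> pi")
    case True then show ?thesis using that by (simp add: arccos_cos)
  next
    case False
    have "cos y = cos (2 * pi - y)" by (simp add: cos_diff)
    then have "arccos (cos y) = 2 * pi - y" using False that by (simp add: arccos_cos del: cos_2pi_minus)
    then show ?thesis using refl[of y] that by simp
  qed
  have sq_int: "(\<lambda>x. e x * e x) integrable_on {0..2*pi}" by (rule int[OF cont])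
  have small: "integral {0..2*pi} (\<lambda>x. e x * e x) \<le> \<epsilon> * (2 * pi * M)" if \<epsilon>: "\<epsilon> > 0" for \<epsilon>
  proof -
    have "continuous_on {-1..1} (\<lambda>y. e (arccos y))"
      by (rule continuous_on_compose2[OF cont continuous_on_arccos']) (auto intro!: arccos_lbound order_trans[OF arccos_ubound])
    then obtain g where g: "real_polynomial_function g" "\<And>y. y \<in> {-1..1} \<Longrightarrow> \<bar>e (arccos y) - g y\<bar> < \<epsilon>"
      using Stone_Weierstrass_real_polynomial_function[OF compact_Icc _ \<epsilon>] by blast
    have gc: "continuous_on {0..2*pi} (\<lambda>x. g (cos x))"
    proof -
      have "continuous_on UNIV g"
        using g(1) continuous_real_polymonial_function by (blast intro: continuous_at_imp_continuous_on)
      then show ?thesis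
        by (rule continuous_on_compose2[OF _ continuous_on_cos[OF continuous_on_id]]) auto
    qed
    have "integral {0..2*pi} (\<lambda>x. e x * e x) = integral {0..2*pi} (\<lambda>x. e x * e x - e x * g (cos x))"
      using integral_diff[OF sq_int int[OF gc]] poly[OF g(1)] by simp
    also have "\<dots> \<le> integral {0..2*pi} (\<lambda>x. \<epsilon> * M)"
    proof (rule integral_le)
      show "(\<lambda>x. e x * e x - e x * g (cos x)) integrable_on {0..2*pi}"
        by (intro integrable_diff sq_int int[OF gc])
      fix y assume y: "y \<in> {0..2*pi}"
      have "e y * e y - e y * g (cos y) = e y * (e (arccos (cos y)) - g (cos y))" using arc[OF y] by (simp add: algebra_simps)
      also have "\<dots> \<le> \<bar>e y\<bar> * \<bar>e (arccos (cos y)) - g (cos y)\<bar>" by (metis abs_ge_self abs_mult)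
      also have "\<dots> \<le> M * \<epsilon>" using M(2)[OF y] g(2)[of "cos y"] M(1) by (intro mult_mono) auto
      finally show "e y * e y - e y * g (cos y) \<le> \<epsilon> * M" by (simp add: mult.commute)
    qed auto
    also have "\<dots> = \<epsilon> * (2 * pi * M)" by simp
    finally show ?thesis .
  qed
  have "integral {0..2*pi} (\<lambda>x. e x * e x) \<le> 0"
  proof (rule field_le_epsilon)
    fix h :: real assume "h > 0"
    then show "integral {0..2*pi} (\<lambda>x. e x * e x) \<le> 0 + h"
      using small[of "h / (2 * pi * M)"] M(1) pi_gt_zero by simp
  qed
  moreover have "integral {0..2*pi} (\<lambda>x. e x * e x) \<ge> 0" by (rule integral_nonneg[OF sq_int]) simp
  ultimately have "integral {0..2*pi} (\<lambda>x. e x * e x) = 0" by linarith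
  then have "\<forall>x\<in>{0..2*pi}. e x * e x = 0"
    using integral_eq_0_iff[of 0 "2 * pi" "\<lambda>x. e x * e x", OF continuous_on_mult[OF cont cont]] by simp
  then show ?thesis using x by auto
qed

lemma trig_periodic: "cos (real k * (x + 2 * pi)) = cos (real k * x)" "sin (real k * (x + 2 * pi)) = sin (real k * x)"
proof -
  have e: "real k * (x + 2 * pi) = real k * x + 2 * pi * of_int (int k)" by (simp add: algebra_simps)
  show "cos (real k * (x + 2 * pi)) = cos (real k * x)" "sin (real k * (x + 2 * pi)) = sin (real k * x)"
    unfolding e cos_add sin_add using cos_int_2pin[of "int k"] sin_int_2pin[of "int k"] by simp_all
qed

lemma summable_bounded_mult:
  fixes c t :: "nat \<Rightarrow> real"
  assumes "summable c" "\<And>k. 0 \<le> c k" "\<And>k. \<bar>t k\<bar> \<le> 1"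
  shows "summable (\<lambda>k. c k * t k)"
proof (rule summable_comparison_test'[OF assms(1)])
  show "norm (c k * t k) \<le> c k" for k
    using mult_left_mono[OF assms(3)[of k] assms(2)[of k]] assms(2)[of k] by (simp add: abs_mult)
qed

section \<open>The autocorrelation of a periodic \<open>C\<^sup>2\<close> function\<close>

locale periodic_C2 =
  fixes p p1 p2 :: "real \<Rightarrow> real"
  assumes p_deriv: "\<And>a. (p has_real_derivative p1 a) (at a)"
    and p1_deriv: "\<And>a. (p1 has_real_derivative p2 a) (at a)"
    and p2_cont: "continuous_on UNIV p2"
    and p_periodic: "\<And>a. p (a + 2 * pi) = p a"
begin

lemma p1_periodic: "p1 (a + 2 * pi) = p1 a"
proof -
  have "((\<lambda>b. p (b + 2 * pi)) has_real_derivative p1 (a + 2 * pi)) (at a)"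
    using p_deriv[of "a + 2 * pi"] by (simp add: DERIV_shift)
  then show ?thesis using p_deriv[of a] DERIV_unique unfolding p_periodic by blast
qed

lemma p2_periodic: "p2 (a + 2 * pi) = p2 a"
proof -
  have "((\<lambda>b. p1 (b + 2 * pi)) has_real_derivative p2 (a + 2 * pi)) (at a)"
    using p1_deriv[of "a + 2 * pi"] by (simp add: DERIV_shift)
  then show ?thesis using p1_deriv[of a] DERIV_unique unfolding p1_periodic by blast
qed

lemma p_cont: "continuous_on S p" and p1_cont: "continuous_on S p1"
  using p_deriv p1_deriv by (auto intro!: continuous_at_imp_continuous_on DERIV_isCont)

lemma p2_cont': "continuous_on S p2"
  using p2_cont continuous_on_subset by blast

lemmas p_conts [continuous_intros] = continuous_on_compose2[OF p_cont[of UNIV] _ subset_UNIV]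
  continuous_on_compose2[OF p1_cont[of UNIV] _ subset_UNIV]
  continuous_on_compose2[OF p2_cont _ subset_UNIV]

definition r0 :: "real \<Rightarrow> real" where "r0 d = integral {0..2*pi} (\<lambda>x. p x * p (x + d))"
definition r1 :: "real \<Rightarrow> real" where "r1 d = integral {0..2*pi} (\<lambda>x. p x * p1 (x + d))"
definition r2 :: "real \<Rightarrow> real" where "r2 d = integral {0..2*pi} (\<lambda>x. p x * p2 (x + d))"

lemma correlation_deriv:
  assumes q: "\<And>x. (q has_real_derivative q' x) (at x)" and q': "continuous_on UNIV q'"
  shows "((\<lambda>d. integral {0..2*pi} (\<lambda>x. p x * q (x + d))) has_real_derivative integral {0..2*pi} (\<lambda>x. p x * q' (x + d))) (at d)"
proof -
  have qc: "continuous_on UNIV q" using q by (auto intro!: continuous_at_imp_continuous_on DERIV_isCont)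
  note [continuous_intros] = continuous_on_compose2[OF qc _ subset_UNIV] continuous_on_compose2[OF q' _ subset_UNIV]
  have "((\<lambda>d. integral (cbox 0 (2*pi)) (\<lambda>x. p x * q (x + d))) has_real_derivative
      integral (cbox 0 (2*pi)) (\<lambda>x. p x * q' (x + d))) (at d within UNIV)"
  proof (rule leibniz_rule_field_derivative)
    show "((\<lambda>d. p x * q (x + d)) has_real_derivative p x * q' (x + d)) (at d within UNIV)" for d x
      by (auto intro!: derivative_eq_intros DERIV_chain2[OF q])
    show "(\<lambda>x. p x * q (x + d)) integrable_on cbox 0 (2 * pi)" for d
      by (intro integrable_continuous continuous_intros)
    show "continuous_on (UNIV \<times> cbox 0 (2 * pi)) (\<lambda>(d, x). p x * q' (x + d))"
      unfolding split_beta by (intro continuous_intros)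
  qed auto
  then show ?thesis by simp
qed

lemma r0_deriv: "(r0 has_real_derivative r1 d) (at d)"
  unfolding r0_def[abs_def] r1_def
  by (intro correlation_deriv p_deriv p1_cont)

lemma r1_deriv: "(r1 has_real_derivative r2 d) (at d)"
  unfolding r1_def[abs_def] r2_def
  by (intro correlation_deriv p1_deriv p2_cont)

lemma r2_cont: "continuous_on UNIV r2"
proof -
  have "continuous_on (UNIV \<times> cbox 0 (2 * pi)) (\<lambda>(d, x). p x * p2 (x + d))"
    unfolding split_beta by (intro continuous_intros)
  from integral_continuous_on_param[OF this] show ?thesis by (simp add: r2_def[abs_def])
qed

lemma r0_cont: "continuous_on S r0"
  using r0_deriv by (auto intro!: continuous_at_imp_continuous_on DERIV_isCont)

lemma p_intble: "continuous_on UNIV f \<Longrightarrow> f integrable_on {0..2*pi}" for f :: "real \<Rightarrow> real"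
  by (rule integrable_continuous_real[OF continuous_on_subset[OF _ subset_UNIV]])

text \<open>The factors are \<open>sin d\<close> times the two tangent lengths. Each of the nine products integrates, by
  periodicity and partial integration, to zero or, up to sign, to a value of the autocorrelation or of
  one of its first two derivatives.\<close>
lemma integral_tangent_products:
  assumes d: "0 \<le> d"
  shows "integral {0..2*pi} (\<lambda>a. (p (a + d) - p a * cos d - p1 a * sin d) * (p a - p (a + d) * cos d + p1 (a + d) * sin d))
    = (1 + (cos d)\<^sup>2) * r0 d - 2 * cos d * r0 0 - 2 * cos d * sin d * r1 d + (sin d)\<^sup>2 * r2 d"
proof -
  have hi: "((\<lambda>x. f x) has_integral integral {0..2*pi} f) {0..2*pi}" if "continuous_on UNIV f" for f :: "real \<Rightarrow> real"
    using p_intble[OF that] by (rule integrable_integral)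
  have 1: "((\<lambda>x. p x * p (x + d)) has_integral r0 d) {0..2*pi}"
    unfolding r0_def by (intro hi continuous_intros)
  have 2: "((\<lambda>x. p x * p1 (x + d)) has_integral r1 d) {0..2*pi}"
    unfolding r1_def by (intro hi continuous_intros)
  have 3: "((\<lambda>x. p x * p2 (x + d)) has_integral r2 d) {0..2*pi}"
    unfolding r2_def by (intro hi continuous_intros)
  have 4: "((\<lambda>x. p x * p x) has_integral r0 0) {0..2*pi}"
    unfolding r0_def by (simp, intro hi continuous_intros)
  have 5: "((\<lambda>x. p (x + d) * p (x + d)) has_integral r0 0) {0..2*pi}"
  proof -
    have "integral {0..2*pi} (\<lambda>x. p (x + d) * p (x + d)) = r0 0"
      unfolding r0_def add_0_right
      by (rule integral_periodic_shift[of "\<lambda>x. p x * p x"]) (auto simp: p_periodic d intro!: continuous_intros)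
    moreover have "((\<lambda>x. p (x + d) * p (x + d)) has_integral integral {0..2*pi} (\<lambda>x. p (x + d) * p (x + d))) {0..2*pi}"
      by (intro hi continuous_intros)
    ultimately show ?thesis by simp
  qed
  have per: "p (x + 2 * pi + d) = p (x + d)" "p1 (x + 2 * pi + d) = p1 (x + d)" for x
    using p_periodic[of "x + d"] p1_periodic[of "x + d"] by (simp_all add: ac_simps)
  have per0: "p (2 * pi) = p 0" "p1 (2 * pi) = p1 0" "p (2 * pi + d) = p d" "p1 (2 * pi + d) = p1 d"
    using p_periodic[of 0] p1_periodic[of 0] p_periodic[of d] p1_periodic[of d] by (simp_all add: ac_simps)
  have 6: "((\<lambda>x. p (x + d) * p1 (x + d)) has_integral 0) {0..2*pi}"
    by (rule has_integral_deriv_periodic[where f = "\<lambda>x. p (x + d) * p (x + d) / 2"])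
       (auto intro!: derivative_eq_intros DERIV_chain2[OF p_deriv] simp: per0)
  have 7: "((\<lambda>x. p x * p1 x) has_integral 0) {0..2*pi}"
    by (rule has_integral_deriv_periodic[where f = "\<lambda>x. p x * p x / 2"])
       (auto intro!: derivative_eq_intros p_deriv simp: per0)
  have 8: "((\<lambda>x. p1 x * p (x + d) + p x * p1 (x + d)) has_integral 0) {0..2*pi}"
    by (rule has_integral_deriv_periodic[where f = "\<lambda>x. p x * p (x + d)"])
       (auto intro!: derivative_eq_intros p_deriv DERIV_chain2[OF p_deriv] simp: per0)
  have 9: "((\<lambda>x. p1 x * p1 (x + d) + p x * p2 (x + d)) has_integral 0) {0..2*pi}"
    by (rule has_integral_deriv_periodic[where f = "\<lambda>x. p x * p1 (x + d)"])
       (auto intro!: derivative_eq_intros p_deriv DERIV_chain2[OF p1_deriv] simp: per0)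
  have 10: "((\<lambda>x. p1 x * p (x + d)) has_integral - r1 d) {0..2*pi}"
    using has_integral_diff[OF 8 2] by simp
  have 11: "((\<lambda>x. p1 x * p1 (x + d)) has_integral - r2 d) {0..2*pi}"
    using has_integral_diff[OF 9 3] by simp
  note S = has_integral_add[OF has_integral_add[OF has_integral_add[OF has_integral_mult_right[OF 1, of "1 + (cos d)\<^sup>2"]
      has_integral_mult_right[OF 4, of "- cos d"]] has_integral_add[OF has_integral_mult_right[OF 5, of "- cos d"]
      has_integral_mult_right[OF 6, of "sin d"]]] has_integral_add[OF has_integral_add[OF has_integral_mult_right[OF 7, of "- sin d"]
      has_integral_mult_right[OF 2, of "- (cos d * sin d)"]] has_integral_add[OF has_integral_mult_right[OF 10, of "cos d * sin d"]
      has_integral_mult_right[OF 11, of "- (sin d)\<^sup>2"]]]]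
  have alg: "(y - x * C - x' * s) * (x - y * C + y' * s) =
    (1 + C\<^sup>2) * (x * y) + - C * (x * x) + (- C * (y * y) + s * (y * y')) + (- s * (x * x') + - (C * s) * (x * y') + (C * s * (x' * y) + - s\<^sup>2 * (x' * y')))"
    for x y x' y' C s :: real
    by (simp add: algebra_simps power2_eq_square)
  show ?thesis unfolding alg integral_unique[OF S] by (simp add: algebra_simps)
qed

text \<open>\<open>iso_area d\<close> is the area enclosed by the isoptic curve from which the oval with support function
  \<open>p\<close> is seen under the angle \<open>\<pi> - d\<close>.\<close>
definition iso_num :: "real \<Rightarrow> real" where "iso_num d = r0 0 - cos d * r0 d + sin d * r1 d"
definition iso_area :: "real \<Rightarrow> real" where "iso_area d = iso_num d / (sin d)\<^sup>2"

lemma iso_num_deriv: "(iso_num has_real_derivative sin d * (r0 d + r2 d)) (at d)"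
  unfolding iso_num_def[abs_def]
  by (auto intro!: derivative_eq_intros r0_deriv r1_deriv simp: algebra_simps)

lemma iso_area_deriv:
  assumes "0 < d" "d < pi"
  shows "(iso_area has_real_derivative integral {0..2*pi} (\<lambda>a. (p (a + d) - p a * cos d - p1 a * sin d) * (p a - p (a + d) * cos d + p1 (a + d) * sin d) / sin d ^ 3)) (at d)"
proof -
  have s: "sin d \<noteq> 0" using sin_gt_zero[OF assms] by simp
  have alg: "(s * (x + x2) * s\<^sup>2 - (x0 - c * x + s * x1) * (2 * s * c)) / (s\<^sup>2 * s\<^sup>2)
      = ((1 + c\<^sup>2) * x - 2 * c * x0 - 2 * c * s * x1 + s\<^sup>2 * x2) / s ^ 3" if "s \<noteq> 0" "s\<^sup>2 + c\<^sup>2 = 1" for s c x x0 x1 x2 :: real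
  proof -
    have e: "(s\<^sup>2 * s\<^sup>2) = s * s ^ 3" by (simp add: power2_eq_square power3_eq_cube)
    have "s * (x + x2) * s\<^sup>2 - (x0 - c * x + s * x1) * (2 * s * c) = s * ((1 + c\<^sup>2) * x - 2 * c * x0 - 2 * c * s * x1 + s\<^sup>2 * x2)"
      using that(2) by algebra
    then show ?thesis unfolding e using that(1) by simp
  qed
  have "((\<lambda>d. (sin d)\<^sup>2) has_real_derivative 2 * sin d * cos d) (at d)"
    by (auto intro!: derivative_eq_intros)
  from DERIV_divide[OF iso_num_deriv this] s
  have "(iso_area has_real_derivative ((sin d * (r0 d + r2 d)) * (sin d)\<^sup>2 - iso_num d * (2 * sin d * cos d)) / ((sin d)\<^sup>2 * (sin d)\<^sup>2)) (at d)"
    by (simp add: iso_area_def[abs_def])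
  then show ?thesis
    unfolding integral_divide integral_tangent_products[OF less_imp_le[OF assms(1)]] iso_num_def
    using alg[OF s sin_cos_squared_add, of "r0 d" "r2 d" "r0 0" "r1 d"] by simp
qed

text \<open>The derivative of the numerator contains the factor \<open>sin\<close>, the derivative of \<open>1 - cos\<close>, so the two
  functions can be compared monotonically.\<close>
lemma iso_num_bound:
  obtains B where "0 < B" "\<And>d. 0 \<le> d \<Longrightarrow> d \<le> pi \<Longrightarrow> \<bar>iso_num d\<bar> \<le> B * (1 - cos d)"
proof -
  have "continuous_on {0..pi} (\<lambda>d. r0 d + r2 d)"
    by (intro continuous_intros r0_cont continuous_on_subset[OF r2_cont]) auto
  from compact_imp_bounded[OF compact_continuous_image[OF this compact_Icc]]
  obtain B where B: "0 < B" "\<And>d. d \<in> {0..pi} \<Longrightarrow> \<bar>r0 d + r2 d\<bar> \<le> B"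
    unfolding bounded_pos by auto
  have "\<bar>iso_num d\<bar> \<le> B * (1 - cos d)" if d: "0 \<le> d" "d \<le> pi" for d
  proof -
    have s: "0 \<le> sin x" if "0 \<le> x" "x \<le> d" for x using that d by (intro sin_ge_zero) auto
    have *: "\<bar>sin x * (r0 x + r2 x)\<bar> \<le> B * sin x" if "0 \<le> x" "x \<le> d" for x
      using B(2)[of x] s[OF that] that d mult_left_mono[of "\<bar>r0 x + r2 x\<bar>" B "sin x"] by (simp add: abs_mult mult.commute)
    have z: "iso_num 0 = 0" by (simp add: iso_num_def)
    have "B * (1 - cos 0) - iso_num 0 \<le> B * (1 - cos d) - iso_num d"
    proof (rule DERIV_nonneg_imp_nondecreasing[where f = "\<lambda>x. B * (1 - cos x) - iso_num x"])
      show "\<exists>y. ((\<lambda>x. B * (1 - cos x) - iso_num x) has_real_derivative y) (at x) \<and> 0 \<le> y" if "0 \<le> x" "x \<le> d" for x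
        using *[OF that] by (intro exI[of _ "B * sin x - sin x * (r0 x + r2 x)"]) (auto intro!: derivative_eq_intros iso_num_deriv)
    qed (use d in auto)
    moreover have "B * (1 - cos 0) + iso_num 0 \<le> B * (1 - cos d) + iso_num d"
    proof (rule DERIV_nonneg_imp_nondecreasing[where f = "\<lambda>x. B * (1 - cos x) + iso_num x"])
      show "\<exists>y. ((\<lambda>x. B * (1 - cos x) + iso_num x) has_real_derivative y) (at x) \<and> 0 \<le> y" if "0 \<le> x" "x \<le> d" for x
        using *[OF that] by (intro exI[of _ "B * sin x + sin x * (r0 x + r2 x)"]) (auto intro!: derivative_eq_intros iso_num_deriv)
    qed (use d in auto)
    ultimately show ?thesis using z by simp
  qed
  then show ?thesis using B(1) that by blast
qed

text \<open>L'Hospital's rule; the value \<open>(R(0) + R''(0)) / 2 = \<integral> p (p + p'') / 2\<close> is the area of the oval with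
  support function \<open>p\<close>.\<close>
lemma iso_area_limit: "(iso_area \<longlongrightarrow> (r0 0 + r2 0) / 2) (at_right 0)"
proof -
  have "eventually (\<lambda>x. x \<in> {0<..<pi/2}) (at_right (0::real))"
    by (rule eventually_at_right_real) simp
  then have nz: "eventually (\<lambda>x::real. 0 < sin x \<and> 0 < cos x) (at_right 0)"
    by eventually_elim (auto intro: sin_gt_zero2 cos_gt_zero)
  have right: "(f \<longlongrightarrow> f 0) (at_right 0)" if "isCont f 0" for f :: "real \<Rightarrow> real"
    using tendsto_within_subset[OF isContD[OF that], of "{0<..}"] by simp
  have num: "(iso_num \<longlongrightarrow> 0) (at_right 0)"
    using right[OF DERIV_isCont[OF iso_num_deriv]] by (simp only: iso_num_def[of 0]) simp
  have den: "((\<lambda>x::real. (sin x)\<^sup>2) \<longlongrightarrow> 0) (at_right 0)"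
    using right[of "\<lambda>x. (sin x)\<^sup>2"] by simp
  have "((\<lambda>x. (r0 x + r2 x) / (2 * cos x)) \<longlongrightarrow> (r0 0 + r2 0) / 2) (at_right 0)"
  proof -
    have "isCont (\<lambda>x. (r0 x + r2 x) / (2 * cos x)) 0"
    proof -
      have "isCont r2 0" using r2_cont by (simp add: continuous_on_eq_continuous_at)
      then show ?thesis using DERIV_isCont[OF r0_deriv] by (intro continuous_intros) auto
    qed
    from right[OF this] show ?thesis by simp
  qed
  moreover have "eventually (\<lambda>x. (r0 x + r2 x) / (2 * cos x) = (sin x * (r0 x + r2 x)) / (2 * sin x * cos x)) (at_right 0)"
    using nz by eventually_elim simp
  ultimately have lim: "((\<lambda>x. (sin x * (r0 x + r2 x)) / (2 * sin x * cos x)) \<longlongrightarrow> (r0 0 + r2 0) / 2) (at_right 0)"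
    by (rule Lim_transform_eventually)
  show ?thesis unfolding iso_area_def[abs_def]
  proof (rule lhopital_right[OF num den _ _ _ _ lim])
    show "eventually (\<lambda>x::real. (sin x)\<^sup>2 \<noteq> 0) (at_right 0)"
      using nz by eventually_elim simp
    show "eventually (\<lambda>x::real. 2 * sin x * cos x \<noteq> 0) (at_right 0)"
      using nz by eventually_elim simp
    show "eventually (\<lambda>x. (iso_num has_real_derivative sin x * (r0 x + r2 x)) (at x)) (at_right 0)"
      by (simp add: iso_num_deriv)
    show "eventually (\<lambda>x::real. ((\<lambda>x. (sin x)\<^sup>2) has_real_derivative 2 * sin x * cos x) (at x)) (at_right 0)"
      by (intro always_eventually allI) (auto intro!: derivative_eq_intros)
  qed
qed

end

section \<open>The weight \<open>\<omega>\<^sup>m - sin\<^sup>m \<omega>\<close> and the kernels \<open>g\<^sub>k\<close>\<close>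

lemma omega_fun_deriv:
  "(omega_fun m has_real_derivative real m * (w ^ (m - 1) - sin w ^ (m - 1) * cos w)) (at w)"
  unfolding omega_fun_def[abs_def] by (auto intro!: derivative_eq_intros simp: algebra_simps)

lemma deriv_omega_fun: "deriv (omega_fun m) w = real m * (w ^ (m - 1) - sin w ^ (m - 1) * cos w)"
  by (rule DERIV_imp_deriv[OF omega_fun_deriv])

lemma continuous_deriv_omega_fun: "continuous_on S (deriv (omega_fun m))"
  unfolding deriv_omega_fun[abs_def] by (intro continuous_intros)

lemma isCont_deriv_omega_fun: "isCont (deriv (omega_fun m)) w"
  using continuous_deriv_omega_fun[of UNIV m] by (simp add: continuous_on_eq_continuous_at)

lemma isCont_omega_fun: "isCont (omega_fun m) w"
  by (rule DERIV_isCont[OF omega_fun_deriv])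

lemma sub_sin_le:
  assumes "0 \<le> w" "w \<le> pi" shows "w - sin w \<le> w * (1 - cos w)" "sin w \<le> w"
proof -
  show "sin w \<le> w" using assms by (intro sin_x_le_x)
  show "w - sin w \<le> w * (1 - cos w)"
  proof (cases "w = 0")
    case False
    have "\<exists>z>0. z < w \<and> (w - sin w) - (0 - sin 0) = (w - 0) * (1 - cos z)"
      by (rule MVT2) (use False assms in \<open>auto intro!: derivative_eq_intros\<close>)
    then obtain z where z: "0 < z" "z < w" "w - sin w = w * (1 - cos z)" by auto
    have "cos w \<le> cos z" using z assms by (intro cos_monotone_0_pi_le) auto
    then show ?thesis using z assms by (simp add: mult_left_mono)
  qed simp
qed

lemma power_diff_le:
  fixes x y b :: real
  assumes "0 \<le> y" "y \<le> x" "x \<le> b" "0 \<le> b"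
  shows "x ^ n - y ^ n \<le> real n * b ^ (n - 1) * (x - y)"
proof -
  have "x ^ n - y ^ n = (x - y) * (\<Sum>i<n. y ^ (n - Suc i) * x ^ i)" by (rule power_diff_sumr2)
  also have "\<dots> \<le> (x - y) * (\<Sum>i<n. b ^ (n - 1))"
  proof (intro mult_left_mono sum_mono)
    fix i assume "i \<in> {..<n}"
    then have "b ^ (n - Suc i) * b ^ i = b ^ (n - 1)" by (simp add: power_add[symmetric])
    moreover have "y ^ (n - Suc i) * x ^ i \<le> b ^ (n - Suc i) * b ^ i"
      using assms by (intro mult_mono power_mono) auto
    ultimately show "y ^ (n - Suc i) * x ^ i \<le> b ^ (n - 1)" by simp
  qed (use assms in auto)
  finally show ?thesis by (simp add: mult_ac)
qed

text \<open>The weight is increasing and its derivative vanishes at \<open>0\<close> at least to the order of \<open>1 - cos \<omega>\<close>. All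
  integrability statements rest on this estimate.\<close>
lemma deriv_omega_fun_bound:
  obtains B where "0 < B" "\<And>w. 0 \<le> w \<Longrightarrow> w \<le> pi \<Longrightarrow> 0 \<le> deriv (omega_fun m) w \<and> deriv (omega_fun m) w \<le> B * (1 - cos w)"
proof -
  define j where "j = m - 1"
  define B where "B = real m * (real j * pi ^ (j - 1) * pi + 1) + 1"
  have "0 < B" by (simp add: B_def add_nonneg_pos)
  moreover have "0 \<le> deriv (omega_fun m) w \<and> deriv (omega_fun m) w \<le> B * (1 - cos w)" if w: "0 \<le> w" "w \<le> pi" for w
  proof -
    have s: "0 \<le> sin w" using w by (intro sin_ge_zero)
    have sp: "0 \<le> sin w ^ j" "sin w ^ j \<le> 1" using s by (simp_all add: power_le_one)
    have c: "0 \<le> 1 - cos w" by simp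
    have e: "w ^ j - sin w ^ j * cos w = (w ^ j - sin w ^ j) + sin w ^ j * (1 - cos w)" by (simp add: algebra_simps)
    have 1: "sin w ^ j * (1 - cos w) \<le> 1 - cos w" using mult_right_mono[OF sp(2) c] by simp
    have 2: "0 \<le> w ^ j - sin w ^ j" using power_mono[OF sub_sin_le(2)[OF w] s, of j] by simp
    have "w ^ j - sin w ^ j \<le> real j * pi ^ (j - 1) * (w - sin w)"
      using sub_sin_le(2)[OF w] w s by (intro power_diff_le) auto
    also have "\<dots> \<le> real j * pi ^ (j - 1) * (pi * (1 - cos w))"
      using sub_sin_le(1)[OF w] mult_right_mono[OF w(2) c] by (intro mult_left_mono) auto
    finally have 3: "w ^ j - sin w ^ j \<le> (real j * pi ^ (j - 1) * pi) * (1 - cos w)" by (simp add: mult.assoc)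
    have "real m * (w ^ j - sin w ^ j * cos w) \<le> real m * ((real j * pi ^ (j - 1) * pi + 1) * (1 - cos w))"
      unfolding e using 1 3 by (intro mult_left_mono) (simp_all add: distrib_right)
    also have "\<dots> \<le> B * (1 - cos w)"
      using c by (simp add: B_def distrib_right mult.assoc)
    finally have "deriv (omega_fun m) w \<le> B * (1 - cos w)" by (simp add: deriv_omega_fun j_def)
    moreover have "0 \<le> deriv (omega_fun m) w"
      unfolding deriv_omega_fun j_def[symmetric] e using 2 sp c by simp
    ultimately show ?thesis by simp
  qed
  ultimately show ?thesis using that by blast
qed

lemma omega_fun_0: "1 \<le> m \<Longrightarrow> omega_fun m 0 = 0"
  by (simp add: omega_fun_def)

lemma omega_fun_pi: "1 \<le> m \<Longrightarrow> omega_fun m pi = pi ^ m"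
  by (simp add: omega_fun_def)

lemma omega_fun_bound:
  assumes m: "1 \<le> m" and B: "\<And>w. 0 \<le> w \<Longrightarrow> w \<le> pi \<Longrightarrow> 0 \<le> deriv (omega_fun m) w \<and> deriv (omega_fun m) w \<le> B * (1 - cos w)"
    and w: "0 < w" "w \<le> pi" and "0 < B"
  shows "0 \<le> omega_fun m w" "omega_fun m w \<le> w * (B * (1 - cos w))"
proof -
  have "\<exists>z>0. z < w \<and> omega_fun m w - omega_fun m 0 = (w - 0) * deriv (omega_fun m) z"
    unfolding deriv_omega_fun by (rule MVT2[OF w(1)]) (rule omega_fun_deriv)
  then obtain z where z: "0 < z" "z < w" "omega_fun m w = w * deriv (omega_fun m) z" using omega_fun_0[OF m] by auto
  have "cos w \<le> cos z" using z w by (intro cos_monotone_0_pi_le) auto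
  then have "deriv (omega_fun m) z \<le> B * (1 - cos w)"
  proof -
    have "B * (1 - cos z) \<le> B * (1 - cos w)" using \<open>cos w \<le> cos z\<close> \<open>0 < B\<close> by simp
    then show ?thesis using B[of z] z w by simp
  qed
  then show "omega_fun m w \<le> w * (B * (1 - cos w))" unfolding z(3) using w by (intro mult_left_mono) auto
  show "0 \<le> omega_fun m w" unfolding z(3) using B[of z] z w by auto
qed

text \<open>This is \<open>g\<^sub>k\<close> in the variable \<open>d = \<pi> - \<omega>\<close>, in which it vanishes at \<open>0\<close> and its derivative has a
  simple product form.\<close>
definition iso_kernel :: "nat \<Rightarrow> real \<Rightarrow> real" where
  "iso_kernel k d = 1 - cos d * cos (real k * d) - real k * sin d * sin (real k * d)"

lemma iso_kernel_deriv: "(iso_kernel k has_real_derivative (1 - (real k)\<^sup>2) * (sin d * cos (real k * d))) (at d)"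
  unfolding iso_kernel_def[abs_def] by (auto intro!: derivative_eq_intros simp: algebra_simps power2_eq_square)

lemma iso_kernel_bound:
  assumes d: "0 \<le> d" "d \<le> pi"
  shows "\<bar>iso_kernel k d\<bar> \<le> ((real k)\<^sup>2 + 1) * (1 - cos d)"
proof -
  let ?C = "(real k)\<^sup>2 + 1"
  have *: "\<bar>(1 - (real k)\<^sup>2) * (sin x * cos (real k * x))\<bar> \<le> ?C * sin x" if "0 \<le> x" "x \<le> d" for x
  proof -
    have s: "0 \<le> sin x" using that d by (intro sin_ge_zero) auto
    have "\<bar>1 - (real k)\<^sup>2\<bar> \<le> ?C" by (simp add: abs_le_iff)
    moreover have "\<bar>sin x * cos (real k * x)\<bar> \<le> sin x"
      using mult_left_mono[OF abs_cos_le_one s, of "real k * x"] s by (simp add: abs_mult)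
    ultimately show ?thesis unfolding abs_mult[of "1 - (real k)\<^sup>2"] using s by (intro mult_mono) auto
  qed
  have z: "iso_kernel k 0 = 0" by (simp add: iso_kernel_def)
  have "?C * (1 - cos 0) - iso_kernel k 0 \<le> ?C * (1 - cos d) - iso_kernel k d"
  proof (rule DERIV_nonneg_imp_nondecreasing[where f = "\<lambda>x. ?C * (1 - cos x) - iso_kernel k x"])
    show "\<exists>y. ((\<lambda>x. ?C * (1 - cos x) - iso_kernel k x) has_real_derivative y) (at x) \<and> 0 \<le> y" if "0 \<le> x" "x \<le> d" for x
      using *[OF that] by (intro exI[of _ "?C * sin x - (1 - (real k)\<^sup>2) * (sin x * cos (real k * x))"])
        (auto intro!: derivative_eq_intros iso_kernel_deriv)
  qed (use d in auto)
  moreover have "?C * (1 - cos 0) + iso_kernel k 0 \<le> ?C * (1 - cos d) + iso_kernel k d"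
  proof (rule DERIV_nonneg_imp_nondecreasing[where f = "\<lambda>x. ?C * (1 - cos x) + iso_kernel k x"])
    show "\<exists>y. ((\<lambda>x. ?C * (1 - cos x) + iso_kernel k x) has_real_derivative y) (at x) \<and> 0 \<le> y" if "0 \<le> x" "x \<le> d" for x
      using *[OF that] by (intro exI[of _ "?C * sin x + (1 - (real k)\<^sup>2) * (sin x * cos (real k * x))"])
        (auto intro!: derivative_eq_intros iso_kernel_deriv)
  qed (use d in auto)
  ultimately show ?thesis using z by simp
qed

lemma g_fun_eq_iso_kernel: "g_fun k w = iso_kernel k (pi - w)"
proof -
  have kp: "cos (real k * (pi - w)) = (- 1) ^ k * cos (real k * w)" "sin (real k * (pi - w)) = - ((- 1) ^ k * sin (real k * w))"
    by (simp_all add: right_diff_distrib cos_diff sin_diff cos_npi sin_npi)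
  have e: "cos ((real k - 1) * w) = cos (real k * w) * cos w + sin (real k * w) * sin w"
    "cos ((real k + 1) * w) = cos (real k * w) * cos w - sin (real k * w) * sin w"
    by (simp_all add: left_diff_distrib distrib_right cos_diff cos_add)
  show ?thesis unfolding g_fun_def iso_kernel_def kp e
    by (simp add: cos_diff sin_diff field_simps)
qed

lemma beta_integrand_bound:
  assumes B: "\<And>w. 0 \<le> w \<Longrightarrow> w \<le> pi \<Longrightarrow> 0 \<le> deriv (omega_fun m) w \<and> deriv (omega_fun m) w \<le> B * (1 - cos w)"
    and w: "0 \<le> w" "w \<le> pi"
  shows "\<bar>beta_integrand m k w\<bar> \<le> ((real k)\<^sup>2 + 1) * B"
proof (cases "sin w = 0")
  case True
  have "0 \<le> B" using B[of pi] by simp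
  then show ?thesis using True by (simp add: beta_integrand_def)
next
  case False
  have c: "cos (pi - w) = - cos w" by (simp add: cos_diff)
  have g: "\<bar>g_fun k w\<bar> \<le> ((real k)\<^sup>2 + 1) * (1 + cos w)"
    using iso_kernel_bound[of "pi - w" k] w unfolding g_fun_eq_iso_kernel c by simp
  have "\<bar>deriv (omega_fun m) w\<bar> * \<bar>g_fun k w\<bar> \<le> (B * (1 - cos w)) * (((real k)\<^sup>2 + 1) * (1 + cos w))"
    using B[OF w] g by (intro mult_mono) auto
  also have "\<dots> = (((real k)\<^sup>2 + 1) * B) * (sin w)\<^sup>2"
    unfolding sin_squared_eq by (simp add: power2_eq_square algebra_simps)
  finally show ?thesis using False by (simp add: beta_integrand_def abs_mult pos_divide_le_eq)
qed

lemma beta_integrand_0: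
  assumes "0 < w" "w < pi" shows "beta_integrand m 0 w = M_integrand m w"
proof -
  have s: "sin w \<noteq> 0" using sin_gt_zero[OF assms] by simp
  have c: "1 + cos w \<noteq> 0" "1 - cos w \<noteq> 0"
  proof -
    have "(1 + cos w) * (1 - cos w) = (sin w)\<^sup>2" unfolding sin_squared_eq by (simp add: power2_eq_square algebra_simps)
    then show "1 + cos w \<noteq> 0" "1 - cos w \<noteq> 0" using s by auto
  qed
  have "g_fun 0 w = 1 + cos w" by (simp add: g_fun_def)
  moreover have "(sin w)\<^sup>2 = (1 + cos w) * (1 - cos w)" unfolding sin_squared_eq by (simp add: power2_eq_square algebra_simps)
  ultimately show ?thesis using c by (simp add: beta_integrand_def M_integrand_def)
qed

lemma beta_integrand_1: "beta_integrand m (Suc 0) w = 0"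
  by (simp add: beta_integrand_def g_fun_def)

lemma beta_integrand_measurable [measurable]: "beta_integrand m k \<in> borel_measurable borel"
proof -
  have [measurable]: "deriv (omega_fun m) \<in> borel_measurable borel"
    by (intro borel_measurable_continuous_onI continuous_deriv_omega_fun)
  show ?thesis unfolding beta_integrand_def[abs_def] g_fun_def by measurable
qed

lemma M_integrand_measurable [measurable]: "M_integrand m \<in> borel_measurable borel"
proof -
  have [measurable]: "deriv (omega_fun m) \<in> borel_measurable borel"
    by (intro borel_measurable_continuous_onI continuous_deriv_omega_fun)
  show ?thesis unfolding M_integrand_def[abs_def] by measurable
qed

lemma set_integrable_bounded_interval:
  fixes f :: "real \<Rightarrow> real"
  assumes "f \<in> borel_measurable borel" "\<And>x. x \<in> S \<Longrightarrow> \<bar>f x\<bar> \<le> B" "S \<in> sets borel" "S \<subseteq> {a..b}"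
  shows "set_integrable lborel S f"
proof -
  have "emeasure lborel S \<le> emeasure lborel {a..b}" using assms(4) by (intro emeasure_mono) auto
  also have "\<dots> < \<infinity>" using emeasure_compact_finite[of "{a..b}"] by (simp add: less_top)
  finally show ?thesis
    unfolding set_integrable_def using assms
    by (intro integrableI_bounded_set_indicator[where B = B]) auto
qed

lemma set_integrable_beta: "set_integrable lborel {0..pi} (beta_integrand m k)"
proof -
  obtain B where B: "\<And>w. 0 \<le> w \<Longrightarrow> w \<le> pi \<Longrightarrow> 0 \<le> deriv (omega_fun m) w \<and> deriv (omega_fun m) w \<le> B * (1 - cos w)"
    using deriv_omega_fun_bound[of m] by metis
  show ?thesis
    by (rule set_integrable_bounded_interval[where B = "((real k)\<^sup>2 + 1) * B" and a = 0 and b = pi])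
       (use beta_integrand_bound[OF B] in auto)
qed

lemma set_integrable_M: "set_integrable lborel {0..pi} (M_integrand m)"
proof -
  obtain B where B: "\<And>w. 0 \<le> w \<Longrightarrow> w \<le> pi \<Longrightarrow> 0 \<le> deriv (omega_fun m) w \<and> deriv (omega_fun m) w \<le> B * (1 - cos w)" "0 < B"
    using deriv_omega_fun_bound[of m] by metis
  have "\<bar>M_integrand m w\<bar> \<le> B" if "w \<in> {0..pi}" for w
  proof (cases "cos w = 1")
    case False
    then have "0 < 1 - cos w" using cos_le_one[of w] by (simp add: less_le)
    then show ?thesis using B(1)[of w] that by (simp add: M_integrand_def pos_divide_le_eq)
  qed (use B(2) in \<open>simp add: M_integrand_def\<close>)
  then show ?thesis
    by (intro set_integrable_bounded_interval[where B = B and a = 0 and b = pi]) auto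
qed

lemma deriv_omega_measurable [measurable]: "deriv (omega_fun m) \<in> borel_measurable borel"
  by (intro borel_measurable_continuous_onI continuous_deriv_omega_fun)

lemma set_integral_reflect:
  fixes f :: "real \<Rightarrow> real"
  shows "(LINT d:{0<..<pi}|lborel. f (pi - d)) = (LINT w:{0<..<pi}|lborel. f w)"
proof -
  have "(\<integral>w. indicator {0<..<pi} w *\<^sub>R f w \<partial>lborel) = (\<integral>d. indicator {0<..<pi} (pi + (- 1) * d) *\<^sub>R f (pi + (- 1) * d) \<partial>lborel)"
    using lborel_integral_real_affine[of "- 1" "\<lambda>w. indicator {0<..<pi} w *\<^sub>R f w" pi] by simp
  also have "\<dots> = (\<integral>d. indicator {0<..<pi} d *\<^sub>R f (pi - d) \<partial>lborel)"
    by (intro Bochner_Integration.integral_cong) (auto simp: indicator_def)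
  finally show ?thesis by (simp add: set_lebesgue_integral_def)
qed

lemma set_integral_Icc_Ioo:
  fixes f :: "real \<Rightarrow> real"
  assumes "set_integrable lborel {0..pi} f"
  shows "(LINT w:{0<..<pi}|lborel. f w) = (LINT w:{0..pi}|lborel. f w)"
proof -
  have "set_integrable lborel {0<..<pi} f" by (rule set_integrable_subset[OF assms]) auto
  then show ?thesis
    using set_borel_integral_eq_integral(2)[OF assms] set_borel_integral_eq_integral(2)[of "{0<..<pi}" f]
    by (simp add: integral_open_interval_real)
qed

text \<open>The indices \<open>0\<close> and \<open>1\<close> are covered by the formula for \<open>\<beta>\<^sub>k\<close>, which makes the constant term and the
  missing first harmonic part of one uniform series.\<close>
lemma beta_coeff_0: "beta_coeff m 0 = M_coeff m" and beta_coeff_1: "beta_coeff m (Suc 0) = 0"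
proof -
  have "(LINT w:{0<..<pi}|lborel. beta_integrand m 0 w) = (LINT w:{0<..<pi}|lborel. M_integrand m w)"
    by (rule set_lebesgue_integral_cong) (auto simp: beta_integrand_0)
  then show "beta_coeff m 0 = M_coeff m"
    unfolding beta_coeff_def M_coeff_def
    using set_integral_Icc_Ioo[OF set_integrable_beta[of m 0]] set_integral_Icc_Ioo[OF set_integrable_M[of m]] by simp
  show "beta_coeff m (Suc 0) = 0"
    unfolding beta_coeff_def beta_integrand_1 by simp
qed

section \<open>Fourier expansion of the isoptic area\<close>

context periodic_C2 begin

definition fourier_sq :: "nat \<Rightarrow> real" where "fourier_sq k = (fourier_a p k)\<^sup>2 + (fourier_b p k)\<^sup>2"
text \<open>The cosine coefficients of the autocorrelation \<open>r0\<close>; the constant term carries the normalisation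
  \<open>1 / (2\<pi>)\<close> instead of \<open>1 / \<pi>\<close>.\<close>
definition corr_coeff :: "nat \<Rightarrow> real" where "corr_coeff k = (if k = 0 then 2 * pi else pi) * fourier_sq k"

lemma fourier_sq_nonneg: "0 \<le> fourier_sq k" by (simp add: fourier_sq_def)
lemma corr_coeff_nonneg: "0 \<le> corr_coeff k" by (simp add: corr_coeff_def fourier_sq_nonneg)

text \<open>Fubini and a shift by \<open>x\<close> in the inner integral, followed by the addition theorem.\<close>
lemma integral_r0_cos:
  "integral {0..2*pi} (\<lambda>d. r0 d * cos (real k * d)) =
    (integral {0..2*pi} (\<lambda>x. p x * cos (real k * x)))\<^sup>2 + (integral {0..2*pi} (\<lambda>x. p x * sin (real k * x)))\<^sup>2"
proof -
  define A where "A = integral {0..2*pi} (\<lambda>x. p x * cos (real k * x))"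
  define B where "B = integral {0..2*pi} (\<lambda>x. p x * sin (real k * x))"
  have inner: "integral {0..2*pi} (\<lambda>d. p (x + d) * cos (real k * d)) = A * cos (real k * x) + B * sin (real k * x)"
    if x: "x \<in> {0..2*pi}" for x
  proof -
    define f where "f y = p y * cos (real k * (y - x))" for y
    have "integral {0..2*pi} (\<lambda>d. p (x + d) * cos (real k * d)) = integral {0..2*pi} (\<lambda>d. f (d + x))"
      by (intro integral_cong) (simp add: f_def add.commute)
    also have "\<dots> = integral {0..2*pi} f"
    proof (rule integral_periodic_shift)
      show "continuous_on UNIV f" unfolding f_def[abs_def] by (intro continuous_intros)
      show "f (y + 2 * pi) = f y" for y
      proof -
        have e: "y + 2 * pi - x = (y - x) + 2 * pi" by simp
        show ?thesis unfolding f_def e trig_periodic p_periodic ..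
      qed
    qed (use x in auto)
    also have "\<dots> = integral {0..2*pi} (\<lambda>y. (p y * cos (real k * y)) * cos (real k * x) + (p y * sin (real k * y)) * sin (real k * x))"
      by (intro integral_cong) (simp add: f_def right_diff_distrib cos_diff distrib_left mult.assoc)
    also have "\<dots> = A * cos (real k * x) + B * sin (real k * x)"
      unfolding A_def B_def integral_mult_left[symmetric]
      by (intro integral_add p_intble continuous_intros)
    finally show ?thesis .
  qed
  have "integral {0..2*pi} (\<lambda>d. r0 d * cos (real k * d)) =
      integral {0..2*pi} (\<lambda>d. integral {0..2*pi} (\<lambda>x. p x * p (x + d) * cos (real k * d)))"
    unfolding r0_def by simp
  also have "\<dots> = integral {0..2*pi} (\<lambda>x. integral {0..2*pi} (\<lambda>d. p x * p (x + d) * cos (real k * d)))"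
    using integral_swap_continuous[of 0 0 "2*pi" "2*pi" "\<lambda>d x. p x * p (x + d) * cos (real k * d)"]
    by (simp add: split_beta continuous_intros)
  also have "\<dots> = integral {0..2*pi} (\<lambda>x. p x * (A * cos (real k * x) + B * sin (real k * x)))"
  proof (intro integral_cong)
    fix x assume x: "x \<in> {0..2*pi}"
    have "integral {0..2*pi} (\<lambda>d. p x * p (x + d) * cos (real k * d)) = p x * integral {0..2*pi} (\<lambda>d. p (x + d) * cos (real k * d))"
      unfolding mult.assoc by (rule integral_mult_right)
    then show "integral {0..2*pi} (\<lambda>d. p x * p (x + d) * cos (real k * d)) = p x * (A * cos (real k * x) + B * sin (real k * x))"
      using inner[OF x] by simp
  qed
  also have "\<dots> = integral {0..2*pi} (\<lambda>x. A * (p x * cos (real k * x)) + B * (p x * sin (real k * x)))"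
    by (intro integral_cong) (simp add: algebra_simps)
  also have "\<dots> = A * A + B * B"
    by (subst integral_add) (auto simp: A_def B_def intro!: p_intble continuous_intros)
  finally show ?thesis by (simp add: A_def B_def power2_eq_square)
qed

lemma integral_r0_cos_coeff:
  "integral {0..2*pi} (\<lambda>d. r0 d * cos (real k * d)) = corr_coeff k * (if k = 0 then 2 * pi else pi)"
proof (cases "k = 0")
  case True
  then show ?thesis unfolding integral_r0_cos corr_coeff_def fourier_sq_def fourier_a_def fourier_b_def
    by (simp add: power2_eq_square)
next
  case False
  then show ?thesis unfolding integral_r0_cos corr_coeff_def fourier_sq_def fourier_a_def fourier_b_def
    by (simp add: power2_eq_square field_simps)
qed

text \<open>Two partial integrations turn \<open>k\<^sup>2\<close> times a Fourier coefficient of \<open>p\<close> into minus the corresponding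
  coefficient of the bounded function \<open>p''\<close>.\<close>
lemma fourier_sq_decay:
  obtains M where "\<And>k. real k ^ 4 * fourier_sq k \<le> M"
proof -
  have per: "p (2 * pi) = p 0" "p1 (2 * pi) = p1 0" using p_periodic[of 0] p1_periodic[of 0] by simp_all
  obtain B where B: "B > 0" "\<And>x. x \<in> {0..2*pi} \<Longrightarrow> \<bar>p2 x\<bar> \<le> B"
    using compact_imp_bounded[OF compact_continuous_image[OF p2_cont'[of "{0..2*pi}"] compact_Icc]] unfolding bounded_pos by auto
  have bd: "\<bar>(real k)\<^sup>2 * integral {0..2*pi} (\<lambda>x. p x * t x)\<bar> \<le> B * (2 * pi)"
    if t: "t = (\<lambda>x. cos (real k * x)) \<or> t = (\<lambda>x. sin (real k * x))" for k t
  proof -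
    have tr: "cos (real k * (2 * pi)) = 1" "sin (real k * (2 * pi)) = 0"
      using trig_periodic[of k 0] by simp_all
    have tc: "continuous_on UNIV t" and t1: "\<And>x. \<bar>t x\<bar> \<le> 1" using t by (auto intro!: continuous_intros)
    note [continuous_intros] = continuous_on_compose2[OF tc _ subset_UNIV]
    have "((\<lambda>x. p2 x * t x + (real k)\<^sup>2 * (p x * t x)) has_integral 0) {0..2*pi}"
    proof (cases "t = (\<lambda>x. cos (real k * x))")
      case True
      show ?thesis unfolding True
        by (rule has_integral_deriv_periodic[where f = "\<lambda>x. p1 x * cos (real k * x) + real k * (p x * sin (real k * x))"])
           ((auto intro!: derivative_eq_intros p_deriv p1_deriv simp: algebra_simps power2_eq_square)[1], simp_all only: per tr, simp_all)
    next
      case False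
      then have t': "t = (\<lambda>x. sin (real k * x))" using t by simp
      show ?thesis unfolding t'
        by (rule has_integral_deriv_periodic[where f = "\<lambda>x. p1 x * sin (real k * x) - real k * (p x * cos (real k * x))"])
           ((auto intro!: derivative_eq_intros p_deriv p1_deriv simp: algebra_simps power2_eq_square)[1], simp_all only: per tr, simp_all)
    qed
    then have "integral {0..2*pi} (\<lambda>x. p2 x * t x + (real k)\<^sup>2 * (p x * t x)) = 0" by (rule integral_unique)
    moreover have "integral {0..2*pi} (\<lambda>x. p2 x * t x + (real k)\<^sup>2 * (p x * t x)) =
       integral {0..2*pi} (\<lambda>x. p2 x * t x) + (real k)\<^sup>2 * integral {0..2*pi} (\<lambda>x. p x * t x)"
      by (subst integral_add) (auto intro!: p_intble continuous_intros)
    ultimately have "(real k)\<^sup>2 * integral {0..2*pi} (\<lambda>x. p x * t x) = - integral {0..2*pi} (\<lambda>x. p2 x * t x)" by linarith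
    moreover have "norm (integral {0..2*pi} (\<lambda>x. p2 x * t x)) \<le> B * (2 * pi - 0)"
    proof (rule integral_bound)
      show "continuous_on {0..2*pi} (\<lambda>x. p2 x * t x)" by (intro continuous_intros)
      show "norm (p2 x * t x) \<le> B" if "x \<in> {0..2*pi}" for x
        using mult_mono[OF B(2)[OF that] t1[of x]] B(1) by (simp add: abs_mult)
    qed simp
    ultimately show ?thesis by simp
  qed
  have "real k ^ 4 * fourier_sq k \<le> 2 * (2 * B)\<^sup>2" for k
  proof (cases "k = 0")
    case False
    have 1: "\<bar>(real k)\<^sup>2 * fourier_a p k\<bar> \<le> 2 * B"
      using bd[OF disjI1[OF refl], of k] False by (simp add: fourier_a_def abs_mult field_simps)
    have 2: "\<bar>(real k)\<^sup>2 * fourier_b p k\<bar> \<le> 2 * B"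
      using bd[OF disjI2[OF refl], of k] by (simp add: fourier_b_def abs_mult field_simps)
    have "real k ^ 4 * fourier_sq k = ((real k)\<^sup>2 * fourier_a p k)\<^sup>2 + ((real k)\<^sup>2 * fourier_b p k)\<^sup>2"
      by (simp add: fourier_sq_def power_mult_distrib algebra_simps)
    also have "\<dots> \<le> (2 * B)\<^sup>2 + (2 * B)\<^sup>2"
      using 1 2 by (intro add_mono) (metis abs_ge_zero power2_abs power_mono)+
    finally show ?thesis by simp
  qed simp
  then show ?thesis using that by blast
qed

lemma summable_sq_fourier_sq: "summable (\<lambda>k. (real k)\<^sup>2 * fourier_sq k)"
proof -
  obtain M where M: "\<And>k. real k ^ 4 * fourier_sq k \<le> M" using fourier_sq_decay by blast
  show ?thesis
  proof (rule summable_comparison_test')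
    show "summable (\<lambda>k. M * inverse (real k ^ 2))"
      by (intro summable_mult inverse_power_summable) simp
    show "norm ((real k)\<^sup>2 * fourier_sq k) \<le> M * inverse (real k ^ 2)" if "1 \<le> k" for k
    proof -
      have "(real k)\<^sup>2 * fourier_sq k = (real k ^ 4 * fourier_sq k) * inverse (real k ^ 2)"
        using that by (simp add: field_simps power2_eq_square power4_eq_xxxx)
      also have "\<dots> \<le> M * inverse (real k ^ 2)" by (intro mult_right_mono M) simp
      finally show ?thesis using fourier_sq_nonneg[of k] by simp
    qed
  qed
qed

lemma summable_corr_coeff: "summable (\<lambda>k. real k * corr_coeff k)" "summable corr_coeff"
proof -
  have s: "summable (\<lambda>k. pi * ((real k)\<^sup>2 * fourier_sq k))" by (intro summable_mult summable_sq_fourier_sq)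
  have "norm (real k * corr_coeff k) \<le> pi * ((real k)\<^sup>2 * fourier_sq k)" "norm (corr_coeff k) \<le> pi * ((real k)\<^sup>2 * fourier_sq k)" if "1 \<le> k" for k
  proof -
    have k: "real k \<le> (real k)\<^sup>2" "1 \<le> (real k)\<^sup>2" using that by (auto simp: power2_eq_square mult_ge1_I)
    then show "norm (real k * corr_coeff k) \<le> pi * ((real k)\<^sup>2 * fourier_sq k)" "norm (corr_coeff k) \<le> pi * ((real k)\<^sup>2 * fourier_sq k)"
      using mult_right_mono[OF k(1) fourier_sq_nonneg[of k]] mult_right_mono[OF k(2) fourier_sq_nonneg[of k]] that fourier_sq_nonneg[of k]
      by (simp_all add: corr_coeff_def)
  qed
  then show "summable (\<lambda>k. real k * corr_coeff k)" "summable corr_coeff"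
    using s by (blast intro: summable_comparison_test')+
qed

lemma r0_reflect:
  assumes "0 \<le> d" "d \<le> 2 * pi"
  shows "r0 (2 * pi - d) = r0 d"
proof -
  define f where "f x = p x * p (x - d)" for x
  have "r0 (2 * pi - d) = integral {0..2*pi} f"
    unfolding r0_def f_def
  proof (intro integral_cong)
    fix x
    show "p x * p (x + (2 * pi - d)) = p x * p (x - d)"
      using p_periodic[of "x - d"] by (simp add: algebra_simps)
  qed
  also have "\<dots> = integral {0..2*pi} (\<lambda>x. f (x + d))"
  proof (rule integral_periodic_shift[symmetric])
    show "continuous_on UNIV f" unfolding f_def[abs_def] by (intro continuous_intros)
    show "f (x + 2 * pi) = f x" for x
      using p_periodic[of x] p_periodic[of "x - d"] by (simp add: f_def algebra_simps)
  qed (use assms in auto)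
  also have "\<dots> = r0 d" unfolding r0_def f_def by (intro integral_cong) (simp add: mult.commute)
  finally show ?thesis .
qed

text \<open>The series converges uniformly to a continuous function that is symmetric about \<open>\<pi>\<close> and has the
  cosine coefficients of \<open>r0\<close>, so the uniqueness lemma applies to the difference.\<close>
lemma r0_series:
  assumes "0 \<le> d" "d \<le> 2 * pi"
  shows "r0 d = (\<Sum>k. corr_coeff k * cos (real k * d))"
proof -
  define S where "S d = (\<Sum>k. corr_coeff k * cos (real k * d))" for d
  have unif: "uniform_limit UNIV (\<lambda>n x. \<Sum>i<n. corr_coeff i * t i x) (\<lambda>x. \<Sum>i. corr_coeff i * t i x) sequentially"
    if "\<And>i x. \<bar>t i x\<bar> \<le> 1" for t :: "nat \<Rightarrow> real \<Rightarrow> real"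
  proof (rule Weierstrass_m_test[OF _ summable_corr_coeff(2)])
    show "norm (corr_coeff i * t i x) \<le> corr_coeff i" for i x
      using mult_left_mono[OF that[of i x] corr_coeff_nonneg[of i]] corr_coeff_nonneg[of i] by (simp add: abs_mult)
  qed
  have S_cont: "continuous_on UNIV S"
  proof (rule uniform_limit_theorem)
    show "uniform_limit UNIV (\<lambda>n x. \<Sum>i<n. corr_coeff i * cos (real i * x)) S sequentially"
      unfolding S_def[abs_def] by (rule unif) simp
  qed (auto intro!: always_eventually continuous_intros)
  have S_coeff: "integral {0..2*pi} (\<lambda>x. S x * cos (real k * x)) = corr_coeff k * (if k = 0 then 2 * pi else pi)" for k
  proof -
    have "uniform_limit UNIV (\<lambda>n x. \<Sum>i<n. corr_coeff i * (cos (real i * x) * cos (real k * x)))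
      (\<lambda>x. \<Sum>i. corr_coeff i * (cos (real i * x) * cos (real k * x))) sequentially"
    proof (rule unif)
      show "\<bar>cos (real i * x) * cos (real k * x)\<bar> \<le> 1" for i x
        using mult_mono[of "\<bar>cos (real i * x)\<bar>" 1 "\<bar>cos (real k * x)\<bar>" 1] by (simp add: abs_mult)
    qed
    then have "uniform_limit {0..2*pi} (\<lambda>n x. \<Sum>i<n. corr_coeff i * (cos (real i * x) * cos (real k * x)))
      (\<lambda>x. \<Sum>i. corr_coeff i * (cos (real i * x) * cos (real k * x))) sequentially"
      by (rule uniform_limit_on_subset) simp
    then obtain I J where IJ:
      "\<And>n. ((\<lambda>x. \<Sum>i<n. corr_coeff i * (cos (real i * x) * cos (real k * x))) has_integral I n) {0..2*pi}"
      "((\<lambda>x. \<Sum>i. corr_coeff i * (cos (real i * x) * cos (real k * x))) has_integral J) {0..2*pi}" "I \<longlonglongrightarrow> J"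
      by (rule uniform_limit_integral) (auto intro!: continuous_intros)
    have I: "I n = corr_coeff k * (if k = 0 then 2 * pi else pi)" if "k < n" for n
    proof -
      have "I n = integral {0..2*pi} (\<lambda>x. \<Sum>i<n. corr_coeff i * (cos (real i * x) * cos (real k * x)))"
        using integral_unique[OF IJ(1)] by simp
      also have "\<dots> = (\<Sum>i<n. integral {0..2*pi} (\<lambda>x. corr_coeff i * (cos (real i * x) * cos (real k * x))))"
        by (rule integral_sum) (auto intro!: p_intble continuous_intros)
      also have "\<dots> = (\<Sum>i<n. corr_coeff i * (if i = k then if k = 0 then 2 * pi else pi else 0))"
        unfolding integral_mult_right integral_cos_cos_nat ..
      also have "\<dots> = corr_coeff k * (if k = 0 then 2 * pi else pi)"
        using that by (simp add: if_distrib[of "\<lambda>x. _ * x"] cong: if_cong)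
      finally show ?thesis .
    qed
    have "I \<longlonglongrightarrow> corr_coeff k * (if k = 0 then 2 * pi else pi)"
      by (rule tendsto_eventually, rule eventually_mono[OF eventually_gt_at_top[of k]]) (rule I)
    then have J: "J = corr_coeff k * (if k = 0 then 2 * pi else pi)" using IJ(3) LIMSEQ_unique by blast
    have "S x * cos (real k * x) = (\<Sum>i. corr_coeff i * (cos (real i * x) * cos (real k * x)))" for x
      unfolding S_def mult.assoc[symmetric]
      by (rule suminf_mult2) (intro summable_bounded_mult summable_corr_coeff corr_coeff_nonneg abs_cos_le_one)
    then show ?thesis using integral_unique[OF IJ(2)] J by simp
  qed
  have "r0 d - S d = 0"
  proof (rule cosine_coefficients_zero_imp_zero[where e = "\<lambda>d. r0 d - S d"])
    show "continuous_on {0..2*pi} (\<lambda>d. r0 d - S d)"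
      by (intro continuous_intros r0_cont continuous_on_subset[OF S_cont]) auto
    show "r0 (2 * pi - x) - S (2 * pi - x) = r0 x - S x" if "0 \<le> x" "x \<le> 2 * pi" for x
    proof -
      have "cos (real k * (2 * pi - x)) = cos (real k * x)" for k
        using trig_periodic(1)[of k "- x"] by simp
      then show ?thesis using r0_reflect[OF that] by (simp add: S_def)
    qed
    show "integral {0..2*pi} (\<lambda>x. (r0 x - S x) * cos (real k * x)) = 0" for k
    proof -
      have "integral {0..2*pi} (\<lambda>x. r0 x * cos (real k * x) - S x * cos (real k * x)) =
         integral {0..2*pi} (\<lambda>x. r0 x * cos (real k * x)) - integral {0..2*pi} (\<lambda>x. S x * cos (real k * x))"
        by (intro integral_diff p_intble continuous_intros r0_cont S_cont)
      then show ?thesis by (simp add: left_diff_distrib integral_r0_cos_coeff S_coeff)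
    qed
  qed (use assms in auto)
  then show ?thesis by (simp add: S_def)
qed

lemma r1_series:
  assumes d: "0 < d" "d < 2 * pi"
  shows "r1 d = (\<Sum>k. - (real k * corr_coeff k * sin (real k * d)))"
proof -
  have 1: "((\<lambda>x. corr_coeff k * cos (real k * x)) has_real_derivative - (real k * corr_coeff k * sin (real k * x))) (at x within UNIV)" for k x
    by (auto intro!: derivative_eq_intros)
  have 2: "uniformly_convergent_on UNIV (\<lambda>n x. \<Sum>k<n. - (real k * corr_coeff k * sin (real k * x)))"
  proof (rule Weierstrass_m_test'[OF _ summable_corr_coeff(1)])
    show "norm (- (real k * corr_coeff k * sin (real k * x))) \<le> real k * corr_coeff k" for k x
      using mult_left_mono[OF abs_sin_le_one, of "real k * corr_coeff k" "real k * x"] corr_coeff_nonneg[of k]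
      by (simp add: abs_mult)
  qed
  have 3: "summable (\<lambda>k. corr_coeff k * cos (real k * 0))" using summable_corr_coeff(2) by simp
  have D: "((\<lambda>d. \<Sum>k. corr_coeff k * cos (real k * d)) has_real_derivative (\<Sum>k. - (real k * corr_coeff k * sin (real k * d)))) (at d)"
    using has_field_derivative_series'(2)[OF convex_UNIV 1 2 UNIV_I 3, of d] by simp
  have "(r0 has_real_derivative (\<Sum>k. - (real k * corr_coeff k * sin (real k * d)))) (at d)"
    by (rule has_field_derivative_transform_within_open[OF D, of "{0<..<2*pi}"]) (use d r0_series in auto)
  then show ?thesis using r0_deriv DERIV_unique by blast
qed

lemma iso_num_series:
  assumes d: "0 < d" "d < 2 * pi"
  shows "(\<lambda>k. corr_coeff k * iso_kernel k d) sums iso_num d"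
proof -
  have 0: "corr_coeff sums r0 0"
    using summable_sums[OF summable_corr_coeff(2)] r0_series[of 0] by simp
  have 1: "(\<lambda>k. corr_coeff k * cos (real k * d)) sums r0 d"
    using summable_sums[OF summable_bounded_mult[OF summable_corr_coeff(2) corr_coeff_nonneg abs_cos_le_one, of "\<lambda>k. real k * d"]] r0_series[of d] d
    by simp
  have 2: "(\<lambda>k. - (real k * corr_coeff k * sin (real k * d))) sums r1 d"
    using summable_sums[OF summable_minus[OF summable_bounded_mult[OF summable_corr_coeff(1) _ abs_sin_le_one, of "\<lambda>k. real k * d"]]] r1_series[OF d]
      corr_coeff_nonneg by simp
  from sums_add[OF sums_diff[OF 0 sums_mult[OF 1, of "cos d"]] sums_mult[OF 2, of "sin d"]]
  show ?thesis unfolding iso_num_def iso_kernel_def by (simp add: algebra_simps)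
qed

end

section \<open>Integrating the weight against the isoptic area\<close>

context periodic_C2 begin

lemma iso_area_bound:
  obtains B where "0 < B" "\<And>d. 0 < d \<Longrightarrow> d < pi \<Longrightarrow> \<bar>iso_area d\<bar> * (1 + cos d) \<le> B"
proof -
  obtain B where B: "0 < B" "\<And>d. 0 \<le> d \<Longrightarrow> d \<le> pi \<Longrightarrow> \<bar>iso_num d\<bar> \<le> B * (1 - cos d)"
    using iso_num_bound by blast
  have "\<bar>iso_area d\<bar> * (1 + cos d) \<le> B" if d: "0 < d" "d < pi" for d
  proof -
    have s: "0 < (sin d)\<^sup>2" using sin_gt_zero[OF d] by simp
    have "\<bar>iso_num d\<bar> * (1 + cos d) \<le> B * (1 - cos d) * (1 + cos d)"
      by (rule mult_right_mono[OF B(2)[OF less_imp_le[OF d(1)] less_imp_le[OF d(2)]]])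
         (use cos_ge_minus_one[of d] in linarith)
    also have "\<dots> = B * (sin d)\<^sup>2" unfolding sin_squared_eq by (simp add: power2_eq_square algebra_simps)
    finally show ?thesis using s by (simp add: iso_area_def abs_mult pos_divide_le_eq)
  qed
  then show ?thesis using that B(1) by blast
qed

lemma iso_num_measurable [measurable]: "iso_num \<in> borel_measurable borel"
  by (intro borel_measurable_continuous_onI continuous_at_imp_continuous_on ballI DERIV_isCont[OF iso_num_deriv])

lemma iso_area_measurable [measurable]: "iso_area \<in> borel_measurable borel"
  unfolding iso_area_def[abs_def] by measurable

text \<open>Integration by parts on the open interval. Integrability of \<open>f(\<pi> - d) J d\<close> is not known beforehand;
  adding the constant \<open>B A\<close>, which dominates the bounded remaining term \<open>h\<close>, makes the integrand
  nonnegative, so that the fundamental theorem yields integrability together with the value.\<close>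
lemma integrate_isoptic_area:
  assumes m: "1 \<le> m"
    and J: "\<And>d. 0 < d \<Longrightarrow> d < pi \<Longrightarrow> (iso_area has_real_derivative J d) (at d) \<and> 0 \<le> J d"
    and J_cont: "\<And>d. 0 < d \<Longrightarrow> d < pi \<Longrightarrow> isCont J d"
  shows "set_integrable lborel {0<..<pi} (\<lambda>d. deriv (omega_fun m) (pi - d) * iso_area d)"
    "set_integrable lborel {0<..<pi} (\<lambda>d. omega_fun m (pi - d) * J d)"
    "(LINT d:{0<..<pi}|lborel. omega_fun m (pi - d) * J d) =
       (LINT d:{0<..<pi}|lborel. deriv (omega_fun m) (pi - d) * iso_area d) - pi ^ m * ((r0 0 + r2 0) / 2)"
proof -
  obtain B where B: "0 < B" "\<And>w. 0 \<le> w \<Longrightarrow> w \<le> pi \<Longrightarrow> 0 \<le> deriv (omega_fun m) w \<and> deriv (omega_fun m) w \<le> B * (1 - cos w)"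
    using deriv_omega_fun_bound[of m] by metis
  obtain A where A: "0 < A" "\<And>d. 0 < d \<Longrightarrow> d < pi \<Longrightarrow> \<bar>iso_area d\<bar> * (1 + cos d) \<le> A"
    using iso_area_bound by metis
  have cp: "cos (pi - d) = - cos d" for d by (simp add: cos_diff)
  define h where "h d = deriv (omega_fun m) (pi - d) * iso_area d" for d
  have h_bound: "\<bar>h d\<bar> \<le> B * A" if d: "0 < d" "d < pi" for d
  proof -
    have "\<bar>h d\<bar> \<le> (B * (1 + cos d)) * \<bar>iso_area d\<bar>"
      unfolding h_def abs_mult using B(2)[of "pi - d"] d by (intro mult_right_mono) (simp_all add: cp)
    also have "\<dots> = B * (\<bar>iso_area d\<bar> * (1 + cos d))" by simp
    also have "\<dots> \<le> B * A" using A(2)[OF d] B(1) by (intro mult_left_mono) auto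
    finally show ?thesis .
  qed
  have [measurable]: "h \<in> borel_measurable borel" unfolding h_def[abs_def] by measurable
  have h_int: "set_integrable lborel {0<..<pi} h"
    by (rule set_integrable_bounded_interval[where B = "B * A" and a = 0 and b = pi]) (use h_bound in auto)
  define H where "H d = omega_fun m (pi - d) * iso_area d + (B * A) * d" for d
  define H' where "H' d = omega_fun m (pi - d) * J d - h d + B * A" for d
  have om: "0 \<le> omega_fun m (pi - d)" "omega_fun m (pi - d) \<le> (pi - d) * (B * (1 + cos d))" if "0 < d" "d < pi" for d
    using omega_fun_bound[OF m B(2), of "pi - d"] that B(1) by (simp_all add: cp)
  have D: "(H has_real_derivative H' d) (at d)" if "0 < d" "d < pi" for d
  proof -
    have "((\<lambda>d. omega_fun m (pi - d)) has_real_derivative deriv (omega_fun m) (pi - d) * (0 - 1)) (at d)"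
      unfolding deriv_omega_fun by (rule DERIV_chain2[OF omega_fun_deriv]) (intro derivative_intros)
    then show ?thesis
      unfolding H_def[abs_def] H'_def h_def
      using J[OF that] by (auto intro!: derivative_eq_intros simp: algebra_simps)
  qed
  have H'_cont: "isCont H' d" if d: "0 < d" "d < pi" for d
  proof -
    have "isCont iso_area d" using DERIV_isCont J[OF d] by blast
    then show ?thesis unfolding H'_def[abs_def] h_def
      using J_cont[OF d] isCont_o2[of d "\<lambda>d. pi - d" "omega_fun m"] isCont_o2[of d "\<lambda>d. pi - d" "deriv (omega_fun m)"]
        isCont_omega_fun isCont_deriv_omega_fun
      by (intro continuous_intros) auto
  qed
  have H'_nonneg: "0 \<le> H' d" if d: "0 < d" "d < pi" for d
    using abs_le_D1[OF h_bound[OF d]] mult_nonneg_nonneg[OF om(1)[OF d] conjunct2[OF J[OF d]]] unfolding H'_def by linarith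
  have lim0: "(H \<longlongrightarrow> pi ^ m * ((r0 0 + r2 0) / 2)) (at_right 0)"
  proof -
    have "isCont (\<lambda>d. omega_fun m (pi - d)) 0"
      using isCont_o2[of 0 "\<lambda>d. pi - d" "omega_fun m"] isCont_omega_fun by (auto intro!: continuous_intros)
    from tendsto_within_subset[OF isContD[OF this], of "{0<..}"]
    have "((\<lambda>d. omega_fun m (pi - d)) \<longlongrightarrow> omega_fun m (pi - 0)) (at_right 0)" by simp
    then have "((\<lambda>d. omega_fun m (pi - d)) \<longlongrightarrow> pi ^ m) (at_right 0)" using omega_fun_pi[OF m] by simp
    from tendsto_add[OF tendsto_mult[OF this iso_area_limit] tendsto_mult[OF tendsto_const[of "B * A"] tendsto_ident_at]]
    show ?thesis unfolding H_def[abs_def] by simp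
  qed
  have lim1: "(H \<longlongrightarrow> B * A * pi) (at_left pi)"
  proof -
    have "((\<lambda>d. omega_fun m (pi - d) * iso_area d) \<longlongrightarrow> 0) (at_left pi)"
    proof (rule tendsto_0_le[where K = 1])
      have "((\<lambda>d. (pi - d) * (B * A)) \<longlongrightarrow> (pi - pi) * (B * A)) (at_left pi)"
        by (intro tendsto_intros)
      then show "((\<lambda>d. (pi - d) * (B * A)) \<longlongrightarrow> 0) (at_left pi)" by simp
      have "eventually (\<lambda>d. d \<in> {0<..<pi}) (at_left pi)" by (rule eventually_at_left_real) simp
      then show "eventually (\<lambda>d. norm (omega_fun m (pi - d) * iso_area d) \<le> norm ((pi - d) * (B * A)) * 1) (at_left pi)"
      proof eventually_elim
        fix d assume "d \<in> {0<..<pi}"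
        then have d: "0 < d" "d < pi" by auto
        have "norm (omega_fun m (pi - d) * iso_area d) \<le> ((pi - d) * (B * (1 + cos d))) * \<bar>iso_area d\<bar>"
          using om[OF d] by (simp add: abs_mult mult_right_mono)
        also have "\<dots> = ((pi - d) * B) * (\<bar>iso_area d\<bar> * (1 + cos d))" by simp
        also have "\<dots> \<le> ((pi - d) * B) * A" using A(2)[OF d] B(1) d by (intro mult_left_mono) auto
        finally show "norm (omega_fun m (pi - d) * iso_area d) \<le> norm ((pi - d) * (B * A)) * 1"
          using d A(1) B(1) by (simp add: abs_mult)
      qed
    qed
    from tendsto_add[OF this tendsto_mult[OF tendsto_const[of "B * A"] tendsto_ident_at]]
    show ?thesis unfolding H_def[abs_def] by simp
  qed
  have ei: "einterval (ereal 0) (ereal pi) = {0<..<pi}" by simp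
  have "set_integrable lborel (einterval (ereal 0) (ereal pi)) H'"
    "(LBINT d=ereal 0..ereal pi. H' d) = B * A * pi - pi ^ m * ((r0 0 + r2 0) / 2)"
    by (rule interval_integral_FTC_nonneg[where F = H];
        use D H'_cont H'_nonneg lim0 lim1 in \<open>simp add: ereal_tendsto_simps\<close>)+
  then have H'_int: "set_integrable lborel {0<..<pi} H'" "(LINT d:{0<..<pi}|lborel. H' d) = B * A * pi - pi ^ m * ((r0 0 + r2 0) / 2)"
    unfolding ei by (simp_all add: interval_lebesgue_integral_def)
  have c_int: "set_integrable lborel {0<..<pi} (\<lambda>_. B * A)"
    by (rule set_integrable_bounded_interval[where B = "B * A" and a = 0 and b = pi]) (use A(1) B(1) in auto)
  have c_val: "(LINT d:{0<..<pi}|lborel. B * A) = B * A * pi"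
    by (simp add: set_lebesgue_integral_def)
  have eq: "omega_fun m (pi - d) * J d = H' d + h d - B * A" for d by (simp add: H'_def)
  show "set_integrable lborel {0<..<pi} (\<lambda>d. deriv (omega_fun m) (pi - d) * iso_area d)"
    using h_int by (simp add: h_def[abs_def])
  show "set_integrable lborel {0<..<pi} (\<lambda>d. omega_fun m (pi - d) * J d)"
    unfolding eq by (intro set_integral_diff set_integral_add H'_int h_int c_int)
  show "(LINT d:{0<..<pi}|lborel. omega_fun m (pi - d) * J d) =
       (LINT d:{0<..<pi}|lborel. deriv (omega_fun m) (pi - d) * iso_area d) - pi ^ m * ((r0 0 + r2 0) / 2)"
    unfolding eq h_def[symmetric]
    using set_integral_diff(2)[OF set_integral_add(1)[OF H'_int(1) h_int] c_int] set_integral_add(2)[OF H'_int(1) h_int] H'_int(2) c_val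
    by linarith
qed

lemma iso_area_series:
  assumes w: "0 < w" "w < pi"
  shows "(\<lambda>k. corr_coeff k * beta_integrand m k w) sums (deriv (omega_fun m) w * iso_area (pi - w))"
proof -
  have s: "sin (pi - w) = sin w" by (simp add: sin_diff)
  have "(\<lambda>k. deriv (omega_fun m) w / (sin w)\<^sup>2 * (corr_coeff k * iso_kernel k (pi - w))) sums
      (deriv (omega_fun m) w / (sin w)\<^sup>2 * iso_num (pi - w))"
    by (intro sums_mult iso_num_series) (use w in auto)
  then show ?thesis
    by (simp add: beta_integrand_def g_fun_eq_iso_kernel iso_area_def s mult_ac)
qed

text \<open>The terms are bounded by \<open>corr_coeff k (k\<^sup>2 + 1) B\<close>, a summable sequence of constants on a bounded
  interval.\<close>
lemma integral_isoptic_area_series: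
  "(\<lambda>k. corr_coeff k * beta_coeff m k) sums (LINT d:{0<..<pi}|lborel. deriv (omega_fun m) (pi - d) * iso_area d)"
proof -
  obtain B where B: "0 < B" "\<And>w. 0 \<le> w \<Longrightarrow> w \<le> pi \<Longrightarrow> 0 \<le> deriv (omega_fun m) w \<and> deriv (omega_fun m) w \<le> B * (1 - cos w)"
    using deriv_omega_fun_bound[of m] by metis
  define f where "f k w = indicator {0<..<pi} w *\<^sub>R (corr_coeff k * beta_integrand m k w)" for k and w :: real
  define b where "b k = corr_coeff k * (((real k)\<^sup>2 + 1) * B)" for k
  have b_summable: "summable b"
  proof -
    have "summable (\<lambda>k. 2 * pi * ((real k)\<^sup>2 * fourier_sq k))" by (intro summable_mult summable_sq_fourier_sq)
    then have "summable (\<lambda>k. (real k)\<^sup>2 * corr_coeff k)"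
    proof (rule summable_comparison_test'[where N = 0])
      show "norm ((real k)\<^sup>2 * corr_coeff k) \<le> 2 * pi * ((real k)\<^sup>2 * fourier_sq k)" for k
        using fourier_sq_nonneg[of k] by (simp add: corr_coeff_def mult_ac)
    qed
    from summable_mult[OF summable_add[OF this summable_corr_coeff(2)], of B]
    show ?thesis by (simp add: b_def[abs_def] algebra_simps)
  qed
  have f_bound: "norm (f k w) \<le> indicator {0<..<pi} w *\<^sub>R b k" for k w
    using beta_integrand_bound[OF B(2), of w k] corr_coeff_nonneg[of k]
    by (auto simp: f_def b_def indicator_def abs_mult intro!: mult_left_mono)
  have c_int: "integrable lborel (\<lambda>w. indicator {0<..<pi} w *\<^sub>R c)" for c :: real
    using set_integrable_bounded_interval[of "\<lambda>_. c" "{0<..<pi}" "\<bar>c\<bar>" 0 pi] by (auto simp: set_integrable_def)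
  have f_int: "integrable lborel (f k)" for k
  proof -
    have "set_integrable lborel {0<..<pi} (beta_integrand m k)"
      by (rule set_integrable_subset[OF set_integrable_beta]) auto
    then have "set_integrable lborel {0<..<pi} (\<lambda>w. corr_coeff k * beta_integrand m k w)"
      by (intro set_integrable_mult_right)
    then show ?thesis by (simp add: f_def[abs_def] set_integrable_def)
  qed
  have "(\<lambda>k. integral\<^sup>L lborel (f k)) sums (\<integral>w. (\<Sum>k. f k w) \<partial>lborel)"
  proof (rule sums_integral[OF f_int])
    show "AE w in lborel. summable (\<lambda>k. norm (f k w))"
    proof (rule AE_I2)
      fix w :: real
      have "norm (norm (f k w)) \<le> b k" for k
      proof -
        have "0 \<le> b k" using corr_coeff_nonneg[of k] B(1) by (simp add: b_def)
        then show ?thesis using f_bound[of k w] by (cases "w \<in> {0<..<pi}") auto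
      qed
      then show "summable (\<lambda>k. norm (f k w))" by (intro summable_comparison_test'[OF b_summable])
    qed
    show "summable (\<lambda>k. \<integral>w. norm (f k w) \<partial>lborel)"
    proof (rule summable_comparison_test'[OF summable_mult2[OF b_summable, of pi]])
      fix k
      have "(\<integral>w. norm (f k w) \<partial>lborel) \<le> (\<integral>w. indicator {0<..<pi} w *\<^sub>R b k \<partial>lborel)"
        by (intro integral_mono integrable_norm f_int c_int f_bound)
      then show "norm (\<integral>w. norm (f k w) \<partial>lborel) \<le> b k * pi" by (simp add: mult.commute)
    qed
  qed
  moreover have "integral\<^sup>L lborel (f k) = corr_coeff k * beta_coeff m k" for k
  proof -
    have "f k = (\<lambda>w. corr_coeff k * (indicator {0<..<pi} w *\<^sub>R beta_integrand m k w))"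
      by (simp add: f_def fun_eq_iff)
    then have "integral\<^sup>L lborel (f k) = corr_coeff k * (LINT w:{0<..<pi}|lborel. beta_integrand m k w)"
      unfolding set_lebesgue_integral_def by (simp only: integral_mult_right_zero)
    then show ?thesis
      unfolding beta_coeff_def set_integral_Icc_Ioo[OF set_integrable_beta] .
  qed
  moreover have "(\<integral>w. (\<Sum>k. f k w) \<partial>lborel) = (LINT w:{0<..<pi}|lborel. deriv (omega_fun m) w * iso_area (pi - w))"
    unfolding set_lebesgue_integral_def
  proof (rule Bochner_Integration.integral_cong[OF refl])
    fix w :: real
    show "(\<Sum>k. f k w) = indicator {0<..<pi} w *\<^sub>R (deriv (omega_fun m) w * iso_area (pi - w))"
      using sums_unique[OF iso_area_series[of w m]] by (simp add: f_def indicator_def)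
  qed
  moreover have "\<dots> = (LINT d:{0<..<pi}|lborel. deriv (omega_fun m) (pi - d) * iso_area d)"
    using set_integral_reflect[of "\<lambda>w. deriv (omega_fun m) w * iso_area (pi - w)"] by simp
  ultimately show ?thesis by simp
qed

end

section \<open>Change of variables on a product domain in the plane\<close>

lemma measurable_vector2: "(\<lambda>(x::real, y::real). vector [x, y] :: real^2) \<in> borel \<rightarrow>\<^sub>M borel"
proof -
  have "(\<lambda>(x::real, y::real). vector [x, y] :: real^2) = (\<lambda>z. fst z *\<^sub>R axis 1 1 + snd z *\<^sub>R axis 2 1)"
    by (auto simp: fun_eq_iff vec_eq_iff forall_2 axis_def)
  moreover have "continuous_on UNIV (\<lambda>z::real \<times> real. fst z *\<^sub>R axis 1 1 + snd z *\<^sub>R axis 2 1 :: real^2)"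
    by (intro continuous_intros)
  ultimately show ?thesis by (simp add: borel_measurable_continuous_onI)
qed

lemma lborel_vec2: "(lborel :: (real^2) measure) = distr (lborel \<Otimes>\<^sub>M lborel) borel (\<lambda>(x, y). vector [x, y])"
proof (rule lborel_eqI)
  fix l u :: "real^2" assume le: "\<And>b. b \<in> Basis \<Longrightarrow> l \<bullet> b \<le> u \<bullet> b"
  have "axis i 1 \<in> (Basis :: (real^2) set)" for i :: 2 by (simp add: axis_in_Basis_iff)
  then have le: "l $ i \<le> u $ i" for i using le[of "axis i 1"] by (simp add: inner_axis)
  have "emeasure (distr (lborel \<Otimes>\<^sub>M lborel) borel (\<lambda>(x, y). vector [x, y] :: real^2)) (box l u) =
     emeasure (lborel :: (real \<times> real) measure) (box (l $ 1, l $ 2) (u $ 1, u $ 2))"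
    using measurable_vector2 unfolding lborel_prod
    by (subst emeasure_distr) (auto intro!: arg_cong[where f = "emeasure _"] simp: mem_box_cart mem_box forall_2 Basis_prod_def)
  also have "\<dots> = ennreal ((u $ 1 - l $ 1) * (u $ 2 - l $ 2))"
    using le by (subst emeasure_lborel_box) (auto simp: Basis_prod_def prod.union_disjoint)
  also have "(u $ 1 - l $ 1) * (u $ 2 - l $ 2) = (\<Prod>b\<in>Basis. (u - l) \<bullet> b)"
    by (simp add: prod.reindex Basis_vec_def UNIV_2 inner_axis axis_eq_axis)
  finally show "emeasure (distr (lborel \<Otimes>\<^sub>M lborel) borel (\<lambda>(x, y). vector [x, y] :: real^2)) (box l u) = (\<Prod>b\<in>Basis. (u - l) \<bullet> b)" .
qed simp

lemma nn_integral_vec2: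
  fixes f :: "real^2 \<Rightarrow> ennreal"
  assumes f: "f \<in> borel_measurable borel"
  shows "(\<integral>\<^sup>+v. f v \<partial>lborel) = (\<integral>\<^sup>+y. \<integral>\<^sup>+x. f (vector [x, y]) \<partial>lborel \<partial>lborel)"
proof -
  have meas': "(\<lambda>(x::real, y::real). vector [x, y] :: real^2) \<in> lborel \<Otimes>\<^sub>M lborel \<rightarrow>\<^sub>M borel"
    using measurable_vector2 by (simp add: lborel_prod)
  have 1: "(\<integral>\<^sup>+v. f v \<partial>lborel) = (\<integral>\<^sup>+z. f ((\<lambda>(x, y). vector [x, y]) z) \<partial>(lborel \<Otimes>\<^sub>M lborel))"
    using f by (subst lborel_vec2, subst nn_integral_distr[OF meas']) auto
  show ?thesis unfolding 1
    using lborel_pair.nn_integral_snd[of "\<lambda>z. f ((\<lambda>(x, y). vector [x, y]) z)"] measurable_compose[OF meas' f]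
    by simp
qed

text \<open>The change of variables theorem combined with Tonelli. The weight \<open>w\<close> depends on the second
  coordinate only and everything is nonnegative, so integrability on the image follows from the
  iterated integral.\<close>
lemma area_formula_product:
  fixes g :: "real^2 \<Rightarrow> real^2" and J :: "real \<Rightarrow> real \<Rightarrow> real" and u :: "real^2 \<Rightarrow> real"
  assumes AB: "A \<in> sets borel" "B \<in> sets borel" and S: "S = {v. v $ 1 \<in> A \<and> v $ 2 \<in> B}"
    and der: "\<And>v. v \<in> S \<Longrightarrow> (g has_derivative g' v) (at v)"
    and inj: "inj_on g S"
    and det: "\<And>v. v \<in> S \<Longrightarrow> \<bar>det (matrix (g' v))\<bar> = J (v $ 1) (v $ 2)"
    and u: "\<And>v. v \<in> S \<Longrightarrow> u (g v) = w (v $ 2)"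
    and J: "\<And>b. b \<in> B \<Longrightarrow> set_integrable lborel A (\<lambda>a. J a b) \<and> (LINT a:A|lborel. J a b) = I b"
    and w: "\<And>b. b \<in> B \<Longrightarrow> 0 \<le> w b"
    and r: "set_integrable lborel B (\<lambda>b. w b * I b)" "(LINT b:B|lborel. w b * I b) = r"
    and meas: "(\<lambda>v. indicator S v * (w (v $ 2) * J (v $ 1) (v $ 2))) \<in> borel_measurable borel"
    and meas_u: "set_borel_measurable borel (g ` S) u"
  shows "set_integrable lborel (g ` S) u \<and> (LINT P:g ` S|lborel. u P) = r"
proof -
  define E where "E v = indicator S v * (w (v $ 2) * J (v $ 1) (v $ 2))" for v
  have J0: "0 \<le> J a b" if "a \<in> A" "b \<in> B" for a b
  proof -
    have "\<bar>det (matrix (g' (vector [a, b])))\<bar> = J a b"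
      using det[of "vector [a, b]"] that by (simp add: S)
    then show ?thesis by (metis abs_ge_zero)
  qed
  have E0: "0 \<le> E v" for v using J0 w by (auto simp: E_def S indicator_def)
  have E_meas: "E \<in> borel_measurable borel" using meas by (simp add: E_def[abs_def])
  have inner: "(\<integral>\<^sup>+x. ennreal (E (vector [x, y])) \<partial>lborel) = ennreal (indicator B y * (w y * I y))" for y
  proof (cases "y \<in> B")
    case True
    have "(\<integral>\<^sup>+x. ennreal (E (vector [x, y])) \<partial>lborel) = (\<integral>\<^sup>+x. ennreal (w y * (indicator A x *\<^sub>R J x y)) \<partial>lborel)"
      using True by (intro nn_integral_cong) (auto simp: E_def S indicator_def)
    also have "\<dots> = ennreal (\<integral>x. w y * (indicator A x *\<^sub>R J x y) \<partial>lborel)"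
      using J[OF True] w[OF True] J0[OF _ True]
      by (intro nn_integral_eq_integral integrable_mult_right) (auto simp: set_integrable_def indicator_def)
    finally show ?thesis using J[OF True] True by (simp add: set_lebesgue_integral_def)
  next
    case False
    then show ?thesis by (simp add: E_def S)
  qed
  have I0: "0 \<le> I b" if "b \<in> B" for b
  proof -
    have "0 \<le> (LINT a:A|lborel. J a b)"
      unfolding set_lebesgue_integral_def
      using J0[OF _ that] by (intro integral_nonneg_AE AE_I2) (auto simp: indicator_def)
    then show ?thesis using J[OF that] by simp
  qed
  have nnE: "(\<integral>\<^sup>+v. ennreal (E v) \<partial>lborel) = ennreal r"
  proof -
    have "(\<integral>\<^sup>+v. ennreal (E v) \<partial>lborel) = (\<integral>\<^sup>+y. ennreal (indicator B y * (w y * I y)) \<partial>lborel)"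
      using E_meas by (subst nn_integral_vec2) (auto simp: inner)
    also have "\<dots> = ennreal (\<integral>y. indicator B y * (w y * I y) \<partial>lborel)"
      using r(1) w I0 by (intro nn_integral_eq_integral) (auto simp: set_integrable_def indicator_def)
    finally show ?thesis using r(2) by (simp add: set_lebesgue_integral_def)
  qed
  have r0: "0 \<le> r"
    unfolding r(2)[symmetric] set_lebesgue_integral_def
    using w I0 by (intro integral_nonneg_AE AE_I2) (auto simp: indicator_def)
  have E_int: "integrable lborel E" "integral\<^sup>L lborel E = r"
    using nn_integral_eq_integrable[of E lborel r] E_meas nnE E0 r0 by auto
  have S_meas: "S \<in> sets borel"
  proof -
    have "(\<lambda>v::real^2. v $ i) \<in> borel_measurable borel" for i
      by (intro borel_measurable_continuous_onI continuous_intros)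
    from this[of 1] this[of 2] AB have "(\<lambda>v::real^2. v $ 1) -` A \<inter> (\<lambda>v. v $ 2) -` B \<in> sets borel"
      by (metis (no_types, lifting) measurable_sets sets.Int space_borel Int_UNIV_right)
    then show ?thesis by (simp add: S vimage_def Int_def)
  qed
  have E_abs: "(\<lambda>v. \<bar>det (matrix (g' v))\<bar> * u (g v)) absolutely_integrable_on S \<and>
      integral S (\<lambda>v. \<bar>det (matrix (g' v))\<bar> * u (g v)) = r"
  proof -
    have eq: "indicator S v *\<^sub>R (\<bar>det (matrix (g' v))\<bar> * u (g v)) = E v" for v
      using det u by (auto simp: E_def indicator_def)
    have "integrable lebesgue E" "integral\<^sup>L lebesgue E = r"
      using E_int E_meas by (simp_all add: integrable_completion integral_completion)
    then have 1: "(\<lambda>v. \<bar>det (matrix (g' v))\<bar> * u (g v)) absolutely_integrable_on S"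
      unfolding set_integrable_def eq by simp
    have "(LINT v:S|lebesgue. \<bar>det (matrix (g' v))\<bar> * u (g v)) = r"
      using \<open>integral\<^sup>L lebesgue E = r\<close> unfolding set_lebesgue_integral_def eq by simp
    then show ?thesis using 1 set_lebesgue_integral_eq_integral(2)[OF 1] by simp
  qed
  have "(\<lambda>P. vec (u P) :: real^1) absolutely_integrable_on (g ` S) \<and> integral (g ` S) (\<lambda>P. vec (u P) :: real^1) = vec r"
    using E_abs
    by (subst has_absolute_integral_change_of_variables[OF _ has_derivative_at_withinI[OF der] inj, symmetric])
       (auto simp: S_meas absolutely_integrable_on_1_iff integral_on_1_eq)
  then have U: "u absolutely_integrable_on (g ` S)" "integral (g ` S) u = r"
    by (auto simp: absolutely_integrable_on_1_iff integral_on_1_eq vec_eq_iff)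
  have "(\<lambda>P. indicator (g ` S) P *\<^sub>R u P) \<in> borel_measurable borel"
    using meas_u by (simp add: set_borel_measurable_def)
  then show ?thesis
    using U set_lebesgue_integral_eq_integral(2)[OF U(1)]
    unfolding set_integrable_def set_lebesgue_integral_def
    by (simp add: integrable_completion integral_completion)
qed

lemma vector2_eq_axis: "(vector [x, y] :: real^2) = x *\<^sub>R axis 1 1 + y *\<^sub>R axis 2 1"
  by (simp add: vec_eq_iff forall_2 axis_def)

lemma det_matrix2: "det (matrix (f :: real^2 \<Rightarrow> real^2)) =
    f (axis 1 1) $ 1 * f (axis 2 1) $ 2 - f (axis 2 1) $ 1 * f (axis 1 1) $ 2"
  by (simp add: det_2 matrix_def)

lemma has_derivative_nth: "((\<lambda>v::real^2. v $ i) has_derivative (\<lambda>w. w $ i)) (at v within S)"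
  by (rule bounded_linear_imp_has_derivative[OF bounded_linear_vec_nth])

section \<open>Support geometry of a smooth oval\<close>

definition nvec :: "real \<Rightarrow> real^2" where "nvec a = vector [cos a, sin a]"
definition tvec :: "real \<Rightarrow> real^2" where "tvec a = vector [- sin a, cos a]"

lemma nvec_nth [simp]: "nvec a $ 1 = cos a" "nvec a $ 2 = sin a"
  by (simp_all add: nvec_def)

lemma tvec_nth [simp]: "tvec a $ 1 = - sin a" "tvec a $ 2 = cos a"
  by (simp_all add: tvec_def)

lemma inner_vec2: "(u::real^2) \<bullet> v = u $ 1 * v $ 1 + u $ 2 * v $ 2"
  by (simp add: inner_vec_def UNIV_2)

lemma vec2_eqI: "(u::real^2) $ 1 = v $ 1 \<Longrightarrow> u $ 2 = v $ 2 \<Longrightarrow> u = v"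
  by (simp add: vec_eq_iff forall_2)

lemma norm_nvec [simp]: "norm (nvec a) = 1" and norm_tvec [simp]: "norm (tvec a) = 1"
  by (simp_all add: norm_eq_sqrt_inner inner_vec2 power2_eq_square[symmetric])

lemma nvec_frame: "v = (v \<bullet> nvec a) *\<^sub>R nvec a + (v \<bullet> tvec a) *\<^sub>R tvec a"
proof -
  have "x = (x * c + y * s) * c + (y * c - x * s) * (- s)" "y = (x * c + y * s) * s + (y * c - x * s) * c"
    if "c\<^sup>2 + s\<^sup>2 = 1" for x y c s :: real
    using that by algebra+
  from this[where c = "cos a" and s = "sin a" and x = "v $ 1" and y = "v $ 2"] show ?thesis
    by (intro vec2_eqI) (simp_all add: inner_vec2)
qed

lemma nvec_cases:
  assumes "norm u = 1"
  obtains a where "0 \<le> a" "a < 2 * pi" "u = nvec a"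
proof -
  have "(u $ 1)\<^sup>2 + (u $ 2)\<^sup>2 = 1"
    using assms by (simp add: norm_eq_sqrt_inner inner_vec2 power2_eq_square)
  then obtain a where "0 \<le> a" "a < 2 * pi" "u $ 1 = cos a" "u $ 2 = sin a"
    by (metis sincos_total_2pi)
  then show ?thesis by (intro that) (auto intro: vec2_eqI)
qed

lemma nvec_eq_iff: "nvec a = nvec b \<longleftrightarrow> (\<exists>j::int. a = b + 2 * pi * j)"
proof -
  have "nvec a = nvec b \<longleftrightarrow> sin a = sin b \<and> cos a = cos b"
    by (auto simp: vec_eq_iff forall_2)
  then show ?thesis
    by (simp add: sin_cos_eq_iff)
qed

lemma nvec_inj:
  assumes "nvec a = nvec b" "\<bar>a - b\<bar> < 2 * pi"
  shows "a = b"
proof -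
  obtain j :: int where j: "a = b + 2 * pi * j" using assms(1) nvec_eq_iff by auto
  then have "\<bar>2 * pi * j\<bar> < 2 * pi" using assms(2) by simp
  then have "\<bar>real_of_int j\<bar> < 1" by (simp add: abs_mult)
  then show ?thesis using j by simp
qed

lemma nvec_pi [simp]: "nvec (a + pi) = - nvec a"
  by (rule vec2_eqI) auto
lemma nvec_2pi [simp]: "nvec (a + 2 * pi) = nvec a"
  by (rule vec2_eqI) auto
lemma tvec_2pi [simp]: "tvec (a + 2 * pi) = tvec a"
  by (rule vec2_eqI) auto

text \<open>Sine rule for three directions: it makes support functions sublinear along the circle.\<close>
lemma nvec_between: "sin (c - a) *\<^sub>R nvec b = sin (c - b) *\<^sub>R nvec a + sin (b - a) *\<^sub>R nvec c"
proof -
  have "(sc * ca - cc * sa) * cb = (sc * cb - cc * sb) * ca + (sb * ca - cb * sa) * cc"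
       "(sc * ca - cc * sa) * sb = (sc * cb - cc * sb) * sa + (sb * ca - cb * sa) * sc" for sa sb sc ca cb cc :: real
    by algebra+
  from this[where sa = "sin a" and sb = "sin b" and sc = "sin c" and ca = "cos a" and cb = "cos b" and cc = "cos c"]
  show ?thesis
    by (intro vec2_eqI) (auto simp: sin_diff)
qed

lemma inner_nvec_deriv: "((\<lambda>a. v \<bullet> nvec a) has_real_derivative v \<bullet> tvec a) (at a)"
  by (auto simp: inner_vec2 intro!: derivative_eq_intros)

lemma nvec_reduce:
  obtains b where "a \<le> b" "b < a + 2 * pi" "nvec b = nvec x"
proof -
  define j where "j = \<lfloor>(x - a) / (2 * pi)\<rfloor>"
  define b where "b = x - 2 * pi * j"
  have "of_int j \<le> (x - a) / (2 * pi)" "(x - a) / (2 * pi) < of_int j + 1" unfolding j_def by linarith+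
  then have "a \<le> b" "b < a + 2 * pi" by (auto simp: b_def field_simps)
  moreover have "x = b + 2 * pi * j" by (simp add: b_def)
  then have "nvec b = nvec x" by (metis nvec_eq_iff)
  ultimately show ?thesis using that by blast
qed

lemma nvec_shift: "nvec a = nvec b \<Longrightarrow> nvec (a + e) = nvec (b + e)"
  by (auto simp: nvec_eq_iff)

locale smooth_oval =
  fixes K :: "(real^2) set" and \<gamma> :: "real \<Rightarrow> real^2" and p p1 p2 :: "real \<Rightarrow> real"
  assumes compact_K: "compact K" and convex_K: "convex K"
    and boundary: "C2_boundary_param K \<gamma>"
    and p_def: "p = support_fun K"
    and p_deriv: "\<And>a. (p has_real_derivative p1 a) (at a)"
    and p1_deriv: "\<And>a. (p1 has_real_derivative p2 a) (at a)"
    and p2_cont: "continuous_on UNIV p2"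
begin

definition d\<gamma> :: "real \<Rightarrow> real^2" where "d\<gamma> t = vector_derivative \<gamma> (at t)"

lemma d\<gamma>: "(\<gamma> has_vector_derivative d\<gamma> t) (at t)" and d\<gamma>_nz: "d\<gamma> t \<noteq> 0"
proof -
  have "C2_fun \<gamma>" using boundary by (simp add: C2_boundary_param_def)
  then show "(\<gamma> has_vector_derivative d\<gamma> t) (at t)"
    unfolding C2_fun_def d\<gamma>_def by (metis vector_derivative_at)
  show "d\<gamma> t \<noteq> 0" using boundary by (simp add: C2_boundary_param_def d\<gamma>_def)
qed

lemma \<gamma>_periodic: "\<gamma> (t + 1) = \<gamma> t"
  using boundary by (simp add: C2_boundary_param_def)

lemma \<gamma>_periodic_int: "\<gamma> (t + of_int j) = \<gamma> t"
proof -
  have *: "\<gamma> (s + real n) = \<gamma> s" for s n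
    by (induction n) (auto simp: \<gamma>_periodic[of "s + real _", symmetric] add.assoc add.commute[of 1])
  show ?thesis
  proof (cases "j \<ge> 0")
    case True then show ?thesis using *[of t "nat j"] by simp
  next
    case False then show ?thesis using *[of "t + of_int j" "nat (- j)"] by simp
  qed
qed

lemma \<gamma>_frontier: "\<gamma> t \<in> frontier K"
proof -
  have "\<gamma> t = \<gamma> (frac t)" using \<gamma>_periodic_int[of "frac t" "\<lfloor>t\<rfloor>"] by (simp add: frac_def)
  moreover have "frac t \<in> {0..1}" using frac_lt_1[of t] frac_ge_0[of t] by auto
  ultimately have "\<gamma> t \<in> path_image \<gamma>" by (auto simp: path_image_def)
  then show ?thesis using boundary by (simp add: C2_boundary_param_def)
qed

lemma frontier_\<gamma>: assumes "y \<in> frontier K" obtains t where "0 \<le> t" "t \<le> 1" "y = \<gamma> t"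
  proof -
  have "y \<in> \<gamma> ` {0..1}" using assms boundary by (simp add: C2_boundary_param_def path_image_def)
  then show ?thesis using that by auto
qed

lemma closed_K: "closed K" using compact_K compact_imp_closed by blast

lemma frontier_in_K: "y \<in> frontier K \<Longrightarrow> y \<in> K"
  using closed_K by (simp add: frontier_def)

lemma K_nonempty: "K \<noteq> {}" using \<gamma>_frontier frontier_in_K by blast

lemma inner_\<gamma>_deriv: "((\<lambda>t. \<gamma> t \<bullet> v) has_real_derivative d\<gamma> t \<bullet> v) (at t)"
  unfolding has_real_derivative_iff_has_vector_derivative
  by (rule bounded_linear.has_vector_derivative[OF bounded_linear_inner_left d\<gamma>])

text \<open>Otherwise \<open>K\<close> lies on a line, and a periodic curve on a line has a point of vanishing velocity by
  Rolle's theorem.\<close>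
lemma interior_nonempty: "interior K \<noteq> {}"
proof
  assume e: "interior K = {}"
  then obtain a b where ab: "a \<noteq> 0" "K \<subseteq> {x. a \<bullet> x = b}"
    using empty_interior_subset_hyperplane[OF convex_K] by blast
  define w :: "real^2" where "w = vector [- a$2, a$1]"
  have c: "\<gamma> t \<bullet> a = b" for t using ab(2) frontier_in_K[OF \<gamma>_frontier[of t]] by (auto simp: inner_commute)
  have 1: "d\<gamma> t \<bullet> a = 0" for t
    using inner_\<gamma>_deriv[of a t] unfolding c by (simp add: DERIV_unique)
  have "\<exists>z>0. z < 1 \<and> ((\<lambda>t. \<gamma> t \<bullet> w) has_real_derivative 0) (at z)"
    by (rule Rolle) (use \<gamma>_periodic[of 0] in \<open>auto intro!: continuous_at_imp_continuous_on DERIV_isCont inner_\<gamma>_deriv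
       simp: real_differentiable_def intro: inner_\<gamma>_deriv exI\<close>)
  then obtain z where "((\<lambda>t. \<gamma> t \<bullet> w) has_real_derivative 0) (at z)" by auto
  then have 2: "d\<gamma> z \<bullet> w = 0" using inner_\<gamma>_deriv DERIV_unique by blast
  have "x = 0" "y = 0" if "x * u + y * v = 0" "- (x * v) + y * u = 0" "u\<^sup>2 + v\<^sup>2 \<noteq> 0" for x y u v :: real
    using that by algebra+
  from this[of "d\<gamma> z $ 1" "a $ 1" "d\<gamma> z $ 2" "a $ 2"] 1[of z] 2 ab(1)
  have "d\<gamma> z = 0"
    by (auto simp: inner_vec2 w_def vec_eq_iff forall_2 sum_power2_eq_zero_iff)
  then show False using d\<gamma>_nz by blast
qed

lemma p_alt: "p a = (SUP P\<in>K. P \<bullet> nvec a)"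
  by (simp add: p_def support_fun_def inner_vec2)

lemma inner_bdd: "bdd_above ((\<lambda>P. P \<bullet> v) ` K)"
  by (intro bounded_imp_bdd_above compact_imp_bounded compact_continuous_image continuous_intros compact_K)

lemma support_ge: "y \<in> K \<Longrightarrow> y \<bullet> nvec a \<le> p a"
  unfolding p_alt by (rule cSUP_upper[OF _ inner_bdd])

text \<open>By differentiability of \<open>p\<close> this is the only point of \<open>K\<close> with outer normal angle \<open>a\<close>.\<close>
definition contact :: "real \<Rightarrow> real^2" where "contact a = p a *\<^sub>R nvec a + p1 a *\<^sub>R tvec a"

text \<open>For fixed \<open>y\<close> the function \<open>p b - y \<bullet> nvec b\<close> is nonnegative and vanishes at \<open>a\<close>, so its derivative
  vanishes there.\<close>
lemma contact_unique:
  assumes "y \<in> K" "y \<bullet> nvec a = p a"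
  shows "y = contact a"
proof -
  have "((\<lambda>b. p b - y \<bullet> nvec b) has_real_derivative p1 a - y \<bullet> tvec a) (at a)"
    by (intro derivative_intros p_deriv inner_nvec_deriv)
  then have "p1 a - y \<bullet> tvec a = 0"
    by (rule DERIV_local_min[of _ _ _ 1]) (use assms support_ge in auto)
  then show ?thesis using nvec_frame[of y a] assms(2) by (simp add: contact_def)
qed

lemma contact_inner: "contact a \<bullet> nvec a = p a" "contact a \<bullet> tvec a = p1 a"
proof -
  have "(p * c - q * s) * c + (p * s + q * c) * s = p" "- ((p * c - q * s) * s) + (p * s + q * c) * c = q"
    if "c\<^sup>2 + s\<^sup>2 = 1" for p q c s :: real
    using that by algebra+
  from this[of "cos a" "sin a" "p a" "p1 a"]
  show "contact a \<bullet> nvec a = p a" "contact a \<bullet> tvec a = p1 a"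
    by (auto simp: contact_def inner_vec2 algebra_simps)
qed

lemma contact_in_K: "contact a \<in> K"
proof -
  obtain y where y: "y \<in> K" "\<And>z. z \<in> K \<Longrightarrow> z \<bullet> nvec a \<le> y \<bullet> nvec a"
    using continuous_attains_sup[OF compact_K K_nonempty, of "\<lambda>P. P \<bullet> nvec a"]
      continuous_on_inner[OF continuous_on_id continuous_on_const] by blast
  then have "y \<bullet> nvec a = p a"
    unfolding p_alt by (intro cSup_eq_maximum[symmetric]) auto
  then show ?thesis using contact_unique y(1) by metis
qed

lemma interior_support_less:
  assumes "q \<in> interior K" shows "q \<bullet> nvec a < p a"
proof -
  obtain e where e: "e > 0" "cball q e \<subseteq> K" using assms mem_interior_cball by blast
  have "q + e *\<^sub>R nvec a \<in> cball q e" using e by (simp add: dist_norm)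
  then have "(q + e *\<^sub>R nvec a) \<bullet> nvec a \<le> p a" using e support_ge by blast
  moreover have "nvec a \<bullet> nvec a = 1" by (simp add: inner_vec2 power2_eq_square[symmetric])
  ultimately show ?thesis using e by (simp add: inner_add_left)
qed

lemma width_pos: "0 < p a + p (a + pi)"
proof -
  obtain q where "q \<in> interior K" using interior_nonempty by blast
  from interior_support_less[OF this, of a] interior_support_less[OF this, of "a + pi"]
  show ?thesis by simp
qed

lemma p_periodic: "p (a + 2 * pi) = p a"
  unfolding p_alt by simp

sublocale corr: periodic_C2 p p1 p2
  by unfold_locales (fact p_deriv p1_deriv p2_cont p_periodic)+

lemma contact_frontier: "contact a \<in> frontier K"
  using contact_in_K closed_K interior_support_less[of "contact a" a] contact_inner(1)
  by (fastforce simp: frontier_def)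

lemma normal_perp_tangent:
  assumes "\<gamma> t = contact a" shows "d\<gamma> t \<bullet> nvec a = 0"
  by (rule DERIV_local_max[OF inner_\<gamma>_deriv, of 1])
     (use assms contact_inner \<gamma>_frontier frontier_in_K support_ge in auto)

text \<open>The boundary has no corners: both normals are orthogonal to the nonzero velocity of \<open>\<gamma>\<close>, and they
  cannot be opposite since \<open>K\<close> has positive width.\<close>
lemma normal_unique:
  assumes "contact a = contact b" shows "nvec a = nvec b"
proof -
  obtain t where t: "\<gamma> t = contact a" using contact_frontier frontier_\<gamma> by metis
  have perp: "d\<gamma> t \<bullet> nvec a = 0" "d\<gamma> t \<bullet> nvec b = 0" using normal_perp_tangent t assms by auto
  have "sin (b - a) = 0"
  proof -
    have "(sb * ca - cb * sa) * x = 0" "(sb * ca - cb * sa) * y = 0" if "x * ca + y * sa = 0" "x * cb + y * sb = 0"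
      for x y sa sb ca cb :: real using that by algebra+
    from this[of "d\<gamma> t $ 1" "cos a" "d\<gamma> t $ 2" "sin a" "cos b" "sin b"] perp d\<gamma>_nz[of t]
    show ?thesis by (auto simp: inner_vec2 sin_diff vec_eq_iff forall_2)
  qed
  then obtain i::int where i: "b - a = i * pi" by (auto simp: sin_zero_iff_int2)
  show ?thesis
  proof (cases "even i")
    case True
    then obtain j where "i = 2 * j" by blast
    then have "b = a + 2 * pi * j" using i by (simp add: algebra_simps)
    then show ?thesis by (metis nvec_eq_iff)
  next
    case False
    then obtain j where "i = 2 * j + 1" using oddE by blast
    then have "b = (a + pi) + 2 * pi * j" using i by (simp add: algebra_simps)
    then have b: "nvec b = - nvec a" by (metis nvec_eq_iff nvec_pi)
    have "p b = - p a" using assms contact_inner(1)[of a] contact_inner(1)[of b] b by simp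
    moreover have "p b = p (a + pi)" unfolding p_alt b by simp
    ultimately show ?thesis using width_pos[of a] by simp
  qed
qed

lemma frontier_contact:
  assumes "y \<in> frontier K"
  obtains a where "0 \<le> a" "a < 2 * pi" "y = contact a"
proof -
  have "y \<in> K" "y \<notin> interior K" using assms frontier_in_K by (auto simp: frontier_def)
  moreover have "rel_interior K = interior K"
    using interior_nonempty by (simp add: rel_interior_nonempty_interior)
  ultimately obtain v where v: "v \<noteq> 0" "\<And>z. z \<in> K \<Longrightarrow> v \<bullet> y \<le> v \<bullet> z"
    using supporting_hyperplane_rel_boundary[OF convex_K, of y] by metis
  have "norm (- (v /\<^sub>R norm v)) = 1" using v by simp
  then obtain a where a: "0 \<le> a" "a < 2 * pi" "- (v /\<^sub>R norm v) = nvec a" by (metis nvec_cases)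
  have "z \<bullet> nvec a \<le> y \<bullet> nvec a" if "z \<in> K" for z
    using v(1) v(2)[OF that] unfolding a(3)[symmetric] by (simp add: inner_commute[of _ v] divide_simps)
  then have "y \<bullet> nvec a = p a"
    unfolding p_alt using \<open>y \<in> K\<close> by (intro cSup_eq_maximum[symmetric]) auto
  then show ?thesis using that a contact_unique \<open>y \<in> K\<close> by blast
qed

lemma outside_separated:
  assumes "P \<notin> K" obtains a where "p a < P \<bullet> nvec a"
proof -
  obtain v b where v: "v \<bullet> P < b" "\<And>x. x \<in> K \<Longrightarrow> b < v \<bullet> x"
    using separating_hyperplane_closed_point[OF convex_K closed_K assms] by blast
  have vnz: "v \<noteq> 0" using v K_nonempty by force
  then have "norm (- (v /\<^sub>R norm v)) = 1" by simp
  then obtain a where a: "- (v /\<^sub>R norm v) = nvec a" by (metis nvec_cases)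
  have "contact a \<bullet> nvec a < P \<bullet> nvec a"
    using v(1) v(2)[OF contact_in_K, of a] vnz unfolding a[symmetric] by (simp add: inner_commute divide_simps)
  then show ?thesis using contact_inner(1) that by simp
qed

end

section \<open>The two tangent lines from an exterior point\<close>

context smooth_oval begin

text \<open>The function \<open>h\<^sub>P\<close> of the introduction. Its zeros are the normal angles of the supporting lines
  through \<open>P\<close>.\<close>
definition gap :: "real^2 \<Rightarrow> real \<Rightarrow> real" where "gap P a = p a - P \<bullet> nvec a"

lemma gap_cong: "nvec a = nvec b \<Longrightarrow> gap P a = gap P b"
  by (simp add: gap_def p_alt)

lemma gap_2pi [simp]: "gap P (a + 2 * pi) = gap P a"
  by (rule gap_cong) simp

lemma gap_deriv: "(gap P has_real_derivative p1 a - P \<bullet> tvec a) (at a)"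
  unfolding gap_def[abs_def] by (intro derivative_intros p_deriv inner_nvec_deriv)

lemma gap_width: "0 < gap P a + gap P (a + pi)"
  using width_pos[of a] by (simp add: gap_def)

lemma gap_neg_outside: "gap P a < 0 \<Longrightarrow> P \<notin> K"
  using support_ge[of P a] by (auto simp: gap_def)

text \<open>Strict sublinearity. It is strict because the contact point of the middle direction cannot have the
  outer direction \<open>a\<close> as a second normal.\<close>
lemma gap_between:
  assumes "a < b" "b < c" "c - a < pi"
  shows "gap P b * sin (c - a) < gap P a * sin (c - b) + gap P c * sin (b - a)"
proof -
  let ?y = "contact b"
  have s: "sin (c - b) > 0" "sin (b - a) > 0" using assms by (auto intro!: sin_gt_zero)
  have "?y \<noteq> contact a" using normal_unique[of b a] nvec_inj[of b a] assms by auto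
  then have "?y \<bullet> nvec a < p a" using contact_unique[of ?y a] support_ge[OF contact_in_K[of b], of a] contact_in_K[of b]
    by fastforce
  moreover have "?y \<bullet> nvec c \<le> p c" by (rule support_ge[OF contact_in_K])
  ultimately have "sin (c - b) * (?y \<bullet> nvec a) + sin (b - a) * (?y \<bullet> nvec c) < sin (c - b) * p a + sin (b - a) * p c"
    using s by (intro add_less_le_mono mult_strict_left_mono mult_left_mono) auto
  moreover have inn: "sin (c - a) * (v \<bullet> nvec b) = sin (c - b) * (v \<bullet> nvec a) + sin (b - a) * (v \<bullet> nvec c)" for v
    using arg_cong[OF nvec_between[of c a b], of "\<lambda>w. v \<bullet> w"] by (simp add: inner_add_right)
  ultimately have "sin (c - a) * p b < sin (c - b) * p a + sin (b - a) * p c"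
    using contact_inner(1)[of b] by metis
  then show ?thesis using inn[of P] unfolding gap_def by (simp add: algebra_simps)
qed

lemma contact_cong: "nvec x = nvec y \<Longrightarrow> contact x = contact y"
  using contact_unique[OF contact_in_K[of x], of y] contact_inner(1)[of x] by (simp add: p_alt)

text \<open>The intersection of the supporting lines with normal angles \<open>a\<close> and \<open>a + d\<close>.\<close>
definition meet :: "real \<Rightarrow> real \<Rightarrow> real^2" where
  "meet a d = vector [(p a * sin (a + d) - p (a + d) * sin a) / sin d, (p (a + d) * cos a - p a * cos (a + d)) / sin d]"

lemma meet_inner:
  assumes "sin d \<noteq> 0"
  shows "meet a d \<bullet> nvec a = p a" "meet a d \<bullet> nvec (a + d) = p (a + d)"
proof -
  have *: "(x * (s * c' + c * s') - y * s) / s' * c + (y * c - x * (c * c' - s * s')) / s' * s = x"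
       "(x * (s * c' + c * s') - y * s) / s' * (c * c' - s * s') + (y * c - x * (c * c' - s * s')) / s' * (s * c' + c * s') = y"
    if "s\<^sup>2 + c\<^sup>2 = 1" "s'\<^sup>2 + c'\<^sup>2 = 1" "s' \<noteq> 0" for s c s' c' x y :: real
    using that by (auto simp: divide_simps) algebra+
  show "meet a d \<bullet> nvec a = p a" "meet a d \<bullet> nvec (a + d) = p (a + d)"
    using *[OF sin_cos_squared_add sin_cos_squared_add assms]
    by (simp_all add: meet_def inner_vec2 sin_add cos_add)
qed

lemma meet_unique:
  assumes "sin d \<noteq> 0" "gap P a = 0" "gap P (a + d) = 0"
  shows "P = meet a d"
proof -
  have "x = (pa * (s * c' + c * s') - pb * s) / s'" "y = (pb * c - pa * (c * c' - s * s')) / s'"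
    if "s\<^sup>2 + c\<^sup>2 = 1" "s' \<noteq> 0" "pa = x * c + y * s" "pb = x * (c * c' - s * s') + y * (s * c' + c * s')"
    for s c s' c' pa pb x y :: real
    using that by (auto simp: divide_simps) algebra+
  from this[OF sin_cos_squared_add assms(1)] assms(2,3) show ?thesis
    by (intro vec2_eqI) (auto simp: meet_def gap_def inner_vec2 sin_add cos_add)
qed

context
  fixes a d :: real and P :: "real^2"
  assumes d: "0 < d" "d < pi" and P: "P = meet a d"
begin

lemma meet_gap_zero: "gap P a = 0" "gap P (a + d) = 0"
  using meet_inner sin_gt_zero[OF d] by (auto simp: P gap_def)

lemma meet_gap_neg:
  assumes "a < x" "x < a + d" shows "gap P x < 0"
proof -
  have "gap P x * sin d < 0"
    using gap_between[of a x "a + d" P] assms d meet_gap_zero by simp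
  then show ?thesis using sin_gt_zero[OF d] by (simp add: mult_less_0_iff)
qed

text \<open>On the part of the circle within \<open>\<pi>\<close> of one of the zeros this is strict sublinearity with the two
  known zeros; on the antipodal arc it follows from positive width.\<close>
lemma meet_gap_pos:
  assumes "a + d < x" "x < a + 2 * pi" shows "0 < gap P x"
proof -
  consider "x < a + pi" | "a + d + pi < x" | "a + pi \<le> x" "x \<le> a + d + pi" by linarith
  then show ?thesis
  proof cases
    case 1
    then have "0 < gap P x * sin d"
      using gap_between[of a "a + d" x P] assms d meet_gap_zero by simp
    then show ?thesis using sin_gt_zero[OF d] by (simp add: zero_less_mult_iff)
  next
    case 2
    have "0 < gap P (x - 2 * pi) * sin d"
      using gap_between[of "x - 2 * pi" a "a + d" P] 2 assms d meet_gap_zero by simp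
    then have "0 < gap P (x - 2 * pi)" using sin_gt_zero[OF d] by (simp add: zero_less_mult_iff)
    then show ?thesis using gap_2pi[of P "x - 2 * pi"] by simp
  next
    case 3
    have "x - pi = a \<or> x - pi = a + d \<or> (a < x - pi \<and> x - pi < a + d)" using 3 by linarith
    then have "gap P (x - pi) \<le> 0" using meet_gap_zero meet_gap_neg by (metis less_eq_real_def)
    then show ?thesis using gap_width[of P "x - pi"] by simp
  qed
qed

lemma meet_outside: "P \<notin> K"
  using gap_neg_outside meet_gap_neg[of "a + d / 2"] d by simp

lemma meet_zeros: "gap P x = 0 \<longleftrightarrow> nvec x = nvec a \<or> nvec x = nvec (a + d)"
proof
  assume g: "gap P x = 0"
  obtain b where b: "a \<le> b" "b < a + 2 * pi" "nvec b = nvec x" using nvec_reduce .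
  have "gap P b = 0" using g b gap_cong by metis
  then have "b = a \<or> b = a + d"
    using meet_gap_neg[of b] meet_gap_pos[of b] b by force
  then show "nvec x = nvec a \<or> nvec x = nvec (a + d)" using b(3) by metis
qed (metis meet_gap_zero gap_cong)

lemma meet_gap_neg_iff:
  assumes "a \<le> x" "x < a + 2 * pi"
  shows "gap P x < 0 \<longleftrightarrow> a < x \<and> x < a + d"
proof -
  consider "x = a" | "a < x" "x < a + d" | "x = a + d" | "a + d < x" using assms by linarith
  then show ?thesis
    using assms d meet_gap_neg[of x] meet_gap_pos[of x] meet_gap_zero by cases auto
qed

lemma contact_diff:
  assumes "gap P x = 0" shows "contact x - P = (p1 x - P \<bullet> tvec x) *\<^sub>R tvec x"
  using nvec_frame[of "contact x - P" x] assms by (simp add: inner_diff_left contact_inner gap_def)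

lemma gap_deriv_nz:
  assumes "gap P x = 0" shows "p1 x - P \<bullet> tvec x \<noteq> 0"
proof
  assume "p1 x - P \<bullet> tvec x = 0"
  then have "contact x - P = 0" using contact_diff[OF assms] by simp
  then show False using meet_outside contact_in_K[of x] by simp
qed

lemma tangent_length1_pos: "p1 a - P \<bullet> tvec a < 0"
proof (rule ccontr)
  assume "\<not> p1 a - P \<bullet> tvec a < 0"
  then have "p1 a - P \<bullet> tvec a > 0" using gap_deriv_nz[OF meet_gap_zero(1)] by linarith
  then obtain e where e: "e > 0" "\<And>h. 0 < h \<Longrightarrow> h < e \<Longrightarrow> gap P a < gap P (a + h)"
    using DERIV_pos_inc_right[OF gap_deriv] by blast
  define h where "h = min d e / 2"
  have "0 < h" "h < e" "h < d" using e(1) d by (auto simp: h_def)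
  then show False using e(2)[of h] meet_gap_neg[of "a + h"] meet_gap_zero by simp
qed

lemma tangent_length2_pos: "0 < p1 (a + d) - P \<bullet> tvec (a + d)"
proof (rule ccontr)
  assume "\<not> 0 < p1 (a + d) - P \<bullet> tvec (a + d)"
  then have "p1 (a + d) - P \<bullet> tvec (a + d) < 0" using gap_deriv_nz[OF meet_gap_zero(2)] by linarith
  then obtain e where e: "e > 0" "\<And>h. 0 < h \<Longrightarrow> h < e \<Longrightarrow> gap P (a + d) < gap P (a + d - h)"
    using DERIV_neg_dec_left[OF gap_deriv] by blast
  define h where "h = min d e / 2"
  have "0 < h" "h < e" "h < d" using e(1) d by (auto simp: h_def)
  then show False using e(2)[of h] meet_gap_neg[of "a + d - h"] meet_gap_zero by simp
qed

text \<open>The tangent of \<open>\<gamma>\<close> at a contact point is orthogonal to the normal, so it passes through \<open>P\<close> exactly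
  when the supporting line does.\<close>
lemma tangent_dirs_eq_sgn: "tangent_dirs \<gamma> P = {sgn (contact x - P) |x. gap P x = 0}"
proof (intro set_eqI iffI)
  fix u assume "u \<in> tangent_dirs \<gamma> P"
  then obtain t s c where u: "norm u = 1" "0 < s" "\<gamma> t = P + s *\<^sub>R u" "d\<gamma> t = c *\<^sub>R u"
    by (auto simp: tangent_dirs_def d\<gamma>_def)
  obtain x where x: "\<gamma> t = contact x" using frontier_contact[OF \<gamma>_frontier[of t]] by metis
  have "c \<noteq> 0" using u d\<gamma>_nz[of t] by auto
  then have "u \<bullet> nvec x = 0" using normal_perp_tangent[OF x] u by simp
  then have "gap P x = 0" using contact_inner(1)[of x] unfolding x[symmetric] u by (simp add: gap_def inner_add_left)
  moreover have "contact x - P = s *\<^sub>R u" using x u by (simp add: algebra_simps)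
  then have "u = sgn (contact x - P)" using u by (simp add: sgn_div_norm)
  ultimately show "u \<in> {sgn (contact x - P) |x. gap P x = 0}" by auto
next
  fix u assume "u \<in> {sgn (contact x - P) |x. gap P x = 0}"
  then obtain x where x: "gap P x = 0" "u = sgn (contact x - P)" by auto
  obtain t where t: "\<gamma> t = contact x" using contact_frontier frontier_\<gamma> by metis
  define r where "r = p1 x - P \<bullet> tvec x"
  have r: "contact x - P = r *\<^sub>R tvec x" "r \<noteq> 0" using contact_diff gap_deriv_nz x(1) by (auto simp: r_def)
  have u: "u = sgn r *\<^sub>R tvec x" using x(2) unfolding r by (simp add: sgn_scaleR) (simp add: sgn_div_norm)
  have "d\<gamma> t = (d\<gamma> t \<bullet> tvec x) *\<^sub>R tvec x" using nvec_frame[of "d\<gamma> t" x] normal_perp_tangent[OF t] by simp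
  also have "\<dots> = ((d\<gamma> t \<bullet> tvec x) * sgn r) *\<^sub>R u" using r(2) by (simp add: u sgn_mult_self_eq)
  finally have "d\<gamma> t = ((d\<gamma> t \<bullet> tvec x) * sgn r) *\<^sub>R u" .
  moreover have "\<gamma> t = P + \<bar>r\<bar> *\<^sub>R u" using r(1) unfolding t u by (simp add: algebra_simps abs_mult_sgn)
  moreover have "norm u = 1" using r(2) by (simp add: u abs_sgn_eq)
  moreover have "0 < \<bar>r\<bar>" using r(2) by simp
  ultimately show "u \<in> tangent_dirs \<gamma> P" unfolding tangent_dirs_def d\<gamma>_def[symmetric] by blast
qed

lemma tangent_dirs_eq: "tangent_dirs \<gamma> P = {- tvec a, tvec (a + d)}"
proof -
  have 1: "sgn (contact a - P) = - tvec a"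
    unfolding contact_diff[OF meet_gap_zero(1)] using tangent_length1_pos
    by (simp add: sgn_scaleR) (simp add: sgn_div_norm)
  have 2: "sgn (contact (a + d) - P) = tvec (a + d)"
    unfolding contact_diff[OF meet_gap_zero(2)] using tangent_length2_pos
    by (simp add: sgn_scaleR) (simp add: sgn_div_norm)
  show ?thesis
    unfolding tangent_dirs_eq_sgn meet_zeros 1[symmetric] 2[symmetric]
    by (intro set_eqI iffI; clarsimp; metis contact_cong)
qed

text \<open>The rays point along \<open>- tvec a\<close> and \<open>tvec (a + d)\<close>, whose inner product is \<open>- cos d\<close>.\<close>
lemma visual_angle_meet: "visual_angle \<gamma> P = pi - d"
proof -
  have ip: "- tvec a \<bullet> tvec (a + d) = cos (pi - d)"
    using cos_diff[of a "a + d"] by (simp add: inner_vec2 cos_diff[of pi])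
  have arc: "arccos (- tvec a \<bullet> tvec (a + d)) = pi - d"
    unfolding ip using d by (intro arccos_cos) auto
  have ne: "- tvec a \<noteq> tvec (a + d)"
  proof
    assume "- tvec a = tvec (a + d)"
    then have "- tvec a \<bullet> tvec (a + d) = tvec (a + d) \<bullet> tvec (a + d)" by metis
    then have "- tvec a \<bullet> tvec (a + d) = 1" by (simp add: inner_vec2 power2_eq_square[symmetric])
    then show False using arc d by simp
  qed
  show ?thesis unfolding visual_angle_def tangent_dirs_eq
  proof (rule the_equality)
    show "\<exists>u v. u \<noteq> v \<and> {- tvec a, tvec (a + d)} = {u, v} \<and> pi - d = arccos (u \<bullet> v)"
      using ne arc by metis
    fix w assume "\<exists>u v. u \<noteq> v \<and> {- tvec a, tvec (a + d)} = {u, v} \<and> w = arccos (u \<bullet> v)"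
    then show "w = pi - d" using arc by (auto simp: doubleton_eq_iff inner_commute)
  qed
qed

end

text \<open>A negative value of the gap at \<open>x\<close> and positive width give a zero on either side of \<open>x\<close>. They are
  not exactly \<open>\<pi>\<close> apart by positive width. If they were farther apart, the complementary arc would be
  the one on which the gap is negative, and the gap at \<open>x\<close> would be positive.\<close>
lemma meet_surj:
  assumes "P \<notin> K"
  obtains a d where "0 \<le> a" "a < 2 * pi" "0 < d" "d < pi" "P = meet a d"
proof -
  obtain x where x: "gap P x < 0" using outside_separated[OF assms] by (auto simp: gap_def)
  have xp: "0 < gap P (x + pi)" using gap_width[of P x] x by linarith
  have xm: "0 < gap P (x - pi)" using gap_2pi[of P "x - pi"] xp by (simp add: algebra_simps)
  have cont: "isCont (gap P) y" for y by (rule DERIV_isCont[OF gap_deriv])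
  obtain b where b: "x \<le> b" "b \<le> x + pi" "gap P b = 0"
    using IVT[of "gap P" x 0 "x + pi"] x xp cont by auto
  obtain a where a: "x - pi \<le> a" "a \<le> x" "gap P a = 0"
    using IVT2[of "gap P" x 0 "x - pi"] x xm cont by auto
  have bs: "x < b" "b < x + pi" "x - pi < a" "a < x" using a b x xm xp by (auto simp: less_le)
  have "\<exists>a d. 0 < d \<and> d < pi \<and> P = meet a d"
  proof (cases "b - a < pi")
    case True
    have "sin (b - a) > 0" using bs True by (intro sin_gt_zero) auto
    then have "P = meet a (b - a)" using a b by (intro meet_unique) auto
    then show ?thesis using bs True by (intro exI[of _ a] exI[of _ "b - a"]) auto
  next
    case False
    have "b - a \<noteq> pi" using gap_width[of P a] a b by (auto simp: algebra_simps)
    then have d: "0 < a - (b - 2 * pi)" "a - (b - 2 * pi) < pi" using False bs by auto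
    have "gap P (b - 2 * pi) = 0" using gap_2pi[of P "b - 2 * pi"] b by simp
    then have "P = meet (b - 2 * pi) (a - (b - 2 * pi))"
      using a sin_gt_zero[OF d] by (intro meet_unique) auto
    from meet_gap_pos[OF d this, of x] show ?thesis using bs x by auto
  qed
  then obtain a d where ad: "0 < d" "d < pi" "P = meet a d" by blast
  obtain a' where a': "0 \<le> a'" "a' < 0 + 2 * pi" "nvec a' = nvec a" using nvec_reduce .
  have "gap P a' = 0" "gap P (a' + d) = 0"
    using meet_gap_zero[OF ad] gap_cong[OF a'(3)] gap_cong[OF nvec_shift[OF a'(3)]] by metis+
  then have "P = meet a' d" using sin_gt_zero[OF ad(1,2)] by (intro meet_unique) auto
  then show ?thesis using that a' ad by simp
qed

text \<open>The zeros determine the pair of angles up to order, and the order is fixed by the sign of the gap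
  immediately after the first one.\<close>
lemma meet_inj:
  assumes a: "0 \<le> a" "a < 2 * pi" "0 \<le> a'" "a' < 2 * pi" and d: "0 < d" "d < pi" "0 < d'" "d' < pi"
    and eq: "meet a d = meet a' d'"
  shows "a = a' \<and> d = d'"
proof -
  note Z = meet_zeros[OF d(1,2) refl, of a] and Z' = meet_gap_zero[OF d(3,4) refl, of a']
  have "nvec a' = nvec a \<or> nvec a' = nvec (a + d)" using Z[of a'] Z'(1) eq by simp
  moreover have "nvec a' \<noteq> nvec (a + d)"
  proof
    assume n: "nvec a' = nvec (a + d)"
    \<comment> \<open>An angle small enough to stay in the negative arc of one tangent pair and in the positive arc of
  the other.\<close>
    define e where "e = min d' (2 * pi - d) / 2"
    have e: "0 < e" "e < d'" "e < 2 * pi - d" using d by (auto simp: e_def min_def)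
    have "gap (meet a d) (a + d + e) > 0" using meet_gap_pos[OF d(1,2) refl] e by simp
    moreover have "gap (meet a d) (a' + e) < 0" unfolding eq using meet_gap_neg[OF d(3,4) refl] e by simp
    ultimately show False using gap_cong[OF nvec_shift[OF n, of e]] by simp
  qed
  ultimately have aa: "a' = a" using nvec_inj[of a' a] a by auto
  have "gap (meet a d) (a + d') = 0" using Z'(2) eq aa by simp
  moreover have "gap (meet a d) (a + d) = 0" using meet_gap_zero[OF d(1,2) refl] by simp
  ultimately have "\<not> d < d'" "\<not> d' < d"
    using meet_gap_neg[OF d(1,2) refl, of a "a + d'"] meet_gap_neg[OF d(3,4) refl, of a' "a' + d"] d aa eq by auto
  then show ?thesis using aa by auto
qed

lemma visual_angle_bounds:
  assumes "P \<notin> K" shows "0 < visual_angle \<gamma> P" "visual_angle \<gamma> P < pi"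
  using meet_surj[OF assms] visual_angle_meet by (metis diff_gt_0_iff_gt, metis diff_less_eq less_add_same_cancel1)

text \<open>The right-hand side is an open condition on \<open>P\<close>, which yields Borel measurability.\<close>
lemma visual_angle_less_iff:
  assumes "P \<notin> K" "0 < w" "w < pi"
  shows "visual_angle \<gamma> P < w \<longleftrightarrow> (\<exists>x. gap P x < 0 \<and> gap P (x + (pi - w)) < 0)"
proof -
  obtain a d where ad: "0 < d" "d < pi" "P = meet a d" using meet_surj[OF assms(1)] by metis
  have v: "visual_angle \<gamma> P = pi - d" by (rule visual_angle_meet[OF ad])
  define s where "s = pi - w"
  have s: "0 < s" "s < pi" using assms by (auto simp: s_def)
  have "s < d \<longleftrightarrow> (\<exists>x. gap P x < 0 \<and> gap P (x + s) < 0)"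
  proof
    assume "s < d"
    then have "gap P (a + (d - s) / 2) < 0 \<and> gap P (a + (d - s) / 2 + s) < 0"
      using s meet_gap_neg[OF ad] by (auto simp: field_simps)
    then show "\<exists>x. gap P x < 0 \<and> gap P (x + s) < 0" by blast
  next
    assume "\<exists>x. gap P x < 0 \<and> gap P (x + s) < 0"
    then obtain x where x: "gap P x < 0" "gap P (x + s) < 0" by blast
    obtain b where b: "a \<le> b" "b < a + 2 * pi" "nvec b = nvec x" using nvec_reduce .
    have "gap P b < 0" "gap P (b + s) < 0" using x gap_cong[OF b(3)] gap_cong[OF nvec_shift[OF b(3)]] by auto
    then have "a < b" "b < a + d" "b + s < a + d"
      using meet_gap_neg_iff[OF ad] b s ad by auto
    then show "s < d" by simp
  qed
  then show ?thesis by (auto simp: v s_def)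
qed

text \<open>The default value \<open>\<pi>\<close> on \<open>K\<close> keeps the sublevel sets up to \<open>\<pi>\<close> inside the exterior, where they are
  open.\<close>
lemma visual_angle_measurable:
  "(\<lambda>P. if P \<in> K then pi else visual_angle \<gamma> P) \<in> borel_measurable borel"
proof -
  have "{P. (if P \<in> K then pi else visual_angle \<gamma> P) < w} \<in> sets borel" for w
  proof -
    consider "w \<le> 0" | "0 < w" "w < pi" | "w = pi" | "pi < w" by linarith
    then have "open {P. (if P \<in> K then pi else visual_angle \<gamma> P) < w}"
    proof cases
      case 1
      have "\<not> (if P \<in> K then pi else visual_angle \<gamma> P) < w" for P
        using 1 visual_angle_bounds(1)[of P] order_less_trans[OF pi_gt_zero, of w] by (cases "P \<in> K") auto
      then have "{P. (if P \<in> K then pi else visual_angle \<gamma> P) < w} = {}" by blast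
      then show ?thesis by simp
    next
      case 2
      then have "{P. (if P \<in> K then pi else visual_angle \<gamma> P) < w} = (\<Union>x. {P. gap P x < 0} \<inter> {P. gap P (x + (pi - w)) < 0})"
        using visual_angle_less_iff gap_neg_outside by auto
      moreover have "open {P. gap P x < 0}" for x
        unfolding gap_def by (intro open_Collect_less continuous_intros)
      ultimately show ?thesis by (simp only:) (intro open_UN ballI open_Int)
    next
      case 3
      then have "{P. (if P \<in> K then pi else visual_angle \<gamma> P) < w} = - K"
        using visual_angle_bounds(2) by auto
      then show ?thesis using closed_K by (simp add: open_Compl)
    next
      case 4
      then have "{P. (if P \<in> K then pi else visual_angle \<gamma> P) < w} = UNIV"
        using visual_angle_bounds(2) by fastforce
      then show ?thesis by simp
    qed
    then show ?thesis by simp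
  qed
  then show ?thesis by (simp add: borel_measurable_iff_less)
qed

end

section \<open>Jacobians of the two parametrisations\<close>

context smooth_oval begin

text \<open>\<open>sin d\<close> times the lengths of the segments from \<open>meet a d\<close> to the two contact points.\<close>
definition tl1 :: "real \<Rightarrow> real \<Rightarrow> real" where "tl1 a d = p (a + d) - p a * cos d - p1 a * sin d"
definition tl2 :: "real \<Rightarrow> real \<Rightarrow> real" where "tl2 a d = p a - p (a + d) * cos d + p1 (a + d) * sin d"
definition radius :: "real \<Rightarrow> real" where "radius a = p a + p2 a"

lemma tangent_lengths_pos:
  assumes d: "0 < d" "d < pi" shows "0 < tl1 a d" "0 < tl2 a d"
proof -
  have s: "sin d > 0" using d by (rule sin_gt_zero)
  define P where "P = meet a d"
  have 1: "P \<bullet> nvec (a + d) = cos d * (P \<bullet> nvec a) + sin d * (P \<bullet> tvec a)"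
    by (simp add: inner_vec2 sin_add cos_add algebra_simps)
  have "nvec a = cos d *\<^sub>R nvec (a + d) - sin d *\<^sub>R tvec (a + d)"
  proof -
    have "c = c' * (c * c' - s * s') + s' * (s * c' + c * s')" "s = c' * (s * c' + c * s') - s' * (c * c' - s * s')"
      if "s'\<^sup>2 + c'\<^sup>2 = 1" for s c s' c' :: real
      using that by algebra+
    from this[OF sin_cos_squared_add, of "cos a" d "sin a"] this[OF sin_cos_squared_add, of "sin a" d "cos a"]
    show ?thesis by (intro vec2_eqI) (simp_all add: sin_add cos_add algebra_simps)
  qed
  then have 2: "P \<bullet> nvec a = cos d * (P \<bullet> nvec (a + d)) - sin d * (P \<bullet> tvec (a + d))"
    by (metis inner_diff_right inner_scaleR_right)
  have "tl1 a d = - sin d * (p1 a - P \<bullet> tvec a)"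
    using meet_inner[of d a] s 1 by (simp add: tl1_def P_def algebra_simps)
  then show "0 < tl1 a d" using s tangent_length1_pos[OF d P_def] by (simp add: mult_pos_neg)
  have "tl2 a d = sin d * (p1 (a + d) - P \<bullet> tvec (a + d))"
    using meet_inner[of d a] s 2 by (simp add: tl2_def P_def algebra_simps)
  then show "0 < tl2 a d" using s tangent_length2_pos[OF d P_def] by simp
qed

definition meet' :: "real^2 \<Rightarrow> real^2 \<Rightarrow> real^2" where
  "meet' v w = (let a = v $ 1; d = v $ 2; b = a + d in vector
    [w $ 1 * ((p1 a * sin b + p a * cos b - p1 b * sin a - p b * cos a) / sin d)
       + w $ 2 * ((p a * cos b - p1 b * sin a) / sin d - (p a * sin b - p b * sin a) * cos d / (sin d)\<^sup>2),
     w $ 1 * ((p1 b * cos a - p b * sin a - p1 a * cos b + p a * sin b) / sin d)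
       + w $ 2 * ((p1 b * cos a + p a * sin b) / sin d - (p b * cos a - p a * cos b) * cos d / (sin d)\<^sup>2)])"

lemma meet_has_derivative:
  assumes s: "sin (v $ 2) \<noteq> 0"
  shows "((\<lambda>v. meet (v $ 1) (v $ 2)) has_derivative meet' v) (at v)"
proof -
  note [derivative_intros] = has_derivative_nth DERIV_compose_FDERIV[OF p_deriv]
  have quot: "((\<lambda>v::real^2. N v / sin (v $ 2)) has_derivative (\<lambda>w. w $ 1 * (A / sin (v $ 2)) + w $ 2 * (B / sin (v $ 2) - N v * cos (v $ 2) / (sin (v $ 2))\<^sup>2))) (at v)"
    if N: "(N has_derivative (\<lambda>w. w $ 1 * A + w $ 2 * B)) (at v)" for N A B
  proof -
    have alg: "((x * A + y * B) * S - n * (y * C)) / (S * S) = x * (A / S) + y * (B / S - n * C / S\<^sup>2)"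
      if "S \<noteq> 0" for x y n S C :: real
      using that by (simp add: divide_simps power2_eq_square) (simp add: algebra_simps)
    have "((\<lambda>v::real^2. sin (v $ 2)) has_derivative (\<lambda>w. w $ 2 * cos (v $ 2))) (at v)"
      by (rule DERIV_compose_FDERIV[OF DERIV_sin has_derivative_nth])
    from has_derivative_divide'[OF N this s] show ?thesis
      unfolding alg[OF s] .
  qed
  have *: "((\<lambda>v::real^2. (p (v $ 1) * sin (v $ 1 + v $ 2) - p (v $ 1 + v $ 2) * sin (v $ 1)) / sin (v $ 2)) has_derivative
    (\<lambda>w. meet' v w $ 1)) (at v)"
    unfolding meet'_def Let_def vector_2
    by (rule quot, auto intro!: derivative_eq_intros simp: algebra_simps)
  have **: "((\<lambda>v::real^2. (p (v $ 1 + v $ 2) * cos (v $ 1) - p (v $ 1) * cos (v $ 1 + v $ 2)) / sin (v $ 2)) has_derivative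
    (\<lambda>w. meet' v w $ 2)) (at v)"
    unfolding meet'_def Let_def vector_2
    by (rule quot, auto intro!: derivative_eq_intros simp: algebra_simps)
  show ?thesis
    unfolding meet_def vector2_eq_axis
    by (rule has_derivative_eq_rhs[OF has_derivative_add[OF has_derivative_scaleR_left[OF *] has_derivative_scaleR_left[OF **]]])
       (intro ext vec2_eqI, simp_all add: axis_def)
qed

text \<open>The differential of \<open>P\<close> satisfies \<open>dP \<bullet> n(\<phi>\<^sub>i) = h\<^sub>P'(\<phi>\<^sub>i) d\<phi>\<^sub>i\<close> for both tangent lines, and \<open>|h\<^sub>P'|\<close> is a
  tangent length at a zero. The computation below is this fact in Cartesian coordinates.\<close>
lemma det_meet':
  assumes v: "0 < v $ 2" "v $ 2 < pi"
  shows "\<bar>det (matrix (meet' v))\<bar> = tl1 (v $ 1) (v $ 2) * tl2 (v $ 1) (v $ 2) / sin (v $ 2) ^ 3"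
proof -
  have s: "sin (v $ 2) > 0" using v by (rule sin_gt_zero)
  have quot: "(x1 / S) * (x2 / S - x3 * C / S\<^sup>2) - (x4 / S - x5 * C / S\<^sup>2) * (x6 / S)
      = (x1 * (x2 * S - x3 * C) - (x4 * S - x5 * C) * x6) / S ^ 3"
    if "S \<noteq> 0" for S x1 x2 x3 x4 x5 x6 C :: real
    using that by (simp add: divide_simps power2_eq_square power3_eq_cube)
  have elim: "u * X - Y * w = - (t * t')"
    if "X = c * t'" "Y = - s * t'" "u * c + s * w = - t" for u w X Y t t' c s :: real
  proof -
    have "u * X - Y * w = (u * c + s * w) * t'" unfolding that(1,2) by (simp add: algebra_simps)
    then show ?thesis unfolding that(3) by simp
  qed
  have id: "((x' * sb + x * cb - y' * s - y * c) / S) * ((y' * c + x * sb) / S - (y * c - x * cb) * C / S\<^sup>2)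
    - ((x * cb - y' * s) / S - (x * sb - y * s) * C / S\<^sup>2) * ((y' * c - y * s - x' * cb + x * sb) / S)
    = - ((y - x * C - x' * S) * (x - y * C + y' * S) / S ^ 3)"
    if "s\<^sup>2 + c\<^sup>2 = 1" "S\<^sup>2 + C\<^sup>2 = 1" "S \<noteq> 0" "sb = s * C + c * S" "cb = c * C - s * S"
    for s c S C sb cb x y x' y' :: real
  proof -
    have "(y' * c + x * sb) * S - (y * c - x * cb) * C = c * (x - y * C + y' * S)"
      using that(2) unfolding that(4,5) by algebra
    moreover have "(x * cb - y' * s) * S - (x * sb - y * s) * C = - s * (x - y * C + y' * S)"
      using that(2) unfolding that(4,5) by algebra
    moreover have "(x' * sb + x * cb - y' * s - y * c) * c + s * (y' * c - y * s - x' * cb + x * sb) = - (y - x * C - x' * S)"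
      using that(1) unfolding that(4,5) by algebra
    ultimately have "((x' * sb + x * cb - y' * s - y * c)) * ((y' * c + x * sb) * S - (y * c - x * cb) * C )
    - ((x * cb - y' * s) * S - (x * sb - y * s) * C) * ((y' * c - y * s - x' * cb + x * sb))
    = - ((y - x * C - x' * S) * (x - y * C + y' * S))"
      by (rule elim)
    moreover have "((x' * sb + x * cb - y' * s - y * c) / S) * ((y' * c + x * sb) / S - (y * c - x * cb) * C / S\<^sup>2)
    - ((x * cb - y' * s) / S - (x * sb - y * s) * C / S\<^sup>2) * ((y' * c - y * s - x' * cb + x * sb) / S)
      = (((x' * sb + x * cb - y' * s - y * c)) * ((y' * c + x * sb) * S - (y * c - x * cb) * C )
    - ((x * cb - y' * s) * S - (x * sb - y * s) * C) * ((y' * c - y * s - x' * cb + x * sb))) / S ^ 3"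
      by (rule quot[OF that(3)])
    ultimately show ?thesis by (simp only: minus_divide_left)
  qed
  define a d b where "a = v $ 1" and "d = v $ 2" and "b = v $ 1 + v $ 2"
  have e: "meet' v (axis 1 1) $ 1 = (p1 a * sin b + p a * cos b - p1 b * sin a - p b * cos a) / sin d"
      "meet' v (axis 2 1) $ 1 = (p a * cos b - p1 b * sin a) / sin d - (p a * sin b - p b * sin a) * cos d / (sin d)\<^sup>2"
      "meet' v (axis 1 1) $ 2 = (p1 b * cos a - p b * sin a - p1 a * cos b + p a * sin b) / sin d"
      "meet' v (axis 2 1) $ 2 = (p1 b * cos a + p a * sin b) / sin d - (p b * cos a - p a * cos b) * cos d / (sin d)\<^sup>2"
    by (simp_all only: meet'_def Let_def axis_def vector_2 a_def b_def d_def) simp_all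
  have "sin b = sin a * cos d + cos a * sin d" "cos b = cos a * cos d - sin a * sin d" "sin d \<noteq> 0"
    using s by (simp_all add: a_def b_def d_def sin_add cos_add)
  then have "det (matrix (meet' v)) = - ((p b - p a * cos d - p1 a * sin d) * (p a - p b * cos d + p1 b * sin d) / sin d ^ 3)"
    unfolding det_matrix2 e by (intro id sin_cos_squared_add)
  then have "det (matrix (meet' v)) = - (tl1 (v $ 1) (v $ 2) * tl2 (v $ 1) (v $ 2) / sin (v $ 2) ^ 3)"
    by (simp only: tl1_def tl2_def a_def b_def d_def)
  then show ?thesis using tangent_lengths_pos[OF v, of "v $ 1"] s by (simp add: abs_mult)
qed

lemma contact_has_vector_derivative: "(contact has_vector_derivative radius a *\<^sub>R tvec a) (at a)"
proof -
  have "(nvec has_vector_derivative tvec a) (at a)" "(tvec has_vector_derivative - nvec a) (at a)"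
    unfolding nvec_def[abs_def] tvec_def[abs_def] vector2_eq_axis
    by (auto intro!: derivative_eq_intros simp: vec_eq_iff axis_def)
  then show ?thesis
    unfolding contact_def[abs_def]
    by (auto intro!: derivative_eq_intros p_deriv p1_deriv simp: radius_def algebra_simps)
qed

text \<open>The radius of curvature is the second derivative of \<open>p b - contact a \<bullet> nvec b\<close> at its minimum
  \<open>b = a\<close>.\<close>
lemma radius_nonneg: "0 \<le> radius a"
proof -
  define h where "h x = p x - contact a \<bullet> nvec x" for x
  define h' where "h' x = p1 x - contact a \<bullet> tvec x" for x
  have h: "(h has_real_derivative h' x) (at x)" for x
    unfolding h_def[abs_def] h'_def by (intro derivative_intros p_deriv inner_nvec_deriv)
  have h': "(h' has_real_derivative radius a) (at a)"
  proof -
    have "((\<lambda>x. contact a \<bullet> tvec x) has_real_derivative - (contact a \<bullet> nvec a)) (at a)"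
      by (auto simp: inner_vec2 intro!: derivative_eq_intros)
    from DERIV_diff[OF p1_deriv this] show ?thesis by (simp add: h'_def[abs_def] radius_def contact_inner add.commute)
  qed
  have h0: "h a = 0" "h' a = 0" by (simp_all add: h_def h'_def contact_inner)
  have hge: "0 \<le> h x" for x using support_ge[OF contact_in_K] by (simp add: h_def)
  show ?thesis
  proof (rule ccontr)
    assume "\<not> 0 \<le> radius a"
    then obtain e where e: "e > 0" "\<And>k. 0 < k \<Longrightarrow> k < e \<Longrightarrow> h' (a + k) < h' a"
      using DERIV_neg_dec_right[OF h'] by auto
    have "h (a + e / 2) < h a"
    proof (rule DERIV_neg_imp_decreasing_open[where f = h])
      show "\<exists>y. (h has_real_derivative y) (at x) \<and> y < 0" if "a < x" "x < a + e / 2" for x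
        using h[of x] e(2)[of "x - a"] that h0 e(1) by auto
      show "continuous_on {a..a + e / 2} h" by (intro continuous_at_imp_continuous_on ballI DERIV_isCont[OF h])
    qed (use e in auto)
    then show False using hge[of "a + e / 2"] h0 by simp
  qed
qed

text \<open>Coordinates on the interior of \<open>K\<close>: the segments from an interior point \<open>q\<close> to the contact points.\<close>
definition star :: "real^2 \<Rightarrow> real^2 \<Rightarrow> real^2" where
  "star q v = q + (v $ 2) *\<^sub>R (contact (v $ 1) - q)"

definition star' :: "real^2 \<Rightarrow> real^2 \<Rightarrow> real^2 \<Rightarrow> real^2" where
  "star' q v w = (w $ 2) *\<^sub>R (contact (v $ 1) - q) + (v $ 2 * w $ 1 * radius (v $ 1)) *\<^sub>R tvec (v $ 1)"

lemma star_has_derivative: "(star q has_derivative star' q v) (at v)"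
proof -
  have "((\<lambda>v::real^2. contact (v $ 1)) has_derivative (\<lambda>w. (w $ 1) *\<^sub>R (radius (v $ 1) *\<^sub>R tvec (v $ 1)))) (at v)"
    using has_derivative_compose[OF has_derivative_nth contact_has_vector_derivative[unfolded has_vector_derivative_def]]
    by simp
  then show ?thesis
    unfolding star_def[abs_def] star'_def[abs_def]
    by (auto intro!: derivative_eq_intros has_derivative_nth simp: algebra_simps)
qed

lemma det_star':
  assumes "q \<in> interior K" "0 \<le> v $ 2"
  shows "\<bar>det (matrix (star' q v))\<bar> = v $ 2 * (radius (v $ 1) * (p (v $ 1) - q \<bullet> nvec (v $ 1)))"
proof -
  have "det (matrix (star' q v)) = - (v $ 2 * (radius (v $ 1) * ((contact (v $ 1) - q) \<bullet> nvec (v $ 1))))"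
    unfolding det_matrix2 star'_def by (simp add: axis_def inner_vec2 algebra_simps)
  also have "(contact (v $ 1) - q) \<bullet> nvec (v $ 1) = p (v $ 1) - q \<bullet> nvec (v $ 1)"
    by (simp add: inner_diff_left contact_inner)
  finally show ?thesis
    using assms(2) radius_nonneg[of "v $ 1"] interior_support_less[OF assms(1), of "v $ 1"]
    by (simp add: abs_mult)
qed

lemma star_inj:
  assumes q: "q \<in> interior K"
  shows "inj_on (star q) {v. v $ 1 \<in> {0..<2*pi} \<and> v $ 2 \<in> {0<..<1}}"
proof -
  \<comment> \<open>If \<open>s\<close> were larger, \<open>contact a\<close> would be a strict convex combination of \<open>q\<close> and a point of \<open>K\<close>,
  contradicting that it maximises the inner product with \<open>nvec a\<close>.\<close>
  have le: "s \<le> s'" if eq: "s *\<^sub>R (contact a - q) = s' *\<^sub>R (contact b - q)" and s: "0 < s" "0 < s'" for a b s s'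
  proof (rule ccontr)
    assume "\<not> s \<le> s'"
    define t where "t = s' / s"
    have t: "0 < t" "t < 1" using \<open>\<not> s \<le> s'\<close> s by (auto simp: t_def)
    have "s *\<^sub>R (contact a - q) = s *\<^sub>R (t *\<^sub>R (contact b - q))" using eq s by (simp add: t_def)
    then have c: "contact a - q = t *\<^sub>R (contact b - q)" using s by (simp del: scaleR_scaleR)
    have "(contact a - q) \<bullet> nvec a = p a - q \<bullet> nvec a" by (simp add: inner_diff_left contact_inner)
    moreover have "(contact a - q) \<bullet> nvec a \<le> t * (p a - q \<bullet> nvec a)"
      unfolding c using support_ge[OF contact_in_K[of b], of a] t by (simp add: inner_diff_left)
    moreover have "t * (p a - q \<bullet> nvec a) < 1 * (p a - q \<bullet> nvec a)"
      using t interior_support_less[OF q, of a] by (intro mult_strict_right_mono) auto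
    ultimately show False by simp
  qed
  show ?thesis
  proof (intro inj_onI)
    fix v w :: "real^2" assume v: "v \<in> {v. v $ 1 \<in> {0..<2*pi} \<and> v $ 2 \<in> {0<..<1}}" and w: "w \<in> {v. v $ 1 \<in> {0..<2*pi} \<and> v $ 2 \<in> {0<..<1}}"
      and eq: "star q v = star q w"
    have "v $ 2 *\<^sub>R (contact (v $ 1) - q) = w $ 2 *\<^sub>R (contact (w $ 1) - q)" using eq by (simp add: star_def)
    moreover from le[OF this] le[OF this[symmetric]] have 2: "v $ 2 = w $ 2" using v w by auto
    ultimately have "contact (v $ 1) = contact (w $ 1)" using v by auto
    then have "v $ 1 = w $ 1" using normal_unique[of "v $ 1" "w $ 1"] nvec_inj[of "v $ 1" "w $ 1"] v w by auto
    then show "v = w" using 2 by (rule vec2_eqI)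
  qed
qed

lemma star_image:
  assumes q: "q \<in> interior K"
  shows "star q ` {v. v $ 1 \<in> {0..<2*pi} \<and> v $ 2 \<in> {0<..<1}} = interior K - {q}"
proof (intro set_eqI iffI)
  fix y assume "y \<in> star q ` {v. v $ 1 \<in> {0..<2*pi} \<and> v $ 2 \<in> {0<..<1}}"
  then obtain v where v: "v $ 2 \<in> {0<..<1}" "y = star q v" by auto
  have "contact (v $ 1) \<noteq> q" using contact_frontier[of "v $ 1"] q by (auto simp: frontier_def)
  then have "y \<noteq> q" using v by (auto simp: star_def)
  have "contact (v $ 1) - (1 - v $ 2) *\<^sub>R (contact (v $ 1) - q) \<in> interior K"
    using v(1) by (intro mem_interior_convex_shrink[OF convex_K q contact_in_K]) auto
  also have "contact (v $ 1) - (1 - v $ 2) *\<^sub>R (contact (v $ 1) - q) = y"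
    unfolding v(2) star_def by (simp add: algebra_simps)
  finally show "y \<in> interior K - {q}" using \<open>y \<noteq> q\<close> by simp
next
  fix y assume y: "y \<in> interior K - {q}"
  then have "y - q \<noteq> 0" by simp
  then obtain d where d: "0 < d" "q + d *\<^sub>R (y - q) \<in> frontier K" "\<And>e. 0 \<le> e \<Longrightarrow> e < d \<Longrightarrow> q + e *\<^sub>R (y - q) \<in> interior K"
    using ray_to_frontier[OF compact_imp_bounded[OF compact_K] q \<open>y - q \<noteq> 0\<close>] by blast
  obtain a where a: "0 \<le> a" "a < 2 * pi" "q + d *\<^sub>R (y - q) = contact a" using frontier_contact[OF d(2)] by metis
  have "1 < d"
  proof (rule ccontr)
    assume "\<not> 1 < d"
    have "y - (1 - d) *\<^sub>R (y - q) \<in> interior K"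
    proof (cases "d = 1")
      case False
      have "y \<in> K" using y interior_subset[of K] by auto
      then show ?thesis using \<open>\<not> 1 < d\<close> d(1) False
        by (intro mem_interior_convex_shrink[OF convex_K q]) auto
    qed (use y in auto)
    then have "q + d *\<^sub>R (y - q) \<in> interior K" by (simp add: algebra_simps)
    then show False using d(2) by (simp add: frontier_def)
  qed
  have "y = q + (1 / d) *\<^sub>R (d *\<^sub>R (y - q))" using d(1) by simp
  also have "d *\<^sub>R (y - q) = contact a - q" unfolding a(3)[symmetric] by simp
  finally have "y = star q (vector [a, 1 / d])" by (simp add: star_def)
  then show "y \<in> star q ` {v. v $ 1 \<in> {0..<2*pi} \<and> v $ 2 \<in> {0<..<1}}"
    using a \<open>1 < d\<close> by (intro image_eqI) auto
qed

end

section \<open>Area and perimeter\<close>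

lemma set_integral_half_open:
  fixes f :: "real \<Rightarrow> real"
  assumes "continuous_on UNIV f"
  shows "set_integrable lborel {0..<T} f \<and> (LINT x:{0..<T}|lborel. f x) = integral {0..T} f"
proof -
  have "set_integrable lborel {0..T} f"
    by (rule borel_integrable_atLeastAtMost'[OF continuous_on_subset[OF assms subset_UNIV]])
  then have 1: "set_integrable lborel {0..<T} f" by (rule set_integrable_subset) auto
  have "negligible ({0..T} - {0..<T})"
    by (rule negligible_subset[OF negligible_sing[of T]]) auto
  then have "integral {0..<T} f = integral {0..T} f"
    by (intro integral_subset_negligible) auto
  then show ?thesis using 1 set_borel_integral_eq_integral(2)[OF 1] by simp
qed

lemma constant_increment_deriv:
  fixes U u :: "real \<Rightarrow> real"
  assumes U: "\<And>x. (U has_real_derivative u x) (at x)" and per: "\<And>x. u (x + T) = u x" and "0 \<le> T"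
  shows "U (x + T) - U x = integral {0..T} u"
proof -
  have "\<forall>y. ((\<lambda>x. U (x + T) - U x) has_real_derivative 0) (at y)"
    using per by (auto intro!: derivative_eq_intros DERIV_chain2[OF U] U)
  then have "U (x + T) - U x = U (0 + T) - U 0" by (rule DERIV_isconst_all)
  also have "(u has_integral U T - U 0) {0..T}"
    using fundamental_theorem_of_calculus[of 0 T U u] U \<open>0 \<le> T\<close>
    by (simp add: has_real_derivative_iff_has_vector_derivative has_vector_derivative_at_within)
  then have "U (0 + T) - U 0 = integral {0..T} u" by (simp add: integral_unique)
  finally show ?thesis .
qed

lemma measurable_vec_nth [measurable]: "(\<lambda>v::real^2. v $ i) \<in> borel_measurable borel"
  by (intro borel_measurable_continuous_onI continuous_intros)

context smooth_oval begin

lemma radius_cont: "continuous_on S radius"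
  unfolding radius_def[abs_def] by (intro continuous_intros corr.p_cont corr.p2_cont')

lemma support_measurable [measurable]:
  "p \<in> borel_measurable borel" "p1 \<in> borel_measurable borel" "radius \<in> borel_measurable borel"
  by (intro borel_measurable_continuous_onI corr.p_cont corr.p1_cont radius_cont)+

lemma radius_periodic: "radius (a + 2 * pi) = radius a"
  by (simp add: radius_def p_periodic corr.p2_periodic)

lemma integral_radius: "integral {0..2*pi} radius = integral {0..2*pi} p"
proof -
  have "(p2 has_integral 0) {0..2*pi}"
    by (rule has_integral_deriv_periodic[OF p1_deriv]) (use corr.p1_periodic[of 0] in auto)
  moreover have "(p has_integral integral {0..2*pi} p) {0..2*pi}"
    using corr.p_intble[OF corr.p_cont] by (rule integrable_integral)
  ultimately have "((\<lambda>x. p x + p2 x) has_integral integral {0..2*pi} p + 0) {0..2*pi}" by (intro has_integral_add)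
  then show ?thesis unfolding radius_def[abs_def] by (simp add: integral_unique)
qed

text \<open>The star coordinates have Jacobian \<open>s (p + p'')(p - q \<bullet> n)\<close>. The contribution of \<open>q\<close> is the
  integral of a derivative of a periodic function, hence zero.\<close>
lemma area_K: "measure lborel K = (corr.r0 0 + corr.r2 0) / 2"
proof -
  obtain q where q: "q \<in> interior K" using interior_nonempty by blast
  define Z where "Z = integral {0..2*pi} (\<lambda>a. radius a * (p a - q \<bullet> nvec a))"
  define S where "S = {v::real^2. v $ 1 \<in> {0..<2*pi} \<and> v $ 2 \<in> {0<..<1}}"
  have image: "star q ` S = interior K - {q}" unfolding S_def by (rule star_image[OF q])
  have nvec_cont: "continuous_on A (\<lambda>a. q \<bullet> nvec a)" for A
    by (intro continuous_at_imp_continuous_on ballI DERIV_isCont[OF inner_nvec_deriv])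
  have cont: "continuous_on UNIV (\<lambda>a. radius a * (p a - q \<bullet> nvec a))"
    by (intro continuous_intros radius_cont corr.p_cont nvec_cont)
  have [measurable]: "(\<lambda>a. q \<bullet> nvec a) \<in> borel_measurable borel"
    by (intro borel_measurable_continuous_onI nvec_cont)
  have Z_half: "((\<lambda>b. b * Z) has_integral Z / 2) {0..1}"
  proof -
    have "((\<lambda>b. b\<^sup>2 / 2 * Z) has_real_derivative b * Z) (at b within {0..1})" for b :: real
      by (auto intro!: derivative_eq_intros)
    then show ?thesis
      using fundamental_theorem_of_calculus[of 0 1 "\<lambda>b. b\<^sup>2 / 2 * Z" "\<lambda>b. b * Z"]
      by (simp add: has_real_derivative_iff_has_vector_derivative)
  qed
  have "set_integrable lborel (star q ` S) (\<lambda>_. 1 :: real) \<and> (LINT P:star q ` S|lborel. (1::real)) = Z / 2"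
  proof (rule area_formula_product[where J = "\<lambda>a b. b * (radius a * (p a - q \<bullet> nvec a))" and I = "\<lambda>b. b * Z" and w = "\<lambda>_. 1"
        and A = "{0..<2*pi}" and B = "{0<..<1}" and g' = "star' q"])
    show "S = {v. v $ 1 \<in> {0..<2*pi} \<and> v $ 2 \<in> {0<..<1}}" by (rule S_def)
    show "(star q has_derivative star' q v) (at v)" for v by (rule star_has_derivative)
    show "inj_on (star q) S" unfolding S_def by (rule star_inj[OF q])
    show "\<bar>det (matrix (star' q v))\<bar> = v $ 2 * (radius (v $ 1) * (p (v $ 1) - q \<bullet> nvec (v $ 1)))" if "v \<in> S" for v
      using that by (intro det_star' q) (auto simp: S_def)
    show "set_integrable lborel {0..<2*pi} (\<lambda>a. b * (radius a * (p a - q \<bullet> nvec a))) \<and>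
        (LINT a:{0..<2*pi}|lborel. b * (radius a * (p a - q \<bullet> nvec a))) = b * Z" for b
      using set_integral_half_open[OF continuous_on_mult_left[OF cont, of b], of "2 * pi"] by (simp add: Z_def)
    have "set_integrable lborel {0..1} (\<lambda>b. b * Z)"
      by (intro borel_integrable_atLeastAtMost' continuous_intros)
    then show *: "set_integrable lborel {0<..<1} (\<lambda>b. 1 * (b * Z))"
      by (auto intro: set_integrable_subset)
    show "(LINT b:{0<..<1}|lborel. 1 * (b * Z)) = Z / 2"
      using set_borel_integral_eq_integral(2)[OF *] integral_unique[OF Z_half]
      unfolding integral_open_interval_real by (simp only: mult_1_left)
    have "(\<lambda>v::real^2. indicator {0..<2*pi} (v $ 1) * indicator {0<..<1} (v $ 2) * (v $ 2 * (radius (v $ 1) * (p (v $ 1) - q \<bullet> nvec (v $ 1))))) \<in> borel_measurable borel"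
      by measurable
    moreover have "(\<lambda>v::real^2. indicator {0..<2*pi} (v $ 1) * indicator {0<..<1} (v $ 2) * (v $ 2 * (radius (v $ 1) * (p (v $ 1) - q \<bullet> nvec (v $ 1)))))
      = (\<lambda>v. indicator S v * (1 * (v $ 2 * (radius (v $ 1) * (p (v $ 1) - q \<bullet> nvec (v $ 1))))))"
      by (auto simp: S_def indicator_def)
    ultimately show "(\<lambda>v. indicator S v * (1 * (v $ 2 * (radius (v $ 1) * (p (v $ 1) - q \<bullet> nvec (v $ 1)))))) \<in> borel_measurable borel"
      by (simp only:)
    show "set_borel_measurable borel (star q ` S) (\<lambda>_. 1 :: real)"
      unfolding image set_borel_measurable_def
      by (intro borel_measurable_scaleR borel_measurable_indicator) auto
  qed auto
  then have 1: "measure lborel (interior K - {q}) = Z / 2"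
    unfolding image set_lebesgue_integral_def by simp
  have null: "{q} \<union> frontier K \<in> null_sets lborel"
  proof -
    have "frontier K \<in> null_sets lebesgue"
      using negligible_convex_frontier[OF convex_K] by (simp add: negligible_iff_null_sets)
    then have "frontier K \<in> null_sets lborel" by (simp add: null_sets_completion_iff)
    moreover have "{q} \<in> null_sets lborel" by (simp add: null_sets_def)
    ultimately show ?thesis by (rule null_sets.Un[rotated])
  qed
  have "K = (interior K - {q}) \<union> ({q} \<union> frontier K)"
    using q interior_subset[of K] closed_K by (auto simp: frontier_def)
  then have "measure lborel K = measure lborel (interior K - {q})"
    using measure_Un_null_set[OF _ null, of "interior K - {q}"] by simp
  also note 1
  also have "Z = corr.r0 0 + corr.r2 0"
  proof -
    have hi: "(f has_integral integral {0..2*pi} f) {0..2*pi}" if "continuous_on UNIV f" for f :: "real \<Rightarrow> real"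
      using corr.p_intble[OF that] by (rule integrable_integral)
    have "((\<lambda>a. radius a * (q \<bullet> nvec a)) has_integral 0) {0..2*pi}"
    proof (rule has_integral_deriv_periodic[where f = "\<lambda>a. p1 a * (q \<bullet> nvec a) - p a * (q \<bullet> tvec a)"])
      have t: "((\<lambda>a. q \<bullet> tvec a) has_real_derivative - (q \<bullet> nvec a)) (at a)" for a
        by (auto simp: inner_vec2 intro!: derivative_eq_intros)
      show "((\<lambda>a. p1 a * (q \<bullet> nvec a) - p a * (q \<bullet> tvec a)) has_real_derivative radius a * (q \<bullet> nvec a)) (at a)" for a
        by (auto intro!: derivative_eq_intros p1_deriv p_deriv inner_nvec_deriv t simp: radius_def algebra_simps)
    qed (use p_periodic[of 0] corr.p1_periodic[of 0] nvec_2pi[of 0] tvec_2pi[of 0] in auto)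
    moreover have "((\<lambda>a. p a * p a + p a * p2 a) has_integral corr.r0 0 + corr.r2 0) {0..2*pi}"
      unfolding corr.r0_def corr.r2_def add_0_right
      by (intro has_integral_add hi continuous_intros corr.p_cont corr.p2_cont')
    ultimately have "((\<lambda>a. p a * p a + p a * p2 a - radius a * (q \<bullet> nvec a)) has_integral corr.r0 0 + corr.r2 0 - 0) {0..2*pi}"
      by (intro has_integral_diff)
    moreover have "(\<lambda>a. p a * p a + p a * p2 a - radius a * (q \<bullet> nvec a)) = (\<lambda>a. radius a * (p a - q \<bullet> nvec a))"
      by (simp add: radius_def algebra_simps)
    ultimately show ?thesis unfolding Z_def by (simp add: integral_unique)
  qed
  finally show ?thesis .
qed

text \<open>Identify the velocity with a nowhere vanishing complex function \<open>w\<close>. A logarithm of \<open>w\<close> is obtained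
  by integrating \<open>w' / w\<close>, and its imaginary part is the angle.\<close>
lemma tangent_angle_exists:
  obtains \<theta> \<theta>' where "\<And>t. t \<in> {0..1} \<Longrightarrow> (\<theta> has_real_derivative \<theta>' t) (at t within {0..1})"
    "\<And>t. t \<in> {0..1} \<Longrightarrow> d\<gamma> t = norm (d\<gamma> t) *\<^sub>R nvec (\<theta> t)"
proof -
  obtain d1 d2 where d: "\<And>t. (\<gamma> has_vector_derivative d1 t) (at t)" "\<And>t. (d1 has_vector_derivative d2 t) (at t)" "continuous_on UNIV d2"
    using boundary by (auto simp: C2_boundary_param_def C2_fun_def)
  have d1: "d1 = d\<gamma>" using d(1) d\<gamma> vector_derivative_unique_at by blast
  define w where "w t = Complex (d\<gamma> t $ 1) (d\<gamma> t $ 2)" for t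
  define w' where "w' t = Complex (d2 t $ 1) (d2 t $ 2)" for t
  have cplx: "Complex x y = x *\<^sub>R 1 + y *\<^sub>R \<i>" for x y by (simp add: complex_eq_iff)
  have comp: "((\<lambda>t. d\<gamma> t $ i) has_real_derivative d2 t $ i) (at t)" for i t
    unfolding has_real_derivative_iff_has_vector_derivative
    by (rule bounded_linear.has_vector_derivative[OF bounded_linear_vec_nth d(2)[unfolded d1]])
  have w: "(w has_vector_derivative w' t) (at t)" for t
    unfolding w_def[abs_def] w'_def cplx by (auto intro!: derivative_eq_intros comp)
  have w_nz: "w t \<noteq> 0" for t
    using d\<gamma>_nz[of t] by (auto simp: w_def complex_eq_iff vec_eq_iff forall_2)
  have w_cont: "continuous_on A w" for A
    by (intro continuous_at_imp_continuous_on ballI has_vector_derivative_continuous[OF w])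
  have w'_cont: "continuous_on A w'" for A
    unfolding w'_def[abs_def] cplx by (intro continuous_intros continuous_on_subset[OF d(3)]) auto
  define l where "l t = Ln (w 0) + integral {0..t} (\<lambda>s. w' s / w s)" for t
  have l: "(l has_vector_derivative w' t / w t) (at t within {0..1})" if "t \<in> {0..1}" for t
    unfolding l_def[abs_def]
    by (auto intro!: derivative_eq_intros integral_has_vector_derivative that continuous_intros w_cont w'_cont simp: w_nz)
  have "w t * exp (- l t) = 1" if "t \<in> {0..1}" for t
  proof -
    have "((\<lambda>t. w t * exp (- l t)) has_vector_derivative 0) (at t within {0..1})" if t: "t \<in> {0..1}" for t
    proof -
      have e: "((\<lambda>t. exp (- l t)) has_vector_derivative (- (w' t / w t)) * exp (- l t)) (at t within {0..1})"
        using field_vector_diff_chain_within[OF has_vector_derivative_minus[OF l[OF t]] has_field_derivative_at_within[OF DERIV_exp]]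
        by (simp add: o_def)
      from has_vector_derivative_mult[OF has_vector_derivative_at_within[OF w] e] show ?thesis
        using w_nz[of t] by simp
    qed
    then obtain c where c: "\<And>t. t \<in> {0..1} \<Longrightarrow> w t * exp (- l t) = c"
      using has_vector_derivative_zero_constant[of "{0..1}" "\<lambda>t. w t * exp (- l t)"] by (metis convex_real_interval(5))
    have "w 0 * exp (- l 0) = 1" using w_nz[of 0] by (simp add: l_def exp_minus)
    then show ?thesis using c[of 0] c[OF that] by simp
  qed
  then have wl: "w t = exp (l t)" if "t \<in> {0..1}" for t
    using that by (metis exp_minus_inverse mult.commute mult_cancel_left exp_not_eq_zero)
  show ?thesis
  proof (rule that[of "\<lambda>t. Im (l t)" "\<lambda>t. Im (w' t / w t)"])
    fix t :: real assume t: "t \<in> {0..1}"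
    show "((\<lambda>t. Im (l t)) has_real_derivative Im (w' t / w t)) (at t within {0..1})"
      unfolding has_real_derivative_iff_has_vector_derivative
      by (rule bounded_linear.has_vector_derivative[OF bounded_linear_Im l[OF t]])
    have n: "norm (d\<gamma> t) = exp (Re (l t))"
    proof -
      have "norm (d\<gamma> t) = cmod (w t)"
        by (simp add: w_def norm_eq_sqrt_inner[of "d\<gamma> t"] inner_vec2 cmod_def power2_eq_square)
      then show ?thesis using wl[OF t] by simp
    qed
    have "Re (w t) = exp (Re (l t)) * cos (Im (l t))" "Im (w t) = exp (Re (l t)) * sin (Im (l t))"
      unfolding wl[OF t] by (simp_all add: Re_exp Im_exp)
    then show "d\<gamma> t = norm (d\<gamma> t) *\<^sub>R nvec (Im (l t))"
      unfolding n by (intro vec2_eqI) (simp_all add: w_def)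
  qed
qed

text \<open>The sign \<open>\<sigma>\<close> is the orientation of \<open>\<gamma>\<close>. It is constant because the outer normal has positive inner
  product with \<open>\<gamma> t - q\<close>, which is continuous in \<open>t\<close>.\<close>
lemma normal_angle_exists:
  obtains \<sigma> \<alpha> \<alpha>' where "\<sigma> = 1 \<or> \<sigma> = - 1"
    "\<And>t. t \<in> {0..1} \<Longrightarrow> (\<alpha> has_real_derivative \<alpha>' t) (at t within {0..1})"
    "\<And>t. t \<in> {0..1} \<Longrightarrow> \<gamma> t = contact (\<alpha> t)"
    "\<And>t. t \<in> {0..1} \<Longrightarrow> d\<gamma> t = (\<sigma> * norm (d\<gamma> t)) *\<^sub>R tvec (\<alpha> t)"
proof -
  obtain \<theta> \<theta>' where \<theta>: "\<And>t. t \<in> {0..1} \<Longrightarrow> (\<theta> has_real_derivative \<theta>' t) (at t within {0..1})"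
    and tang: "\<And>t. t \<in> {0..1} \<Longrightarrow> d\<gamma> t = norm (d\<gamma> t) *\<^sub>R nvec (\<theta> t)"
    using tangent_angle_exists by blast
  obtain q where q: "q \<in> interior K" using interior_nonempty by blast
  define f where "f t = (\<gamma> t - q) \<bullet> nvec (\<theta> t - pi / 2)" for t
  have \<theta>_cont: "continuous_on {0..1} \<theta>"
    by (meson \<theta> DERIV_continuous continuous_on_eq_continuous_within)
  have \<gamma>_cont: "continuous_on A \<gamma>" for A
    by (intro continuous_at_imp_continuous_on ballI has_vector_derivative_continuous[OF d\<gamma>])
  have f_cont: "continuous_on {0..1} f"
    unfolding f_def[abs_def] inner_vec2 nvec_nth
    by (intro continuous_intros \<theta>_cont \<gamma>_cont)
  have normal: "\<exists>e. (e = 1 \<or> e = - 1) \<and> 0 < e * f t \<and> (\<exists>a. \<gamma> t = contact a \<and> nvec a = e *\<^sub>R nvec (\<theta> t - pi / 2))"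
    if t: "t \<in> {0..1}" for t
  proof -
    obtain a where a: "\<gamma> t = contact a" using frontier_contact[OF \<gamma>_frontier[of t]] by metis
    have "nvec (\<theta> t) \<bullet> nvec a = 0"
      using normal_perp_tangent[OF a] tang[OF t] d\<gamma>_nz[of t] by (metis inner_scaleR_left mult_eq_0_iff norm_eq_zero)
    then have "nvec a = (nvec a \<bullet> tvec (\<theta> t)) *\<^sub>R tvec (\<theta> t)"
      using nvec_frame[of "nvec a" "\<theta> t"] by (simp add: inner_commute)
    moreover have tn: "tvec (\<theta> t) = - nvec (\<theta> t - pi / 2)" by (rule vec2_eqI) (simp_all add: cos_diff sin_diff)
    ultimately have ne: "nvec a = (- (nvec a \<bullet> tvec (\<theta> t))) *\<^sub>R nvec (\<theta> t - pi / 2)" by simp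
    define e where "e = - (nvec a \<bullet> tvec (\<theta> t))"
    have ne: "nvec a = e *\<^sub>R nvec (\<theta> t - pi / 2)" using ne by (simp add: e_def)
    have "norm (nvec a) = \<bar>e\<bar>" unfolding ne by simp
    then have e: "e = 1 \<or> e = - 1" by auto
    have "0 < p a - q \<bullet> nvec a" using interior_support_less[OF q, of a] by simp
    also have "p a - q \<bullet> nvec a = (\<gamma> t - q) \<bullet> nvec a" by (simp add: a inner_diff_left contact_inner)
    also have "\<dots> = e * f t" unfolding f_def ne by simp
    finally show ?thesis using e a ne by blast
  qed
  define \<sigma> where "\<sigma> = sgn (f 0)"
  have f_nz: "f t \<noteq> 0" if "t \<in> {0..1}" for t using normal[OF that] by auto
  have \<sigma>: "\<sigma> = 1 \<or> \<sigma> = - 1" using f_nz[of 0] by (auto simp: \<sigma>_def sgn_if)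
  have sign: "0 < \<sigma> * f t" if t: "t \<in> {0..1}" for t
  proof (rule ccontr)
    assume "\<not> 0 < \<sigma> * f t"
    then have "\<sigma> * f t \<le> 0" by simp
    moreover have "0 \<le> \<sigma> * f 0" by (simp add: \<sigma>_def sgn_if)
    moreover have "continuous_on {0..t} (\<lambda>t. \<sigma> * f t)"
      using t by (intro continuous_intros continuous_on_subset[OF f_cont]) auto
    ultimately obtain x where "0 \<le> x" "x \<le> t" "\<sigma> * f x = 0"
      using IVT2'[of "\<lambda>t. \<sigma> * f t" t 0 0] t by auto
    then show False using f_nz[of x] \<sigma> t by auto
  qed
  define \<alpha> where "\<alpha> t = \<theta> t - \<sigma> * (pi / 2)" for t
  have n\<alpha>: "nvec (\<alpha> t) = \<sigma> *\<^sub>R nvec (\<theta> t - pi / 2)" "nvec (\<theta> t) = \<sigma> *\<^sub>R tvec (\<alpha> t)" for t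
    using \<sigma> by (auto simp: \<alpha>_def vec_eq_iff forall_2 cos_diff sin_diff cos_add sin_add)
  show ?thesis
  proof (rule that[of \<sigma> \<alpha> \<theta>'])
    fix t :: real assume t: "t \<in> {0..1}"
    show "(\<alpha> has_real_derivative \<theta>' t) (at t within {0..1})"
      unfolding \<alpha>_def[abs_def] by (auto intro!: derivative_eq_intros \<theta>[OF t])
    obtain e a where e: "e = 1 \<or> e = - 1" "0 < e * f t" "\<gamma> t = contact a" "nvec a = e *\<^sub>R nvec (\<theta> t - pi / 2)"
      using normal[OF t] by blast
    have "e = \<sigma>" using e(1,2) sign[OF t] \<sigma> by auto
    then have "nvec a = nvec (\<alpha> t)" using e(4) n\<alpha>(1) by simp
    then show "\<gamma> t = contact (\<alpha> t)" using contact_cong e(3) by metis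
    show "d\<gamma> t = (\<sigma> * norm (d\<gamma> t)) *\<^sub>R tvec (\<alpha> t)"
      using tang[OF t] unfolding n\<alpha>(2) by (simp add: mult.commute)
  qed (rule \<sigma>)
qed

lemma \<gamma>_inj: "0 < t \<Longrightarrow> t < 1 \<Longrightarrow> \<gamma> t \<noteq> \<gamma> 0"
  using boundary by (force simp: C2_boundary_param_def simple_path_def loop_free_def)

text \<open>Along \<open>\<gamma>\<close> the speed is \<open>\<plusminus>(p + p'')(\<alpha>) \<alpha>'\<close>, so the length is the increment of an antiderivative of
  \<open>p + p''\<close> over the total turn of the normal angle \<open>\<alpha>\<close>. The turn is exactly one full rotation: the
  angle is strictly monotone, and after a full rotation the curve is back at the same contact point,
  which simplicity allows only at the end.\<close>
lemma curve_length_eq: "curve_length \<gamma> = integral {0..2*pi} p"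
proof -
  obtain \<sigma> \<alpha> \<alpha>' where \<sigma>: "\<sigma> = 1 \<or> \<sigma> = - 1"
    and \<alpha>: "\<And>t. t \<in> {0..1} \<Longrightarrow> (\<alpha> has_real_derivative \<alpha>' t) (at t within {0..1})"
    and \<gamma>\<alpha>: "\<And>t. t \<in> {0..1} \<Longrightarrow> \<gamma> t = contact (\<alpha> t)"
    and d\<gamma>\<alpha>: "\<And>t. t \<in> {0..1} \<Longrightarrow> d\<gamma> t = (\<sigma> * norm (d\<gamma> t)) *\<^sub>R tvec (\<alpha> t)"
    using normal_angle_exists by blast
  have \<sigma>2: "\<sigma> * \<sigma> = 1" using \<sigma> by auto
  have speed: "radius (\<alpha> t) * \<alpha>' t = \<sigma> * norm (d\<gamma> t)" if t: "t \<in> {0..1}" for t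
  proof -
    have "((\<lambda>t. contact (\<alpha> t)) has_vector_derivative \<alpha>' t *\<^sub>R (radius (\<alpha> t) *\<^sub>R tvec (\<alpha> t))) (at t within {0..1})"
      using vector_diff_chain_within[OF _ has_vector_derivative_at_within[OF contact_has_vector_derivative], of \<alpha> "\<alpha>' t" t "{0..1}"] \<alpha>[OF t]
      by (simp add: o_def has_real_derivative_iff_has_vector_derivative)
    then have "(\<gamma> has_vector_derivative \<alpha>' t *\<^sub>R (radius (\<alpha> t) *\<^sub>R tvec (\<alpha> t))) (at t within {0..1})"
      by (rule has_vector_derivative_transform[OF t, rotated]) (simp add: \<gamma>\<alpha>)
    moreover have "at t within {0..1} \<noteq> bot"
      using t by (simp add: trivial_limit_within islimpt_Icc)
    ultimately have "d\<gamma> t = \<alpha>' t *\<^sub>R (radius (\<alpha> t) *\<^sub>R tvec (\<alpha> t))"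
      using vector_derivative_unique_within has_vector_derivative_at_within[OF d\<gamma>] by blast
    then have "(\<sigma> * norm (d\<gamma> t)) *\<^sub>R tvec (\<alpha> t) = (\<alpha>' t * radius (\<alpha> t)) *\<^sub>R tvec (\<alpha> t)"
      using d\<gamma>\<alpha>[OF t] by (metis scaleR_scaleR)
    moreover have "tvec (\<alpha> t) \<noteq> 0" using norm_tvec[of "\<alpha> t"] by (metis norm_zero zero_neq_one)
    ultimately have "\<sigma> * norm (d\<gamma> t) = \<alpha>' t * radius (\<alpha> t)" using scaleR_cancel_right by blast
    then show ?thesis by (simp only: mult.commute)
  qed
  have pos: "0 < \<sigma> * \<alpha>' t" if t: "t \<in> {0..1}" for t
  proof -
    have "radius (\<alpha> t) * (\<sigma> * \<alpha>' t) = (\<sigma> * \<sigma>) * norm (d\<gamma> t)" using speed[OF t] by (simp add: mult_ac)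
    then have "0 < radius (\<alpha> t) * (\<sigma> * \<alpha>' t)" using d\<gamma>_nz[of t] \<sigma>2 by simp
    then show ?thesis using radius_nonneg[of "\<alpha> t"] by (simp add: zero_less_mult_iff)
  qed
  have \<alpha>_cont: "continuous_on {0..1} \<alpha>"
    by (meson \<alpha> DERIV_continuous continuous_on_eq_continuous_within)
  have incr: "\<sigma> * \<alpha> s < \<sigma> * \<alpha> t" if "0 \<le> s" "s < t" "t \<le> 1" for s t
  proof (rule DERIV_pos_imp_increasing_open[where f = "\<lambda>t. \<sigma> * \<alpha> t"])
    show "\<exists>y. ((\<lambda>t. \<sigma> * \<alpha> t) has_real_derivative y) (at x) \<and> 0 < y" if "s < x" "x < t" for x
    proof -
      have x: "x \<in> {0..1}" "0 < x" "x < 1" using that \<open>0 \<le> s\<close> \<open>t \<le> 1\<close> by auto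
      have "(\<alpha> has_real_derivative \<alpha>' x) (at x)" using \<alpha>[OF x(1)] x by (simp add: at_within_Icc_at)
      then show ?thesis using pos[OF x(1)] by (intro exI[of _ "\<sigma> * \<alpha>' x"]) (auto intro!: derivative_eq_intros)
    qed
    show "continuous_on {s..t} (\<lambda>t. \<sigma> * \<alpha> t)"
      using that by (intro continuous_intros continuous_on_subset[OF \<alpha>_cont]) auto
  qed (rule that)
  have turn: "\<alpha> 1 = \<alpha> 0 + \<sigma> * (2 * pi)"
  proof -
    have "contact (\<alpha> 1) = contact (\<alpha> 0)" using \<gamma>\<alpha>[of 0] \<gamma>\<alpha>[of 1] \<gamma>_periodic[of 0] by simp
    then obtain j :: int where j: "\<alpha> 1 = \<alpha> 0 + 2 * pi * j" using normal_unique nvec_eq_iff by metis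
    have "0 < (2 * pi) * (\<sigma> * real_of_int j)" using incr[of 0 1] j by (simp add: distrib_left mult_ac)
    then have sj: "0 < \<sigma> * real_of_int j" by (rule zero_less_mult_pos) simp
    define n :: int where "n = (if \<sigma> = 1 then j else - j)"
    have n: "\<sigma> * real_of_int j = real_of_int n" using \<sigma> by (auto simp: n_def)
    then have "0 < n" using sj by simp
    have "n < 2"
    proof (rule ccontr)
      assume "\<not> n < 2"
      then have n2: "2 \<le> real_of_int n" by simp
      have b1: "\<sigma> * \<alpha> 1 = \<sigma> * \<alpha> 0 + 2 * pi * real_of_int n" using j n[symmetric] by (simp add: algebra_simps)
      have "2 * pi * 2 \<le> 2 * pi * real_of_int n" using n2 by (intro mult_left_mono) auto
      then have b: "\<sigma> * \<alpha> 0 + 2 * pi < \<sigma> * \<alpha> 1" using b1 pi_gt_zero by simp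
      then obtain t where t: "0 \<le> t" "t \<le> 1" "\<sigma> * \<alpha> t = \<sigma> * \<alpha> 0 + 2 * pi"
        using IVT'[of "\<lambda>t. \<sigma> * \<alpha> t" 0 "\<sigma> * \<alpha> 0 + 2 * pi" 1] continuous_on_mult_left[OF \<alpha>_cont] pi_gt_zero by force
      then have "t \<noteq> 0" "t \<noteq> 1" using b pi_gt_zero by auto
      then have t01: "0 < t" "t < 1" using t by auto
      have "\<alpha> t = \<alpha> 0 + 2 * pi \<or> \<alpha> 0 = \<alpha> t + 2 * pi" using \<sigma> t(3) by auto
      then have "nvec (\<alpha> t) = nvec (\<alpha> 0)" by auto
      then have "\<gamma> t = \<gamma> 0" using contact_cong[of "\<alpha> t" "\<alpha> 0"] \<gamma>\<alpha>[of t] \<gamma>\<alpha>[of 0] t by simp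
      then show False using \<gamma>_inj[OF t01] by simp
    qed
    then have "\<sigma> * real_of_int j = 1" using n \<open>0 < n\<close> by simp
    then have "real_of_int j = \<sigma>" using \<sigma> by auto
    then show ?thesis using j by simp
  qed
  obtain U where U: "\<And>x. (U has_real_derivative radius x) (at x)"
  proof -
    have "\<exists>F. \<forall>x::real. - \<infinity> < ereal x \<longrightarrow> ereal x < \<infinity> \<longrightarrow> (F has_vector_derivative radius x) (at x)"
      using radius_cont[of UNIV] by (intro einterval_antiderivative) (auto simp: continuous_on_eq_continuous_at)
    then show ?thesis using that by (auto simp: has_real_derivative_iff_has_vector_derivative)
  qed
  have D: "U (x + 2 * pi) - U x = integral {0..2*pi} p" for x
    using constant_increment_deriv[OF U radius_periodic, of x] integral_radius by simp
  have "((\<lambda>t. norm (d\<gamma> t)) has_integral \<sigma> * U (\<alpha> 1) - \<sigma> * U (\<alpha> 0)) {0..1}"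
  proof (rule fundamental_theorem_of_calculus)
    fix t :: real assume t: "t \<in> {0..1}"
    have "((\<lambda>t. \<sigma> * U (\<alpha> t)) has_real_derivative \<sigma> * (radius (\<alpha> t) * \<alpha>' t)) (at t within {0..1})"
      by (intro DERIV_cmult DERIV_chain2[OF U \<alpha>[OF t]])
    also have "\<sigma> * (radius (\<alpha> t) * \<alpha>' t) = (\<sigma> * \<sigma>) * norm (d\<gamma> t)" unfolding speed[OF t] by simp
    finally show "((\<lambda>t. \<sigma> * U (\<alpha> t)) has_vector_derivative norm (d\<gamma> t)) (at t within {0..1})"
      using \<sigma>2 by (simp add: has_real_derivative_iff_has_vector_derivative)
  qed simp
  then have "curve_length \<gamma> = \<sigma> * U (\<alpha> 1) - \<sigma> * U (\<alpha> 0)"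
    by (simp add: curve_length_def d\<gamma>_def integral_unique)
  also have "\<dots> = integral {0..2*pi} p"
    using \<sigma> D[of "\<alpha> 0"] D[of "\<alpha> 0 - 2 * pi"] unfolding turn by auto
  finally show ?thesis .
qed

lemma curve_length_fourier: "curve_length \<gamma> = 2 * pi * fourier_a p 0"
  by (simp add: curve_length_eq fourier_a_def)

end

section \<open>The exterior integral\<close>

context smooth_oval begin

definition meet_jacobian :: "real \<Rightarrow> real \<Rightarrow> real" where "meet_jacobian a d = tl1 a d * tl2 a d / sin d ^ 3"

lemma meet_jacobian_cont: "sin d \<noteq> 0 \<Longrightarrow> continuous_on UNIV (\<lambda>a. meet_jacobian a d)"
  unfolding meet_jacobian_def tl1_def tl2_def by (intro continuous_intros corr.p_conts) auto

lemma iso_area_deriv_meet_jacobian: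
  assumes d: "0 < d" "d < pi"
  shows "(corr.iso_area has_real_derivative integral {0..2*pi} (\<lambda>a. meet_jacobian a d)) (at d)" "0 \<le> integral {0..2*pi} (\<lambda>a. meet_jacobian a d)"
proof -
  show "(corr.iso_area has_real_derivative integral {0..2*pi} (\<lambda>a. meet_jacobian a d)) (at d)"
    using corr.iso_area_deriv[OF d] by (simp add: meet_jacobian_def tl1_def tl2_def)
  have s: "sin d > 0" using d by (rule sin_gt_zero)
  show "0 \<le> integral {0..2*pi} (\<lambda>a. meet_jacobian a d)"
    by (rule integral_nonneg[OF corr.p_intble[OF meet_jacobian_cont]])
       (use s tangent_lengths_pos[OF d] in \<open>auto simp: meet_jacobian_def intro!: divide_nonneg_pos mult_nonneg_nonneg less_imp_le\<close>)
qed

lemma isCont_integral_meet_jacobian: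
  assumes d: "0 < d" "d < pi"
  shows "isCont (\<lambda>d. integral {0..2*pi} (\<lambda>a. meet_jacobian a d)) d"
proof -
  have "continuous_on {0<..<pi} (\<lambda>d. integral (cbox 0 (2*pi)) (\<lambda>a. meet_jacobian a d))"
  proof (rule integral_continuous_on_param)
    have "sin (fst x) \<noteq> 0" if "x \<in> {0<..<pi} \<times> cbox 0 (2 * pi)" for x :: "real \<times> real"
      using that sin_gt_zero[of "fst x"] by auto
    then show "continuous_on ({0<..<pi} \<times> cbox 0 (2 * pi)) (\<lambda>(d, a). meet_jacobian a d)"
      unfolding split_beta meet_jacobian_def tl1_def tl2_def by (intro continuous_intros corr.p_conts) auto
  qed
  then show ?thesis using d by (simp add: continuous_on_eq_continuous_at)
qed

lemma exterior_integral:
  assumes m: "1 \<le> m"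
  shows "set_integrable lborel (- K) (\<lambda>P. omega_fun m (visual_angle \<gamma> P)) \<and>
    (LINT P:- K|lborel. omega_fun m (visual_angle \<gamma> P)) =
      (LINT d:{0<..<pi}|lborel. deriv (omega_fun m) (pi - d) * corr.iso_area d) - pi ^ m * measure lborel K"
proof -
  define S where "S = {v::real^2. v $ 1 \<in> {0..<2*pi} \<and> v $ 2 \<in> {0<..<pi}}"
  have image: "(\<lambda>v. meet (v $ 1) (v $ 2)) ` S = - K"
  proof (intro set_eqI iffI)
    fix P assume "P \<in> (\<lambda>v. meet (v $ 1) (v $ 2)) ` S"
    then show "P \<in> - K" using meet_outside by (auto simp: S_def)
  next
    fix P assume "P \<in> - K"
    then obtain a d where "0 \<le> a" "a < 2 * pi" "0 < d" "d < pi" "P = meet a d" using meet_surj by blast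
    then show "P \<in> (\<lambda>v. meet (v $ 1) (v $ 2)) ` S"
      by (intro image_eqI[of _ _ "vector [a, d]"]) (auto simp: S_def)
  qed
  have om_meas: "omega_fun m \<in> borel_measurable borel"
    by (intro borel_measurable_continuous_onI continuous_at_imp_continuous_on ballI isCont_omega_fun)
  note [measurable] = om_meas
  note I = corr.integrate_isoptic_area[OF m conjI[OF iso_area_deriv_meet_jacobian] isCont_integral_meet_jacobian]
  have "set_integrable lborel ((\<lambda>v. meet (v $ 1) (v $ 2)) ` S) (\<lambda>P. omega_fun m (visual_angle \<gamma> P)) \<and>
    (LINT P:(\<lambda>v. meet (v $ 1) (v $ 2)) ` S|lborel. omega_fun m (visual_angle \<gamma> P)) =
      (LINT d:{0<..<pi}|lborel. deriv (omega_fun m) (pi - d) * corr.iso_area d) - pi ^ m * ((corr.r0 0 + corr.r2 0) / 2)"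
  proof (rule area_formula_product[where J = meet_jacobian and I = "\<lambda>d. integral {0..2*pi} (\<lambda>a. meet_jacobian a d)" and w = "\<lambda>d. omega_fun m (pi - d)"
        and A = "{0..<2*pi}" and B = "{0<..<pi}" and g' = meet'])
    show "S = {v. v $ 1 \<in> {0..<2*pi} \<and> v $ 2 \<in> {0<..<pi}}" by (rule S_def)
    have s: "sin d \<noteq> 0" if "d \<in> {0<..<pi}" for d using that sin_gt_zero[of d] by auto
    show "((\<lambda>v. meet (v $ 1) (v $ 2)) has_derivative meet' v) (at v)" if "v \<in> S" for v
      using that s by (intro meet_has_derivative) (simp add: S_def)
    show "inj_on (\<lambda>v. meet (v $ 1) (v $ 2)) S"
    proof (intro inj_onI vec2_eqI)
      fix v w assume vw: "v \<in> S" "w \<in> S" "meet (v $ 1) (v $ 2) = meet (w $ 1) (w $ 2)"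
      then show "v $ 1 = w $ 1" "v $ 2 = w $ 2"
        using meet_inj[of "v $ 1" "w $ 1" "v $ 2" "w $ 2"] by (auto simp: S_def)
    qed
    show "\<bar>det (matrix (meet' v))\<bar> = meet_jacobian (v $ 1) (v $ 2)" if "v \<in> S" for v
      using that unfolding meet_jacobian_def by (intro det_meet') (auto simp: S_def)
    show "omega_fun m (visual_angle \<gamma> (meet (v $ 1) (v $ 2))) = omega_fun m (pi - v $ 2)" if "v \<in> S" for v
      using that visual_angle_meet[OF _ _ refl, of "v $ 2" "v $ 1"] by (auto simp: S_def)
    show "set_integrable lborel {0..<2*pi} (\<lambda>a. meet_jacobian a d) \<and> (LINT a:{0..<2*pi}|lborel. meet_jacobian a d) = integral {0..2*pi} (\<lambda>a. meet_jacobian a d)"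
      if "d \<in> {0<..<pi}" for d
      by (rule set_integral_half_open[OF meet_jacobian_cont[OF s[OF that]]])
    show "0 \<le> omega_fun m (pi - d)" if "d \<in> {0<..<pi}" for d
    proof -
      obtain B where "0 < B" "\<And>w. 0 \<le> w \<Longrightarrow> w \<le> pi \<Longrightarrow> 0 \<le> deriv (omega_fun m) w \<and> deriv (omega_fun m) w \<le> B * (1 - cos w)"
        using deriv_omega_fun_bound[of m] by metis
      then show ?thesis using that by (intro omega_fun_bound(1)[OF m, of B]) auto
    qed
    show "set_integrable lborel {0<..<pi} (\<lambda>d. omega_fun m (pi - d) * integral {0..2*pi} (\<lambda>a. meet_jacobian a d))"
      by (rule I(2))
    show "(LINT d:{0<..<pi}|lborel. omega_fun m (pi - d) * integral {0..2*pi} (\<lambda>a. meet_jacobian a d)) =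
      (LINT d:{0<..<pi}|lborel. deriv (omega_fun m) (pi - d) * corr.iso_area d) - pi ^ m * ((corr.r0 0 + corr.r2 0) / 2)"
      by (rule I(3))
    have "(\<lambda>v::real^2. indicator {0..<2*pi} (v $ 1) * indicator {0<..<pi} (v $ 2) * (omega_fun m (pi - v $ 2) * meet_jacobian (v $ 1) (v $ 2))) \<in> borel_measurable borel"
      unfolding meet_jacobian_def tl1_def tl2_def by measurable
    moreover have "(\<lambda>v::real^2. indicator {0..<2*pi} (v $ 1) * indicator {0<..<pi} (v $ 2) * (omega_fun m (pi - v $ 2) * meet_jacobian (v $ 1) (v $ 2)))
       = (\<lambda>v. indicator S v * (omega_fun m (pi - v $ 2) * meet_jacobian (v $ 1) (v $ 2)))"
      by (auto simp: S_def indicator_def)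
    ultimately show "(\<lambda>v. indicator S v * (omega_fun m (pi - v $ 2) * meet_jacobian (v $ 1) (v $ 2))) \<in> borel_measurable borel"
      by (simp only:)
    have "(\<lambda>P. indicator (- K) P * omega_fun m (if P \<in> K then pi else visual_angle \<gamma> P)) \<in> borel_measurable borel"
      using measurable_compose[OF visual_angle_measurable om_meas] closed_K
      by (intro borel_measurable_times borel_measurable_indicator) auto
    moreover have "(\<lambda>P. indicator (- K) P * omega_fun m (if P \<in> K then pi else visual_angle \<gamma> P)) =
        (\<lambda>P. indicator (- K) P *\<^sub>R omega_fun m (visual_angle \<gamma> P))"
      by (auto simp: indicator_def)
    ultimately show "set_borel_measurable borel ((\<lambda>v. meet (v $ 1) (v $ 2)) ` S) (\<lambda>P. omega_fun m (visual_angle \<gamma> P))"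
      unfolding image set_borel_measurable_def by (simp only:)
  qed auto
  then show ?thesis unfolding image area_K .
qed

end

theorem mainTheorem5:
  fixes K :: "(real^2) set" and \<gamma> :: "real \<Rightarrow> real^2" and F L :: real
    and c :: "nat \<Rightarrow> real" and m :: nat
  assumes "compact K" and "convex K"
    and "C2_boundary_param K \<gamma>"
    and "C2_fun (support_fun K)"
    and "F = measure lborel K"
    and "L = curve_length \<gamma>"
    and "\<And>k. (c k)\<^sup>2 = (fourier_a (support_fun K) k)\<^sup>2 + (fourier_b (support_fun K) k)\<^sup>2"
    and "m \<ge> 1"
  shows "set_integrable lborel (- K) (\<lambda>P. visual_angle \<gamma> P ^ m - sin (visual_angle \<gamma> P) ^ m) \<and>
    set_integrable lborel {0..pi} (M_integrand m) \<and>
    (\<forall>k\<ge>2. set_integrable lborel {0..pi} (beta_integrand m k)) \<and>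
    summable (\<lambda>k. beta_coeff m (k + 2) * (c (k + 2))\<^sup>2) \<and>
    (LINT P:- K|lborel. visual_angle \<gamma> P ^ m - sin (visual_angle \<gamma> P) ^ m)
      = - (pi ^ m) * F + M_coeff m * (L\<^sup>2 / (2 * pi))
        + pi * (\<Sum>k. beta_coeff m (k + 2) * (c (k + 2))\<^sup>2)"
proof -
  obtain p1 p2 where p: "\<And>a. (support_fun K has_vector_derivative p1 a) (at a)" "\<And>a. (p1 has_vector_derivative p2 a) (at a)"
      "continuous_on UNIV p2"
    using assms(4) by (auto simp: C2_fun_def)
  interpret smooth_oval K \<gamma> "support_fun K" p1 p2
    using assms p by unfold_locales (auto simp: has_real_derivative_iff_has_vector_derivative)
  have c: "(c k)\<^sup>2 = corr.fourier_sq k" for k using assms(7) by (simp add: corr.fourier_sq_def)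
  note ext = exterior_integral[OF assms(8)]
  define I where "I = (LINT d:{0<..<pi}|lborel. deriv (omega_fun m) (pi - d) * corr.iso_area d)"
  have ser: "(\<lambda>k. corr.corr_coeff k * beta_coeff m k) sums I"
    unfolding I_def by (rule corr.integral_isoptic_area_series)
  have "(\<lambda>k. corr.corr_coeff (k + 2) * beta_coeff m (k + 2)) sums (I - (\<Sum>k<2. corr.corr_coeff k * beta_coeff m k))"
    using ser by (rule sums_split_initial_segment)
  moreover have "(\<Sum>k<2. corr.corr_coeff k * beta_coeff m k) = M_coeff m * (L\<^sup>2 / (2 * pi))"
  proof -
    have "fourier_b (support_fun K) 0 = 0" by (simp add: fourier_b_def)
    then have "corr.corr_coeff 0 = L\<^sup>2 / (2 * pi)"
      unfolding assms(6) curve_length_fourier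
      by (simp add: corr.corr_coeff_def corr.fourier_sq_def power2_eq_square field_simps)
    then show ?thesis by (simp add: numeral_2_eq_2 beta_coeff_0 beta_coeff_1 mult.commute)
  qed
  moreover have "corr.corr_coeff (k + 2) * beta_coeff m (k + 2) = pi * (beta_coeff m (k + 2) * (c (k + 2))\<^sup>2)" for k
    by (simp add: corr.corr_coeff_def c mult_ac)
  ultimately have s: "(\<lambda>k. pi * (beta_coeff m (k + 2) * (c (k + 2))\<^sup>2)) sums (I - M_coeff m * (L\<^sup>2 / (2 * pi)))"
    by (simp only:)
  have "summable (\<lambda>k. beta_coeff m (k + 2) * (c (k + 2))\<^sup>2)"
    using summable_mult_D[OF sums_summable[OF s]] by simp
  moreover have "pi * (\<Sum>k. beta_coeff m (k + 2) * (c (k + 2))\<^sup>2) = I - M_coeff m * (L\<^sup>2 / (2 * pi))"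
    using sums_unique[OF s] suminf_mult[OF calculation, of pi] by simp
  ultimately show ?thesis
    using ext set_integrable_M[of m] set_integrable_beta[of m]
    unfolding omega_fun_def I_def[symmetric] assms(5) by simp
qed

end
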